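(* Let $f$ be a nonconstant meromorphic function on $\mathbb{C}$ with hyper order $\rho_2(f)<1$, let $c\in\mathbb{C}\setminus\{0\}$, and let $A$ be a nonzero constant. If $$E(0,f(z))\subseteq E(0,f(z+c)),\quad E(\infty,f(z+c))\subseteq E(\infty,f(z)),\quad \overline{E}(1,f(z))\subseteq\overline{E}(A,f(z+c)),$$ then $f(z+c)\equiv Af(z)$ or $f(z+c)\equiv f(z)$. In particular, if $A=1$, then $f(z+c)\equiv f(z)$.
   Context: For a meromorphic function $g$ and $a\in\mathbb{C}\cup\{\infty\}$, $E(a,g)$ denotes the set of zeros of $g-a$ (poles of $g$ if $a=\infty$) counted with multiplicity (a zero of multiplicity $m$ counted $m$ times), and $\overline{E}(a,g)$ denotes the set of such points each counted once. An inclusion $E(a,g)\subseteq E(b,h)$ means every $a$-point of $g$ of multiplicity $m$ is a $b$-point of $h$ of multiplicity at least $m$; $\overline{E}(a,g)\subseteq\overline{E}(b,h)$ means every $a$-point of $g$ is a $b$-point of $h$. The hyper order is $\rho_2(f)=\limsup_{r\to\infty}\frac{\log\log T(r,f)}{\log r}$, where $T(r,f)$ is the Nevanlinna characteristic. *)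

theory Defs
  imports "HOL-Complex_Analysis.Complex_Analysis"
begin

text \<open>Meromorphic functions on the plane are represented by nicely meromorphic
functions (removable singularities filled in, value 0 at poles).\<close>

definition log_plus :: "real \<Rightarrow> real" where
  "log_plus x = (if x \<le> 1 then 0 else ln x)"

definition apoint_mult :: "(complex \<Rightarrow> complex) \<Rightarrow> complex \<Rightarrow> complex \<Rightarrow> int" where
  "apoint_mult f a z = (if \<not> is_pole f z \<and> f z = a then zorder (\<lambda>w. f w - a) z else 0)"

definition pole_mult :: "(complex \<Rightarrow> complex) \<Rightarrow> complex \<Rightarrow> int" where
  "pole_mult f z = (if is_pole f z then - zorder f z else 0)"

definition pole_count :: "(complex \<Rightarrow> complex) \<Rightarrow> real \<Rightarrow> real" where
  "pole_count f t = real_of_int (\<Sum>z\<in>{z. norm z \<le> t \<and> is_pole f z}. pole_mult f z)"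

definition proximity :: "(complex \<Rightarrow> complex) \<Rightarrow> real \<Rightarrow> real" where
  "proximity f r = integral {0..2*pi} (\<lambda>\<theta>. log_plus (norm (f (of_real r * cis \<theta>)))) / (2*pi)"

definition counting :: "(complex \<Rightarrow> complex) \<Rightarrow> real \<Rightarrow> real" where
  "counting f r = integral {0..r} (\<lambda>t. (pole_count f t - pole_count f 0) / t)
                  + pole_count f 0 * ln r"

definition nevanlinna_T :: "(complex \<Rightarrow> complex) \<Rightarrow> real \<Rightarrow> real" where
  "nevanlinna_T f r = proximity f r + counting f r"

definition hyper_order :: "(complex \<Rightarrow> complex) \<Rightarrow> ereal" where
  "hyper_order f = Limsup at_top (\<lambda>r. ereal (ln (ln (nevanlinna_T f r)) / ln r))"

end

theory Submission
  imports Defs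
begin

text \<open>Write \<open>f = g / h\<close> with entire \<open>g\<close>, \<open>h\<close> without common zeros. The first two sharing conditions say that
  \<open>F(z) = f(z+c) / f(z)\<close> is entire. Its logarithm is subharmonic, so it is bounded by its area means over discs
  of radius \<open>\<rho>\<close>, and these are differences of area means of \<open>ln |f|\<close> over two discs that overlap up to a shell of
  relative area \<open>O(1/\<rho>)\<close>; hence the characteristic of \<open>F\<close> is at most a small multiple of that of \<open>f\<close> at a radius
  larger by a constant. The same holds for \<open>F\<^sub>j(z) = f(z+jc) / f(z)\<close>.

  If \<open>F\<close> is not constant, then \<open>f\<close> takes each of the small functions \<open>1\<close>, \<open>1/F\<^sub>1\<close>, \<open>1/F\<^sub>2\<close> only where \<open>f(z)\<close>, \<open>f(z+c)\<close>
  or \<open>f(z+2c)\<close> equals 1 (or where \<open>F\<^sub>2\<close> vanishes), that is, at zeros of entire functions built from the \<open>F\<^sub>j\<close>. A second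
  main theorem with three small targets, counting without multiplicity, then gives
  \<open>T(r) \<le> T(r+m)/4 + O(ln r)\<close>. As \<open>T\<close> grows subexponentially (hyper order below 1), iteration
  yields \<open>T(r) = O(ln r)\<close>, and the difference estimate with \<open>\<rho>\<close> proportional to \<open>r\<close> makes \<open>F\<close> constant
  after all. A constant \<open>F\<close> other than \<open>1\<close> and \<open>A\<close> is excluded by Picard's theorem, or, for \<open>F = -1\<close>, by
  applying the difference estimate to \<open>(f+1)/(f-1)\<close>.\<close>

section \<open>Circle means and Jensen's formula\<close>

text \<open>Hyper order below 1 is used only as \<open>subexp\<close>, that is log T(r) = o(r).
  Under this growth a loss of an additive constant in the radius is harmless during the iteration,
  whereas a lost factor would be fatal: T(r) = r satisfies T(r) <= T(2r)/2. This shapes every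
  estimate. The difference estimate uses discs of fixed radius \<rho>, a large multiple of |c|, and
  area means because Lebesgue measure is invariant under translation by c, so no Poisson kernel is
  needed.

  Exceptional sets of radii are avoided as well. Characteristics increase, so it suffices to work on
  one well-chosen circle slightly outside r. On a circle that keeps its distance from the zeros,
  logarithmic derivatives are bounded pointwise by a polynomial in r and T, which costs only O(ln r
  + ln T) after taking logarithms.

  The value 1 is shared without multiplicity, so the second main theorem must truncate. This is done
  by multiplying the Wronskian by a function that vanishes at least simply at all points to be
  counted; the resulting quotient is entire, and counting functions disappear because the mean of ln
  |Q| is bounded below for every nonzero entire Q.\<close>

definition cmean :: "(complex \<Rightarrow> real) \<Rightarrow> real \<Rightarrow> real" where
  "cmean \<phi> r = integral {0..2*pi} (\<lambda>t. \<phi> (of_real r * cis t)) / (2*pi)"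

abbreviation ln_norm :: "(complex \<Rightarrow> complex) \<Rightarrow> complex \<Rightarrow> real" where
  "ln_norm G \<equiv> \<lambda>z. ln (norm (G z))"

abbreviation ln_ratio :: "(complex \<Rightarrow> complex) \<Rightarrow> (complex \<Rightarrow> complex) \<Rightarrow> complex \<Rightarrow> real" where
  "ln_ratio G H \<equiv> \<lambda>z. \<bar>ln (norm (G z)) - ln (norm (H z))\<bar>"

text \<open>On a circle free of zeros \<open>ln_norm G\<close> is continuous, so its mean is the
  integral of a continuous function. A nonzero entire function has only finitely many bad radii in a
  bounded range, so a good radius can always be found nearby.\<close>

definition regular :: "(complex \<Rightarrow> complex) \<Rightarrow> real \<Rightarrow> bool" where
  "regular G r \<longleftrightarrow> (\<forall>a. norm a = r \<longrightarrow> G a \<noteq> 0)"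

lemma continuous_on_circle:
  assumes "continuous_on (sphere 0 r) \<phi>" "r \<ge> 0"
  shows "continuous_on X (\<lambda>t. \<phi> (of_real r * cis t))"
  by (rule continuous_on_compose2[OF assms(1)]) (use assms(2) in \<open>auto intro!: continuous_intros simp: norm_mult\<close>)

lemma circle_integrable:
  fixes \<phi> :: "complex \<Rightarrow> 'a::banach"
  assumes "continuous_on (sphere 0 r) \<phi>" "r \<ge> 0"
  shows "(\<lambda>t. \<phi> (of_real r * cis t)) integrable_on {0..2*pi}"
  using continuous_on_circle[OF assms] by (rule integrable_continuous_interval)

lemma cmean_cong:
  assumes "r \<ge> 0" "\<And>z. norm z = r \<Longrightarrow> \<phi> z = \<psi> z"
  shows "cmean \<phi> r = cmean \<psi> r"
  unfolding cmean_def using assms by (simp add: norm_mult)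

lemma cmean_const [simp]: "cmean (\<lambda>_. k) r = k"
  by (simp add: cmean_def)

lemma cmean_add:
  assumes "continuous_on (sphere 0 r) \<phi>" "continuous_on (sphere 0 r) \<psi>" "r \<ge> 0"
  shows "cmean (\<lambda>z. \<phi> z + \<psi> z) r = cmean \<phi> r + cmean \<psi> r"
  unfolding cmean_def using assms
  by (subst integral_add) (auto intro!: circle_integrable simp: add_divide_distrib)

lemma cmean_diff:
  assumes "continuous_on (sphere 0 r) \<phi>" "continuous_on (sphere 0 r) \<psi>" "r \<ge> 0"
  shows "cmean (\<lambda>z. \<phi> z - \<psi> z) r = cmean \<phi> r - cmean \<psi> r"
  unfolding cmean_def using assms
  by (subst integral_diff) (auto intro!: circle_integrable simp: diff_divide_distrib)

lemma cmean_cmult: "cmean (\<lambda>z. k * \<phi> z) r = k * cmean \<phi> r"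
  unfolding cmean_def by simp

lemma cmean_sum:
  assumes "finite A" "\<And>a. a \<in> A \<Longrightarrow> continuous_on (sphere 0 r) (\<phi> a)" "r \<ge> 0"
  shows "cmean (\<lambda>z. \<Sum>a\<in>A. \<phi> a z) r = (\<Sum>a\<in>A. cmean (\<phi> a) r)"
  using assms
proof (induction A rule: finite_induct)
  case (insert x F)
  then show ?case
    by (simp add: cmean_add continuous_on_sum)
qed simp

lemma cmean_mono:
  assumes "continuous_on (sphere 0 r) \<phi>" "continuous_on (sphere 0 r) \<psi>" "r \<ge> 0"
    and "\<And>z. norm z = r \<Longrightarrow> \<phi> z \<le> \<psi> z"
  shows "cmean \<phi> r \<le> cmean \<psi> r"
  unfolding cmean_def using assms
  by (intro divide_right_mono integral_le circle_integrable) (auto simp: norm_mult)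

lemma cmean_has_integral:
  assumes "continuous_on (sphere 0 r) \<phi>" "r \<ge> 0"
  shows "((\<lambda>t. \<phi> (of_real r * cis t)) has_integral (2*pi * cmean \<phi> r)) {0..2*pi}"
  using integrable_integral[OF circle_integrable[OF assms]] by (simp add: cmean_def)

lemma holomorphic_circle_integral:
  fixes H :: "complex \<Rightarrow> complex"
  assumes "H holomorphic_on ball 0 R" "0 < r" "r < R"
  shows "((\<lambda>t. H (of_real r * cis t)) has_integral (of_real (2 * pi) * H 0)) {0..2*pi}"
proof -
  have "H holomorphic_on cball 0 r"
    using assms by (auto intro: holomorphic_on_subset)
  then have "((\<lambda>u. H u/(u-0)) has_contour_integral (2 * of_real pi * \<i> * H 0)) (circlepath 0 r)"
    by (rule Cauchy_integral_circlepath_simple) (use assms in auto)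
  then have "((\<lambda>t. H (of_real r * cis t) / (of_real r * cis t) * of_real r * \<i> * cis t) has_integral
              (2 * of_real pi * \<i> * H 0)) {0..2*pi}"
    unfolding circlepath_def by (subst (asm) has_contour_integral_part_circlepath_iff) simp_all
  then have *: "((\<lambda>t. - \<i> * (H (of_real r * cis t) / (of_real r * cis t) * of_real r * \<i> * cis t)) has_integral
              (- \<i> * (2 * of_real pi * \<i> * H 0))) {0..2*pi}"
    by (rule has_integral_mult_right)
  have e1: "- \<i> * (H (of_real r * cis t) / (of_real r * cis t) * of_real r * \<i> * cis t) = H (of_real r * cis t)" for t
    using assms by (simp add: field_simps)
  have e2: "- \<i> * (2 * of_real pi * \<i> * H 0) = of_real (2 * pi) * H 0"
    by (simp add: algebra_simps)
  show ?thesis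
    using * unfolding e1 e2 .
qed

lemma cmean_Re_holomorphic:
  assumes "H holomorphic_on ball 0 R" "0 < r" "r < R"
  shows "cmean (\<lambda>z. Re (H z)) r = Re (H 0)"
  using has_integral_Re[OF holomorphic_circle_integral[OF assms]]
  by (simp add: cmean_def integral_unique)


text \<open>A zero-free \<open>H\<close> on the disc is \<open>exp L\<close>, and
  \<open>ln |H|\<close> is the real part of \<open>L\<close>.\<close>

lemma cmean_ln_nonvanishing:
  assumes "H holomorphic_on ball 0 R" "\<And>z. z \<in> ball 0 R \<Longrightarrow> H z \<noteq> 0" "0 < r" "r < R"
  shows "cmean (ln_norm H) r = ln (norm (H 0))"
proof -
  obtain L where L: "L holomorphic_on ball 0 R" "\<And>z. z \<in> ball 0 R \<Longrightarrow> exp (L z) = H z"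
    using holomorphic_logarithm_exists[of "ball 0 R" H 0] assms by auto
  have *: "ln (norm (H z)) = Re (L z)" if "z \<in> ball 0 R" for z
    by (simp flip: L(2)[OF that])
  have "cmean (ln_norm H) r = cmean (\<lambda>z. Re (L z)) r"
    by (rule cmean_cong) (use assms * in auto)
  also have "\<dots> = ln (norm (H 0))"
    using cmean_Re_holomorphic[OF L(1) assms(3,4)] *[of 0] assms(3,4) by simp
  finally show ?thesis .
qed

text \<open>If \<open>|a| > r\<close>, the function is zero-free on a larger disc. If
  \<open>|a| < r\<close>, the zero is reflected: on the circle
  \<open>|z - a| = |r - cnj a * z / r|\<close>, and the right-hand function is zero-free beyond the
  circle with value \<open>r\<close> at 0.\<close>

lemma cmean_ln_dist:
  assumes "0 < r" "norm a \<noteq> r"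
  shows "cmean (\<lambda>z. ln (norm (z - a))) r = ln (max r (norm a))"
proof (cases "norm a > r")
  case True
  then show ?thesis
    using cmean_ln_nonvanishing[of "\<lambda>z. z - a" "norm a" r] assms
    by (fastforce intro!: holomorphic_intros)
next
  case False
  with assms have less: "norm a < r" by simp
  \<comment> \<open>The reflected zero has modulus \<open>r^2 / |a|\<close>; for
    \<open>a = 0\<close> the reflected function is constant and any radius above \<open>r\<close>
    serves.\<close>
  define R where "R = (if a = 0 then 2 * r else r^2 / norm a)"
  have R: "r < R"
    using less assms by (auto simp: R_def field_simps power2_eq_square)
  have nz: "of_real r - cnj a * z / of_real r \<noteq> 0" if "z \<in> ball 0 R" for z
  proof
    assume "of_real r - cnj a * z / of_real r = 0"
    then have "cnj a * z = of_real (r^2)"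
      using assms by (simp add: field_simps power2_eq_square)
    then have "norm a * norm z = r^2"
      by (metis complex_mod_cnj norm_mult norm_of_real abs_power2)
    then show False
      using that assms by (auto simp: R_def field_simps split: if_splits)
  qed
  have "norm (of_real r * cis t - a) = norm (of_real r - cnj a * (of_real r * cis t) / of_real r)" for t
  proof -
    have "norm (of_real r * cis t - a) = norm (cnj (of_real r * cis t - a))"
      by (rule complex_mod_cnj[symmetric])
    also have "\<dots> = norm (cis t * cnj (of_real r * cis t - a))"
      by (simp add: norm_mult del: complex_cnj_diff)
    also have "cis t * cnj (of_real r * cis t - a) = of_real r - cnj a * (of_real r * cis t) / of_real r"
    proof -
      have "cis t * cnj (cis t) = 1"
        by (simp add: cis_cnj cis_mult)
      moreover have "cis t * cnj (of_real r * cis t - a) = of_real r * (cis t * cnj (cis t)) - cnj a * cis t"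
        by (simp add: algebra_simps)
      ultimately show ?thesis using assms by simp
    qed
    finally show ?thesis .
  qed
  then have "cmean (\<lambda>z. ln (norm (z - a))) r = cmean (\<lambda>z. ln (norm (of_real r - cnj a * z / of_real r))) r"
    by (simp add: cmean_def)
  also have "\<dots> = ln r"
    using cmean_ln_nonvanishing[of "\<lambda>z. of_real r - cnj a * z / of_real r" R r, OF _ nz assms(1) R] assms
    by (simp add: holomorphic_intros)
  finally show ?thesis using less by simp
qed

section \<open>Zeros of entire functions and Jensen's formula\<close>

definition zset :: "(complex \<Rightarrow> complex) \<Rightarrow> real \<Rightarrow> complex set" where
  "zset G R = {a. norm a < R \<and> G a = 0}"

definition zmult :: "(complex \<Rightarrow> complex) \<Rightarrow> complex \<Rightarrow> nat" where
  "zmult G a = nat (zorder G a)"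

definition zcount :: "(complex \<Rightarrow> complex) \<Rightarrow> real \<Rightarrow> real" where
  "zcount G R = (\<Sum>a\<in>zset G R. real (zmult G a))"

lemma finite_zset:
  assumes "G holomorphic_on UNIV" "G z0 \<noteq> 0"
  shows "finite (zset G R)"
proof (cases "G constant_on UNIV")
  case True
  then have "zset G R = {}"
    using assms(2) by (auto simp: zset_def constant_on_def)
  then show ?thesis by simp
next
  case False
  then have "finite {z \<in> cball 0 R. G z = 0}"
    by (intro holomorphic_compact_finite_zeros[OF assms(1)]) auto
  then show ?thesis
    by (rule rev_finite_subset) (auto simp: zset_def)
qed

lemma entire_eventually_nonzero:
  assumes "G holomorphic_on UNIV" "G z0 \<noteq> 0"
  shows "eventually (\<lambda>w. G w \<noteq> 0) (at z)"
  using non_zero_neighbour_alt[of G UNIV z z0] assms by (auto elim: eventually_mono)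

lemma frequently_at_complexI:
  assumes "eventually P (at (z::complex))"
  shows "frequently P (at z)"
  using assms eventually_frequently at_neq_bot by blast

lemma zmult_pos:
  assumes "G holomorphic_on UNIV" "G z0 \<noteq> 0" "G a = 0"
  shows "zmult G a > 0"
  using zorder_pos_iff[OF assms(1), of a] frequently_at_complexI[OF entire_eventually_nonzero[OF assms(1,2)]] assms(3)
  by (simp add: zmult_def)

lemma zero_factorization:
  assumes G: "G holomorphic_on UNIV" "G z0 \<noteq> 0" and "R > 0"
  obtains Z where "Z holomorphic_on ball 0 R" "\<And>z. z \<in> ball 0 R \<Longrightarrow> Z z \<noteq> 0"
    "\<And>z. z \<in> ball 0 R \<Longrightarrow> G z = Z z * (\<Prod>a\<in>zset G R. (z - a) ^ zmult G a)"
proof -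
  define P where "P z = (\<Prod>a\<in>zset G R. (z - a) ^ zmult G a)" for z
  have hP: "P holomorphic_on UNIV"
    unfolding P_def by (intro holomorphic_intros)
  have fin: "finite (zset G R)"
    using finite_zset[OF G] .
  have P0: "P z = 0 \<longleftrightarrow> G z = 0" if "z \<in> ball 0 R" for z
    using that fin zmult_pos[OF G] by (auto simp: P_def zset_def)
  have "\<exists>z. P z \<noteq> 0"
  proof -
    obtain z where "z \<notin> zset G R"
      using fin ex_new_if_finite infinite_UNIV_char_0 by blast
    then show ?thesis
      using fin by (intro exI[of _ z]) (auto simp: P_def)
  qed
  then obtain z1 where z1: "P z1 \<noteq> 0" by blast
  have zo: "zorder P z = zorder G z" if z: "z \<in> ball 0 R" for z
  proof (cases "G z = 0")
    case False
    have "zorder P z = 0"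
      using P0[OF z] False holomorphic_on_imp_analytic_at[OF hP] by (intro zorder_eq_0I) auto
    moreover have "zorder G z = 0"
      using False holomorphic_on_imp_analytic_at[OF G(1)] by (intro zorder_eq_0I) auto
    ultimately show ?thesis by simp
  next
    case True
    define Q where "Q w = (\<Prod>a\<in>zset G R - {z}. (w - a) ^ zmult G a)" for w
    have hQ: "Q holomorphic_on UNIV"
      unfolding Q_def by (intro holomorphic_intros)
    have zin: "z \<in> zset G R"
      using True z by (auto simp: zset_def)
    have PQ: "P w = Q w * (w - z) powi (int (zmult G z))" for w
      unfolding P_def Q_def by (subst prod.remove[OF fin zin]) (simp only: power_int_of_nat mult.commute)
    have "zorder P z = int (zmult G z)"
    proof (rule zorder_eqI[of UNIV z Q])
      show "Q z \<noteq> 0" using fin by (auto simp: Q_def)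
      show "P w = Q w * (w - z) powi int (zmult G z)" for w by (rule PQ)
    qed (simp_all add: hQ)
    also have "\<dots> = zorder G z"
      using zmult_pos[OF G True] by (simp add: zmult_def)
    finally show ?thesis .
  qed
  obtain h where h: "h holomorphic_on ball 0 R" "\<And>z. z \<in> ball 0 R \<Longrightarrow> h z \<noteq> 0"
     "\<And>z. z \<in> ball 0 R \<Longrightarrow> G z = h z * P z"
  proof (rule holomorphic_zorder_factorization[of G "ball 0 R" P])
    show "G holomorphic_on ball 0 R" "P holomorphic_on ball 0 R"
      using G(1) hP by (auto intro: holomorphic_on_subset)
    show "P z = 0 \<longleftrightarrow> G z = 0" if "z \<in> ball 0 R" for z
      using P0[OF that] .
    show "zorder P z = zorder G z" if "z \<in> ball 0 R" for z
      using zo[OF that] .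
  qed auto
  show ?thesis
    by (rule that[OF h(1,2)]) (simp_all only: h(3) P_def)
qed

lemma continuous_on_ln_norm [continuous_intros]:
  assumes "continuous_on X G" "\<And>z. z \<in> X \<Longrightarrow> G z \<noteq> 0"
  shows "continuous_on X (\<lambda>z. ln (norm (G z :: complex)))"
  using assms by (auto intro!: continuous_intros)

lemma entire_continuous_on: "G holomorphic_on UNIV \<Longrightarrow> continuous_on X G"
  using holomorphic_on_imp_continuous_on continuous_on_subset by blast

lemma regular_ln_continuous:
  assumes "G holomorphic_on UNIV" "regular G r"
  shows "continuous_on (sphere 0 r) (ln_norm G)"
  by (rule continuous_on_ln_norm) (use assms in \<open>auto simp: regular_def entire_continuous_on\<close>)

text \<open>Factor out the zeros and average term by term. \<open>K\<close> is fixed before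
  \<open>r\<close>, so differences of means at two radii below \<open>R\<close> become sums over
  zeros. It is \<open>ln |Z 0|\<close> for the zero-free factor \<open>Z\<close>, hence
  \<open>G 0 = 0\<close> is allowed.\<close>

lemma jensen:
  assumes G: "G holomorphic_on UNIV" "G z0 \<noteq> 0" and "R > 0"
  obtains K where "\<And>r. 0 < r \<Longrightarrow> r < R \<Longrightarrow> regular G r \<Longrightarrow>
     cmean (ln_norm G) r = (\<Sum>a\<in>zset G R. real (zmult G a) * ln (max r (norm a))) + K"
proof -
  obtain Z where Z: "Z holomorphic_on ball 0 R" "\<And>z. z \<in> ball 0 R \<Longrightarrow> Z z \<noteq> 0"
    "\<And>z. z \<in> ball 0 R \<Longrightarrow> G z = Z z * (\<Prod>a\<in>zset G R. (z - a) ^ zmult G a)"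
    using zero_factorization[OF G \<open>R > 0\<close>] by blast
  have fin: "finite (zset G R)"
    using finite_zset[OF G] .
  show ?thesis
  proof (rule that)
    fix r assume r: "0 < r" "r < R" "regular G r"
    have ne: "z \<noteq> a" if "norm z = r" "a \<in> zset G R" for z a
      using r that by (auto simp: regular_def zset_def)
    have contZ: "continuous_on (sphere 0 r) (ln_norm Z)"
      using Z(1,2) r by (intro continuous_intros) (auto intro: continuous_on_subset[OF holomorphic_on_imp_continuous_on[OF Z(1)]])
    have cont: "continuous_on (sphere 0 r) (\<lambda>z. real (zmult G a) * ln (norm (z - a)))" if "a \<in> zset G R" for a
      using ne[OF _ that] by (intro continuous_intros) auto
    have "cmean (ln_norm G) r =
          cmean (\<lambda>z. (\<Sum>a\<in>zset G R. real (zmult G a) * ln (norm (z - a))) + ln (norm (Z z))) r"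
    proof (rule cmean_cong)
      fix z :: complex assume z: "norm z = r"
      have "norm (G z) = norm (Z z) * (\<Prod>a\<in>zset G R. norm (z - a) ^ zmult G a)"
        using z r by (simp add: Z(3) norm_mult norm_power flip: prod_norm)
      also have "ln \<dots> = ln (norm (Z z)) + ln (\<Prod>a\<in>zset G R. norm (z - a) ^ zmult G a)"
        using z r Z(2)[of z] ne[OF z] by (intro ln_mult_pos prod_pos) auto
      also have "ln (\<Prod>a\<in>zset G R. norm (z - a) ^ zmult G a) = (\<Sum>a\<in>zset G R. real (zmult G a) * ln (norm (z - a)))"
        using ne[OF z] fin by (subst ln_prod) (auto simp: ln_realpow)
      finally show "ln (norm (G z)) = (\<Sum>a\<in>zset G R. real (zmult G a) * ln (norm (z - a))) + ln (norm (Z z))"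
        by simp
    qed (use r in auto)
    also have "\<dots> = (\<Sum>a\<in>zset G R. real (zmult G a) * cmean (\<lambda>z. ln (norm (z - a))) r) + cmean (ln_norm Z) r"
      using r contZ cont fin by (simp add: cmean_add cmean_sum continuous_on_sum cmean_cmult)
    also have "cmean (ln_norm Z) r = ln (norm (Z 0))"
      using cmean_ln_nonvanishing[OF Z(1,2)] r by auto
    also have "(\<Sum>a\<in>zset G R. real (zmult G a) * cmean (\<lambda>z. ln (norm (z - a))) r) =
               (\<Sum>a\<in>zset G R. real (zmult G a) * ln (max r (norm a)))"
    proof (rule sum.cong)
      fix a assume "a \<in> zset G R"
      then show "real (zmult G a) * cmean (\<lambda>z. ln (norm (z - a))) r = real (zmult G a) * ln (max r (norm a))"
        using ne[of a a] r by (subst cmean_ln_dist) auto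
    qed simp
    finally show "cmean (ln_norm G) r =
       (\<Sum>a\<in>zset G R. real (zmult G a) * ln (max r (norm a))) + ln (norm (Z 0))" .
  qed
qed

text \<open>In Jensen's sum a zero with \<open>|a| < r1\<close> gains exactly
  \<open>ln (r2 / r1)\<close> between the two radii, and no other zero loses. This yields both the
  monotonicity of the means and, later, a bound for the number of zeros.\<close>

lemma cmean_ln_mono:
  assumes G: "G holomorphic_on UNIV" "G z0 \<noteq> 0" and r: "0 < r1" "r1 \<le> r2" "regular G r1" "regular G r2"
  shows "zcount G r1 * ln (r2 / r1) \<le> cmean (ln_norm G) r2 - cmean (ln_norm G) r1"
proof -
  obtain K where K: "\<And>r. 0 < r \<Longrightarrow> r < r2 + 1 \<Longrightarrow> regular G r \<Longrightarrow>
     cmean (ln_norm G) r = (\<Sum>a\<in>zset G (r2+1). real (zmult G a) * ln (max r (norm a))) + K"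
    using jensen[OF G, of "r2 + 1"] r by auto
  have sub: "zset G r1 \<subseteq> zset G (r2+1)"
    using r by (auto simp: zset_def)
  have "cmean (ln_norm G) r2 - cmean (ln_norm G) r1 =
     (\<Sum>a\<in>zset G (r2+1). real (zmult G a) * (ln (max r2 (norm a)) - ln (max r1 (norm a))))"
    using K[of r1] K[of r2] r by (simp add: sum_subtractf right_diff_distrib)
  also have "\<dots> \<ge> (\<Sum>a\<in>zset G r1. real (zmult G a) * (ln (max r2 (norm a)) - ln (max r1 (norm a))))"
    using r by (intro sum_mono2 finite_zset[OF G] sub mult_nonneg_nonneg) auto
  moreover have "(\<Sum>a\<in>zset G r1. real (zmult G a) * (ln (max r2 (norm a)) - ln (max r1 (norm a)))) =
                 zcount G r1 * ln (r2 / r1)"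
    unfolding zcount_def sum_distrib_right
  proof (rule sum.cong)
    fix a assume "a \<in> zset G r1"
    then show "real (zmult G a) * (ln (max r2 (norm a)) - ln (max r1 (norm a))) = real (zmult G a) * ln (r2 / r1)"
      using r by (auto simp: zset_def max_def ln_div)
  qed simp
  ultimately show ?thesis by simp
qed

lemma zcount_nonneg: "zcount G r \<ge> 0"
  unfolding zcount_def by (intro sum_nonneg) auto

lemma cmean_ln_mono':
  assumes G: "G holomorphic_on UNIV" "G z0 \<noteq> 0" and r: "0 < r1" "r1 \<le> r2" "regular G r1" "regular G r2"
  shows "cmean (ln_norm G) r1 \<le> cmean (ln_norm G) r2"
proof -
  have "0 \<le> zcount G r1 * ln (r2 / r1)"
    using r by (intro mult_nonneg_nonneg zcount_nonneg) auto
  then show ?thesis using cmean_ln_mono[OF assms] by simp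
qed

lemma finite_irregular:
  assumes G: "G holomorphic_on UNIV" "G z0 \<noteq> 0"
  shows "finite {r. 0 \<le> r \<and> r \<le> R \<and> \<not> regular G r}"
proof -
  have "{r. 0 \<le> r \<and> r \<le> R \<and> \<not> regular G r} \<subseteq> norm ` zset G (R+1)"
    by (auto simp: regular_def zset_def)
  then show ?thesis
    using finite_zset[OF G] finite_surj by blast
qed

lemma ex_regular:
  assumes G: "G holomorphic_on UNIV" "G z0 \<noteq> 0" and "0 \<le> x" "x < y"
  obtains r where "x < r" "r < y" "regular G r"
proof -
  have "infinite {x<..<y}"
    using \<open>x < y\<close> by simp
  then have "infinite ({x<..<y} - {r. 0 \<le> r \<and> r \<le> y \<and> \<not> regular G r})"
    using finite_irregular[OF G] by simp
  then obtain r where "r \<in> {x<..<y} - {r. 0 \<le> r \<and> r \<le> y \<and> \<not> regular G r}"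
    using infinite_imp_nonempty by blast
  then show ?thesis using that assms by auto
qed

text \<open>Equality holds on tiny circles inside a zero-free neighbourhood of 0, and the means
  increase with the radius.\<close>

lemma submean_ln:
  assumes G: "G holomorphic_on UNIV" "G 0 \<noteq> 0" and r: "0 < r" "regular G r"
  shows "ln (norm (G 0)) \<le> cmean (ln_norm G) r"
proof -
  obtain e where e: "e > 0" "\<And>z. norm z < e \<Longrightarrow> G z \<noteq> 0"
    using continuous_at_avoid[of 0 G 0] G
    by (metis dist_0_norm entire_continuous_on continuous_on_eq_continuous_at open_UNIV UNIV_I)
  define s where "s = min (e/2) r"
  have s: "0 < s" "s < e" "s \<le> r"
    using e r by (auto simp: s_def)
  have "cmean (ln_norm G) s = ln (norm (G 0))"
    using G e s by (intro cmean_ln_nonvanishing[of _ e]) (auto intro: holomorphic_on_subset)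
  moreover have "cmean (ln_norm G) s \<le> cmean (ln_norm G) r"
    using s e r by (intro cmean_ln_mono'[OF G]) (auto simp: regular_def)
  ultimately show ?thesis by simp
qed

lemma cmean_ln_lower:
  assumes G: "G holomorphic_on UNIV" "G z0 \<noteq> 0"
  obtains C where "C \<ge> 0" "\<And>r. r \<ge> 1 \<Longrightarrow> regular G r \<Longrightarrow> - C \<le> cmean (ln_norm G) r"
proof -
  obtain r0 where r0: "0 < r0" "r0 < 1" "regular G r0"
    using ex_regular[OF G, of 0 1] by auto
  show ?thesis
  proof (rule that)
    show "- \<bar>cmean (ln_norm G) r0\<bar> \<le> cmean (ln_norm G) r" if "r \<ge> 1" "regular G r" for r
      using cmean_ln_mono'[OF G r0(1) _ r0(3) that(2)] that r0 by linarith
  qed auto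
qed

section \<open>The characteristic of a quotient of entire functions\<close>

text \<open>Cartan's form of the Nevanlinna characteristic of \<open>g / h\<close>, up to an additive constant.\<close>

definition Vmax :: "(complex \<Rightarrow> complex) \<Rightarrow> (complex \<Rightarrow> complex) \<Rightarrow> complex \<Rightarrow> real" where
  "Vmax g h z = ln (max (norm (g z)) (norm (h z)))"

definition Tchar :: "(complex \<Rightarrow> complex) \<Rightarrow> (complex \<Rightarrow> complex) \<Rightarrow> real \<Rightarrow> real" where
  "Tchar g h r = cmean (Vmax g h) r"

text \<open>\<open>Vone F\<close> is log+ |F|, and \<open>Tone F\<close> is the Nevanlinna
  characteristic of an entire \<open>F\<close>, which consists of its proximity function
  alone.\<close>

abbreviation "Vone F \<equiv> Vmax F (\<lambda>_. 1)"

abbreviation "Tone F \<equiv> Tchar F (\<lambda>_. 1)"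

section \<open>Circle means as functions of the radius\<close>

lemma cmean_continuous:
  assumes "continuous_on UNIV \<phi>"
  shows "continuous_on X (cmean \<phi>)"
proof -
  have "continuous_on X (\<lambda>r. integral (cbox 0 (2*pi)) (\<lambda>t. \<phi> (of_real r * cis t)))"
    by (rule integral_continuous_on_param)
       (auto simp: case_prod_unfold intro!: continuous_on_compose2[OF assms] continuous_intros)
  then show ?thesis
    unfolding cmean_def by (auto intro!: continuous_intros)
qed

lemma circle_integral_rotate:
  fixes \<phi> :: "complex \<Rightarrow> real"
  assumes "continuous_on (sphere 0 r) \<phi>" "r \<ge> 0" "0 \<le> \<alpha>" "\<alpha> \<le> 2*pi"
  shows "integral {0..2*pi} (\<lambda>t. \<phi> (of_real r * cis (\<alpha> + t))) = integral {0..2*pi} (\<lambda>t. \<phi> (of_real r * cis t)) "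
proof -
  define p where "p t = \<phi> (of_real r * cis t)" for t
  have cont: "continuous_on X p" for X :: "real set"
    unfolding p_def by (rule continuous_on_circle[OF assms(1,2)])
  have int: "p integrable_on {a..b}" for a b
    by (rule integrable_continuous_interval[OF cont])
  have per: "p (t + 2 * pi) = p t" for t
    by (simp add: p_def flip: cis_mult)
  have "integral {0..2*pi} (\<lambda>t. p (\<alpha> + t)) = integral {\<alpha>..2*pi+\<alpha>} p"
    using integral_shift[of 0 \<alpha> "2*pi" p] cont by (simp add: o_def add.commute)
  also have "\<dots> = integral {\<alpha>..2*pi} p + integral {2*pi..2*pi+\<alpha>} p"
    using assms int by (intro Henstock_Kurzweil_Integration.integral_combine[symmetric]) auto
  also have "integral {2*pi..2*pi+\<alpha>} p = integral {0..\<alpha>} p"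
    using integral_shift[of 0 "2*pi" \<alpha> p] cont per by (simp add: o_def add.commute)
  also have "integral {\<alpha>..2*pi} p + integral {0..\<alpha>} p = integral {0..2*pi} p"
    using assms int Henstock_Kurzweil_Integration.integral_combine[of 0 \<alpha> "2*pi" p] by simp
  finally show ?thesis
    unfolding p_def .
qed

lemma cmean_rotate:
  assumes "continuous_on (sphere 0 r) \<phi>" "r \<ge> 0" "0 \<le> \<alpha>" "\<alpha> \<le> 2*pi"
  shows "cmean (\<lambda>z. \<phi> (cis \<alpha> * z)) r = cmean \<phi> r"
proof -
  have eq: "cis \<alpha> * (of_real r * cis t) = of_real r * cis (\<alpha> + t)" for t
    by (simp add: cis_mult[symmetric])
  show ?thesis
    unfolding cmean_def eq using circle_integral_rotate[OF assms] by simp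
qed

lemma cmean_swap:
  assumes "continuous_on UNIV (\<lambda>(x,y). f x y)"
  shows "cmean (\<lambda>x. cmean (\<lambda>y. f x y) r) s = cmean (\<lambda>y. cmean (\<lambda>x. f x y) s) r"
proof -
  have "integral (cbox 0 (2*pi)) (\<lambda>x. integral (cbox 0 (2*pi)) (\<lambda>y. f (of_real s * cis x) (of_real r * cis y))) =
        integral (cbox 0 (2*pi)) (\<lambda>y. integral (cbox 0 (2*pi)) (\<lambda>x. f (of_real s * cis x) (of_real r * cis y)))"
    by (rule integral_swap_continuous)
       (auto simp: case_prod_unfold intro!: continuous_on_compose2[OF assms, of _ "\<lambda>p. (of_real s * cis (fst p), of_real r * cis (snd p))", simplified] continuous_intros)
  then show ?thesis
    by (simp add: cmean_def)
qed

text \<open>Averaging \<open>V\<close> over rotations gives a radial function \<open>A\<close> whose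
  value on a circle is the mean of \<open>V\<close> there. It inherits continuity and the submean
  inequality, so the claim is the maximum principle for \<open>A\<close>. A small multiple of
  \<open>|z|^2\<close> is added to make the submean inequality strict and to force the maximum onto
  the boundary.\<close>

lemma submean_radial_mono:
  fixes V :: "complex \<Rightarrow> real"
  assumes cont: "continuous_on UNIV V"
    and sub: "\<And>z s. s > 0 \<Longrightarrow> V z \<le> cmean (\<lambda>w. V (z + w)) s"
    and r: "0 \<le> r1" "r1 \<le> r2"
  shows "cmean V r1 \<le> cmean V r2"
proof -
  note contc = continuous_on_compose2[OF cont _ subset_UNIV]
  define A where "A z = cmean (\<lambda>w. V (z * w)) 1" for z
  have Acirc: "A z = cmean V (norm z)" for z
  proof -
    have "z = of_real (norm z) * cis (Arg2pi z)"
      by (simp add: Arg2pi_eq complex_norm_eq_1_exp cis_conv_exp flip: Arg2pi_eq)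
    then have "A z = cmean (\<lambda>w. V (of_real (norm z) * cis (Arg2pi z) * w)) 1"
      unfolding A_def by metis
    also have "\<dots> = cmean (\<lambda>w. V (cis (Arg2pi z) * w)) (norm z)"
      by (simp add: cmean_def mult_ac)
    also have "\<dots> = cmean V (norm z)"
      by (rule cmean_rotate) (auto intro: continuous_on_subset[OF cont] simp: Arg2pi less_imp_le)
    finally show ?thesis .
  qed
  have contA: "continuous_on UNIV A"
    unfolding Acirc
    by (rule continuous_on_compose2[OF cmean_continuous[OF cont, of UNIV]]) (auto intro!: continuous_intros)
  note contAc = continuous_on_compose2[OF contA _ subset_UNIV]
  have subA: "A z \<le> cmean (\<lambda>w. A (z + w)) s" if "s > 0" for z s
  proof -
    \<comment> \<open>The submean inequality at \<open>z * u\<close> is averaged over unit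
      \<open>u\<close>. Writing the displacement as \<open>u * w\<close> does not change the inner
      circle mean and makes the integrand a rotation of \<open>V\<close> at
      \<open>z + w\<close>.\<close>
    have "A z \<le> cmean (\<lambda>u. cmean (\<lambda>w. V (z * u + u * w)) s) 1"
      unfolding A_def
    proof (rule cmean_mono)
      fix u :: complex assume u: "norm u = 1"
      have ueq: "u = cis (Arg2pi u)"
        using u by (metis Arg2pi_eq cis_conv_exp mult_1 of_real_1)
      have "V (z * u) \<le> cmean (\<lambda>w. V (z * u + w)) s"
        by (rule sub[OF that])
      also have "\<dots> = cmean (\<lambda>w. V (z * u + cis (Arg2pi u) * w)) s"
        using that by (intro cmean_rotate[symmetric, of s "\<lambda>w. V (z * u + w)"])
           (auto intro!: contc continuous_intros simp: Arg2pi less_imp_le)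
      finally show "V (z * u) \<le> cmean (\<lambda>w. V (z * u + u * w)) s"
        using ueq by simp
    next
      show "continuous_on (sphere 0 1) (\<lambda>u. cmean (\<lambda>w. V (z * u + u * w)) s)"
        unfolding cmean_def
        by (intro continuous_intros integral_continuous_on_param[of _ 0 "2*pi", simplified])
           (auto simp: case_prod_unfold intro!: contc continuous_intros)
    qed (auto intro!: contc continuous_intros)
    also have "\<dots> = cmean (\<lambda>w. cmean (\<lambda>u. V (z * u + u * w)) 1) s"
      by (rule cmean_swap) (auto simp: case_prod_unfold intro!: contc continuous_intros)
    also have "\<dots> = cmean (\<lambda>w. A (z + w)) s"
      by (simp add: A_def algebra_simps)
    finally show ?thesis .
  qed
  show ?thesis
  proof (cases "r1 = r2")
    case False
    then have r12: "r1 < r2" using r by simp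
    show ?thesis
    proof (rule field_le_epsilon)
      fix e :: real assume "e > 0"
      \<comment> \<open>On the disc of radius \<open>r2\<close> the perturbation
        \<open>d * |z|^2\<close> is at most \<open>e\<close>.\<close>
      define d where "d = e / r2^2"
      have d: "d > 0" using \<open>e > 0\<close> r12 r by (simp add: d_def)
      define B where "B z = A z + d * (norm z)^2" for z
      obtain z0 where z0: "norm z0 \<le> r2" "\<And>z. norm z \<le> r2 \<Longrightarrow> B z \<le> B z0"
      proof -
        have "continuous_on (cball 0 r2) B"
          unfolding B_def by (intro continuous_intros contAc)
        then obtain z0 where "z0 \<in> cball 0 r2" "\<And>z. z \<in> cball 0 r2 \<Longrightarrow> B z \<le> B z0"
          using continuous_attains_sup[of "cball 0 r2" B] r12 r by auto
        then show ?thesis using that by auto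
      qed
      have "norm z0 = r2"
      proof (rule ccontr)
        assume "norm z0 \<noteq> r2"
        \<comment> \<open>The circle of this radius about \<open>z0\<close> stays in the disc. The
          mean of \<open>|z0 + w|^2\<close> over it exceeds \<open>|z0|^2\<close> by the squared
          radius, because the mixed term \<open>q\<close> is the real part of a linear function and
          has mean 0.\<close>
        then have s: "r2 - norm z0 > 0" (is "?s > 0") using z0 by simp
        define q where "q w = 2 * Re (cnj z0 * w)" for w
        have nq: "(norm (z0 + w))^2 = (norm z0)^2 + (norm w)^2 + q w" for w
          unfolding q_def by (simp add: cmod_power2) (simp add: power2_eq_square algebra_simps)
        have cq: "continuous_on X q" for X unfolding q_def by (intro continuous_intros)
        have "cmean q ?s = 2 * cmean (\<lambda>w. Re (cnj z0 * w)) ?s"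
          unfolding q_def by (rule cmean_cmult)
        also have "cmean (\<lambda>w. Re (cnj z0 * w)) ?s = 0"
          using cmean_Re_holomorphic[of "\<lambda>w. cnj z0 * w" "?s + 1" ?s] s
          by (simp only: holomorphic_intros) simp
        finally have "cmean q ?s = 0" by simp
        then have "A z0 + d * (norm z0)^2 + d * ?s^2 \<le> cmean (\<lambda>w. A (z0 + w)) ?s + cmean (\<lambda>w. d * ((norm z0)^2 + ?s^2) + d * q w) ?s"
          using subA[OF s, of z0] s by (subst cmean_add) (auto simp: cmean_cmult algebra_simps intro!: continuous_intros cq)
        also have "\<dots> = cmean (\<lambda>w. A (z0 + w) + (d * ((norm z0)^2 + ?s^2) + d * q w)) ?s"
          using s by (subst cmean_add) (auto intro!: continuous_intros cq contAc)
        also have "\<dots> \<le> cmean (\<lambda>w. B z0) ?s"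
        proof (rule cmean_mono)
          fix w :: complex assume w: "norm w = ?s"
          have "norm (z0 + w) \<le> r2" using norm_triangle_ineq[of z0 w] w by simp
          then have "B (z0 + w) \<le> B z0" by (rule z0)
          then show "A (z0 + w) + (d * ((norm z0)^2 + ?s^2) + d * q w) \<le> B z0"
            unfolding B_def nq w by (simp add: algebra_simps)
        qed (use s in \<open>auto intro!: continuous_intros cq contAc\<close>)
        finally have "d * ?s^2 \<le> 0" by (simp add: B_def)
        then show False using d s by (simp add: mult_le_0_iff)
      qed
      have "cmean V r1 \<le> B (of_real r1)"
        using r d by (simp add: B_def Acirc)
      also have "\<dots> \<le> B z0" using r by (intro z0) simp
      also have "\<dots> = cmean V r2 + e"
        using \<open>norm z0 = r2\<close> r r12 by (simp add: B_def Acirc d_def)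
      finally show "cmean V r1 \<le> cmean V r2 + e" .
    qed
  qed simp
qed

locale coprime_pair =
  fixes g h :: "complex \<Rightarrow> complex"
  assumes g: "g holomorphic_on UNIV" and h: "h holomorphic_on UNIV"
    and coprime: "\<And>z. g z \<noteq> 0 \<or> h z \<noteq> 0"
begin

lemma Vmax_arg_pos: "max (norm (g z)) (norm (h z)) > 0"
  using coprime[of z] by (auto simp: less_max_iff_disj)

lemma Vmax_continuous: "continuous_on X (Vmax g h)"
proof -
  have "max (norm (g z)) (norm (h z)) \<noteq> 0" for z
    using Vmax_arg_pos[of z] by simp
  then show ?thesis
    unfolding Vmax_def by (intro continuous_intros entire_continuous_on g h) auto
qed

lemma Vmax_ge_g: "g z \<noteq> 0 \<Longrightarrow> ln (norm (g z)) \<le> Vmax g h z"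
  and Vmax_ge_h: "h z \<noteq> 0 \<Longrightarrow> ln (norm (h z)) \<le> Vmax g h z"
  unfolding Vmax_def by (subst ln_le_cancel_iff; simp add: less_max_iff_disj)+

text \<open>For \<open>ln |G|\<close> the inequality is available on regular circles only. Regular
  radii tending to \<open>s\<close> transfer it to \<open>s\<close>, since the mean of the
  continuous \<open>Vmax\<close> depends continuously on the radius.\<close>

lemma submean_Vmax_aux:
  fixes z :: complex
  assumes G: "G holomorphic_on UNIV" "G z \<noteq> 0" and "s > 0"
    and le: "\<And>z. G z \<noteq> 0 \<Longrightarrow> ln (norm (G z)) \<le> Vmax g h z"
  shows "ln (norm (G z)) \<le> cmean (\<lambda>w. Vmax g h (z + w)) s"
proof -
  define H where "H w = G (z + w)" for w
  have "(G \<circ> (\<lambda>w. z + w)) holomorphic_on UNIV"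
    by (intro holomorphic_on_compose_gen[OF _ G(1)] holomorphic_intros) auto
  then have H: "H holomorphic_on UNIV" "H 0 \<noteq> 0"
    using G(2) by (simp_all add: H_def o_def[abs_def] H_def[abs_def])
  have cV: "continuous_on X (\<lambda>w. Vmax g h (z + w))" for X :: "complex set"
    by (rule continuous_on_compose2[OF Vmax_continuous[of UNIV]]) (auto intro!: continuous_intros)
  have reg: "ln (norm (G z)) \<le> cmean (\<lambda>w. Vmax g h (z + w)) t" if "t > 0" "regular H t" for t :: real
  proof -
    have "ln (norm (H 0)) \<le> cmean (ln_norm H) t"
      using submean_ln[OF H that] .
    also have "\<dots> \<le> cmean (\<lambda>w. Vmax g h (z + w)) t"
      by (rule cmean_mono[OF regular_ln_continuous[OF H(1) that(2)] cV])
         (use that le in \<open>auto simp: H_def regular_def\<close>)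
    finally show ?thesis by (simp add: H_def)
  qed
  have "\<exists>t. s < t \<and> t < s + inverse (real (Suc n)) \<and> regular H t" for n
    using ex_regular[OF H, of s "s + inverse (real (Suc n))"] \<open>s > 0\<close> by auto
  then obtain t where t: "\<And>n. s < t n \<and> t n < s + inverse (real (Suc n)) \<and> regular H (t n)"
    by metis
  have "t \<longlonglongrightarrow> s"
  proof (rule tendsto_sandwich[where f = "\<lambda>_. s" and h = "\<lambda>n. s + inverse (real (Suc n))"])
    show "(\<lambda>n. s + inverse (real (Suc n))) \<longlonglongrightarrow> s"
      using tendsto_add[OF tendsto_const LIMSEQ_inverse_real_of_nat, of s] by simp
    show "(\<lambda>_. s) \<longlonglongrightarrow> s" by simp
    show "\<forall>\<^sub>F n in sequentially. s \<le> t n"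
      by (rule always_eventually) (use t less_imp_le in blast)
    show "\<forall>\<^sub>F n in sequentially. t n \<le> s + inverse (real (Suc n))"
      by (rule always_eventually) (use t less_imp_le in blast)
  qed
  moreover have "isCont (cmean (\<lambda>w. Vmax g h (z + w))) s"
    using cmean_continuous[OF cV, of UNIV] by (simp add: continuous_on_eq_continuous_at)
  ultimately have "(\<lambda>n. cmean (\<lambda>w. Vmax g h (z + w)) (t n)) \<longlonglongrightarrow> cmean (\<lambda>w. Vmax g h (z + w)) s"
    by (simp add: isCont_tendsto_compose)
  moreover have "ln (norm (G z)) \<le> cmean (\<lambda>w. Vmax g h (z + w)) (t n)" for n
    using t[of n] \<open>s > 0\<close> by (intro reg) auto
  ultimately show ?thesis
    by (intro LIMSEQ_le_const) auto
qed

lemma submean_Vmax: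
  assumes "s > 0"
  shows "Vmax g h z \<le> cmean (\<lambda>w. Vmax g h (z + w)) s"
proof (cases "norm (g z) \<ge> norm (h z)")
  case True
  then have "g z \<noteq> 0" "Vmax g h z = ln (norm (g z))"
    using coprime[of z] by (auto simp: Vmax_def max_def)
  then show ?thesis
    using submean_Vmax_aux[OF g _ assms Vmax_ge_g] by simp
next
  case False
  then have "h z \<noteq> 0" "Vmax g h z = ln (norm (h z))"
    by (auto simp: Vmax_def max_def)
  then show ?thesis
    using submean_Vmax_aux[OF h _ assms Vmax_ge_h] by simp
qed

lemma Tchar_mono:
  assumes "0 \<le> r" "r \<le> s"
  shows "Tchar g h r \<le> Tchar g h s"
  unfolding Tchar_def by (rule submean_radial_mono[OF Vmax_continuous submean_Vmax assms])

text \<open>If \<open>x\<close> and \<open>y\<close> are at most \<open>V\<close>, then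
  \<open>|x - y| \<le> 2 * V - x - y\<close>, and the means of \<open>ln |g|\<close> and
  \<open>ln |h|\<close> are bounded below. In Nevanlinna's terms this is m(r,f) + m(r,1/f) <= 2
  T(r,f) + O(1).\<close>

lemma cmean_ln_quotient:
  assumes "\<exists>z. g z \<noteq> 0" "\<exists>z. h z \<noteq> 0"
  obtains C where "C \<ge> 0"
    "\<And>r. r \<ge> 1 \<Longrightarrow> regular g r \<Longrightarrow> regular h r \<Longrightarrow>
       cmean (ln_ratio g h) r \<le> 2 * Tchar g h r + C"
proof -
  obtain C1 where C1: "C1 \<ge> 0" "\<And>r. r \<ge> 1 \<Longrightarrow> regular g r \<Longrightarrow> - C1 \<le> cmean (ln_norm g) r"
    using assms(1) cmean_ln_lower[OF g] by metis
  obtain C2 where C2: "C2 \<ge> 0" "\<And>r. r \<ge> 1 \<Longrightarrow> regular h r \<Longrightarrow> - C2 \<le> cmean (ln_norm h) r"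
    using assms(2) cmean_ln_lower[OF h] by metis
  show ?thesis
  proof (rule that)
    show "C1 + C2 \<ge> 0" using C1 C2 by simp
    fix r :: real assume r: "r \<ge> 1" "regular g r" "regular h r"
    have c: "continuous_on (sphere 0 r) (ln_norm g)" "continuous_on (sphere 0 r) (ln_norm h)"
      using regular_ln_continuous[OF g] regular_ln_continuous[OF h] r by auto
    have "cmean (ln_ratio g h) r \<le>
          cmean (\<lambda>z. (2 * Vmax g h z - ln (norm (g z))) - ln (norm (h z))) r"
    proof (rule cmean_mono)
      fix z :: complex assume "norm z = r"
      then have "g z \<noteq> 0" "h z \<noteq> 0" using r by (auto simp: regular_def)
      then show "\<bar>ln (norm (g z)) - ln (norm (h z))\<bar> \<le> (2 * Vmax g h z - ln (norm (g z))) - ln (norm (h z))"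
        using Vmax_ge_g[of z] Vmax_ge_h[of z] by linarith
    qed (use r c in \<open>auto intro!: continuous_intros Vmax_continuous\<close>)
    also have "\<dots> = 2 * Tchar g h r - cmean (ln_norm g) r - cmean (ln_norm h) r"
      using r c by (simp add: cmean_diff cmean_cmult Tchar_def Vmax_continuous continuous_intros)
    also have "\<dots> \<le> 2 * Tchar g h r + (C1 + C2)"
      using C1(2)[OF r(1,2)] C2(2)[OF r(1,3)] by simp
    finally show "cmean (ln_ratio g h) r \<le> 2 * Tchar g h r + (C1 + C2)" .
  qed
qed

end

section \<open>The difference estimate\<close>

lemma nn_integral_lborel_shift:
  fixes f :: "'a::euclidean_space \<Rightarrow> ennreal"
  assumes "f \<in> borel_measurable borel"
  shows "(\<integral>\<^sup>+w. f (c + w) \<partial>lborel) = (\<integral>\<^sup>+w. f w \<partial>lborel)"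
proof -
  have "(\<integral>\<^sup>+w. f w \<partial>lborel) = (\<integral>\<^sup>+w. f w \<partial>distr lborel borel ((+) c))"
    by (simp only: lborel_distr_plus)
  also have "\<dots> = (\<integral>\<^sup>+w. f (c + w) \<partial>lborel)"
    by (rule nn_integral_distr) (use assms in auto)
  finally show ?thesis by simp
qed

lemma borel_ball_cball [measurable]:
  "ball (z :: complex) r \<in> sets borel" "cball (z :: complex) r \<in> sets borel"
  by simp_all

text \<open>Uniqueness of translation-invariant measure, played against the rotation-invariant unit disc.\<close>

lemma nn_integral_lborel_rotate:
  fixes f :: "complex \<Rightarrow> ennreal"
  assumes f[measurable]: "f \<in> borel_measurable borel" and a: "norm a = 1"
  shows "(\<integral>\<^sup>+w. f (a * w) \<partial>lborel) = (\<integral>\<^sup>+w. f w \<partial>lborel)"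
proof -
  define B :: "complex \<Rightarrow> ennreal" where "B = indicator (ball 0 1)"
  have B[measurable]: "B \<in> borel_measurable borel"
    unfolding B_def by (intro borel_measurable_indicator) simp
  define b where "b = (\<integral>\<^sup>+w. B w \<partial>lborel)"
  have b: "b \<noteq> 0" "b \<noteq> top"
    by (simp_all add: b_def B_def emeasure_ball unit_ball_vol_2)
  have a0: "a \<noteq> 0" using a by auto
  have Brot: "(\<integral>\<^sup>+w. B (x - a * w) \<partial>lborel) = b" for x
  proof -
    have "(\<integral>\<^sup>+w. B (x - a * w) \<partial>lborel) = (\<integral>\<^sup>+w. B (x - a * (x / a + w)) \<partial>lborel)"
      by (rule nn_integral_lborel_shift[symmetric]) measurable
    also have "\<dots> = (\<integral>\<^sup>+w. B w \<partial>lborel)"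
      by (rule nn_integral_cong) (use a a0 in \<open>simp add: B_def indicator_def norm_mult algebra_simps\<close>)
    finally show ?thesis by (simp add: b_def)
  qed
  have "(\<integral>\<^sup>+x. f x \<partial>lborel) * b = (\<integral>\<^sup>+x. f x * (\<integral>\<^sup>+w. B (x - a * w) \<partial>lborel) \<partial>lborel)"
    unfolding Brot by (rule nn_integral_multc[symmetric]) simp
  also have "\<dots> = (\<integral>\<^sup>+x. (\<integral>\<^sup>+w. f x * B (x - a * w) \<partial>lborel) \<partial>lborel)"
    by (intro nn_integral_cong nn_integral_cmult[symmetric]) simp
  also have "\<dots> = (\<integral>\<^sup>+w. (\<integral>\<^sup>+x. f x * B (x - a * w) \<partial>lborel) \<partial>lborel)"
    by (rule lborel_pair.Fubini'[symmetric]) measurable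
  also have "\<dots> = (\<integral>\<^sup>+w. (\<integral>\<^sup>+x. f (a * w + x) * B x \<partial>lborel) \<partial>lborel)"
  proof (rule nn_integral_cong)
    fix w :: complex
    show "(\<integral>\<^sup>+x. f x * B (x - a * w) \<partial>lborel) = (\<integral>\<^sup>+x. f (a * w + x) * B x \<partial>lborel)"
      using nn_integral_lborel_shift[of "\<lambda>x. f x * B (x - a * w)" "a * w"] by simp
  qed
  also have "\<dots> = (\<integral>\<^sup>+x. (\<integral>\<^sup>+w. f (a * w + x) * B x \<partial>lborel) \<partial>lborel)"
    by (rule lborel_pair.Fubini') measurable
  also have "\<dots> = (\<integral>\<^sup>+x. (\<integral>\<^sup>+w. f (a * w) \<partial>lborel) * B x \<partial>lborel)"
  proof (rule nn_integral_cong)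
    fix x :: complex
    have "(\<integral>\<^sup>+w. f (a * w + x) * B x \<partial>lborel) = (\<integral>\<^sup>+w. f (a * w + x) \<partial>lborel) * B x"
      by (rule nn_integral_multc) simp
    also have "(\<integral>\<^sup>+w. f (a * w + x) \<partial>lborel) = (\<integral>\<^sup>+w. f (a * w) \<partial>lborel)"
      using nn_integral_lborel_shift[of "\<lambda>w. f (a * w)" "x / a"] a0 by (simp add: algebra_simps)
    finally show "(\<integral>\<^sup>+w. f (a * w + x) * B x \<partial>lborel) = (\<integral>\<^sup>+w. f (a * w) \<partial>lborel) * B x" .
  qed
  also have "\<dots> = (\<integral>\<^sup>+w. f (a * w) \<partial>lborel) * b"
    unfolding b_def by (rule nn_integral_cmult) simp
  finally show ?thesis
    using b by (simp add: ennreal_mult_cancel_left mult.commute[of _ b])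
qed

lemma lborel_distr_rotate:
  assumes a: "norm (a::complex) = 1"
  shows "distr lborel borel ((*) a) = lborel"
proof (rule measure_eqI)
  fix A assume "A \<in> sets (distr lborel borel ((*) a))"
  then have A[measurable]: "A \<in> sets borel" by simp
  have "emeasure (distr lborel borel ((*) a)) A = (\<integral>\<^sup>+w. indicator A w \<partial>distr lborel borel ((*) a))"
    by simp
  also have "\<dots> = (\<integral>\<^sup>+w. indicator A (a * w) \<partial>lborel)"
    by (rule nn_integral_distr) auto
  also have "\<dots> = emeasure lborel A"
    by (subst nn_integral_lborel_rotate[OF _ a]) auto
  finally show "emeasure (distr lborel borel ((*) a)) A = emeasure lborel A" .
qed simp

lemma integral_lborel_rotate:
  fixes f :: "complex \<Rightarrow> real"
  assumes f[measurable]: "f \<in> borel_measurable borel" and a: "norm a = 1"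
  shows "(\<integral>w. f (a * w) \<partial>lborel) = (\<integral>w. f w \<partial>lborel)"
proof -
  have "(\<integral>w. f w \<partial>lborel) = (\<integral>w. f w \<partial>distr lborel borel ((*) a))"
    by (simp only: lborel_distr_rotate[OF a])
  also have "\<dots> = (\<integral>w. f (a * w) \<partial>lborel)"
    by (rule integral_distr) (use assms in auto)
  finally show ?thesis by simp
qed

lemma integrable_lborel_rotate:
  fixes f :: "complex \<Rightarrow> real"
  assumes f: "integrable lborel f" and a: "norm a = 1"
  shows "integrable lborel (\<lambda>w. f (a * w))"
proof -
  have [measurable]: "f \<in> borel_measurable borel" using f by auto
  have "integrable (distr lborel borel ((*) a)) f"
    using f by (simp only: lborel_distr_rotate[OF a])
  then show ?thesis
    by (subst (asm) integrable_distr_eq) auto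
qed

lemma lborel_integral_shift:
  fixes f :: "complex \<Rightarrow> real"
  assumes f: "integrable lborel f"
  shows "integrable lborel (\<lambda>w. f (c + w))" "(\<integral>w. f (c + w) \<partial>lborel) = (\<integral>w. f w \<partial>lborel)"
proof -
  have [measurable]: "f \<in> borel_measurable borel" using f by auto
  have "integrable (distr lborel borel ((+) c)) f"
    using f by (simp only: lborel_distr_plus)
  then show "integrable lborel (\<lambda>w. f (c + w))"
    by (subst (asm) integrable_distr_eq) auto
  have "(\<integral>w. f w \<partial>lborel) = (\<integral>w. f w \<partial>distr lborel borel ((+) c))"
    by (simp only: lborel_distr_plus)
  also have "\<dots> = (\<integral>w. f (c + w) \<partial>lborel)"
    by (rule integral_distr) auto
  finally show "(\<integral>w. f (c + w) \<partial>lborel) = (\<integral>w. f w \<partial>lborel)" by simp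
qed

text \<open>A finite union of circles is a null set. With \<open>B\<close> a set of irregular radii,
  the irregular circles can be ignored in area integrals.\<close>

lemma AE_norm_notin_finite:
  assumes "finite B"
  shows "AE w in lborel. norm (z + w :: complex) \<notin> B"
proof (rule AE_I')
  have "sphere (-z) b \<in> null_sets lborel" for b
    using negligible_sphere[of "-z" b]
    by (auto simp: null_sets_completion_iff negligible_iff_null_sets negligible_convex_frontier)
  then show "(\<Union>b\<in>B. sphere (-z) b) \<in> null_sets lborel"
    by (intro null_sets_UN' countable_finite assms)
  show "{w \<in> space lborel. \<not> norm (z + w) \<notin> B} \<subseteq> (\<Union>b\<in>B. sphere (-z) b)"
  proof
    fix w assume "w \<in> {w \<in> space lborel. \<not> norm (z + w) \<notin> B}"
    moreover have "dist (-z) w = norm (z + w)"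
      by (metis add.inverse_inverse dist_norm dist_commute diff_minus_eq_add add.commute)
    ultimately show "w \<in> (\<Union>b\<in>B. sphere (-z) b)" by auto
  qed
qed

lemma AE_entire_nonzero:
  assumes "G holomorphic_on UNIV" "G z0 \<noteq> 0"
  shows "AE w in lborel. G w \<noteq> 0"
proof (rule AE_I')
  have "countable {w. G w = 0}"
  proof (cases "G constant_on UNIV")
    case True
    then have "{w. G w = 0} = {}" using assms(2) by (auto simp: constant_on_def)
    then show ?thesis by simp
  next
    case False
    then show ?thesis
      using holomorphic_countable_zeros[OF assms(1)] by (simp add: Convex.connected_UNIV)
  qed
  then show "{w. G w = 0} \<in> null_sets lborel"
    by (rule countable_imp_null_set_lborel)
qed auto

lemma circle_nn_integral:
  assumes [measurable]: "\<phi> \<in> borel_measurable borel" and "\<And>z. \<phi> z \<ge> 0" "continuous_on (sphere 0 r) \<phi>" "r \<ge> 0"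
  shows "(\<integral>\<^sup>+t. ennreal (\<phi> (of_real r * cis t)) * indicator {0..2*pi} t \<partial>lborel) = ennreal (2 * pi * cmean \<phi> r)"
proof -
  have "((\<lambda>t. \<phi> (of_real r * cis t)) has_integral (2 * pi * cmean \<phi> r)) {0..2*pi}"
    by (rule cmean_has_integral) (use assms in auto)
  then have "((\<lambda>t. if t \<in> {0..2*pi} then \<phi> (of_real r * cis t) else 0) has_integral (2 * pi * cmean \<phi> r)) UNIV"
    by (subst has_integral_restrict_UNIV)
  also have "(\<lambda>t. if t \<in> {0..2*pi} then \<phi> (of_real r * cis t) else 0) = (\<lambda>t. \<phi> (of_real r * cis t) * indicator {0..2*pi} t)"
    by (auto simp: indicator_def)
  finally have I: "((\<lambda>t. \<phi> (of_real r * cis t) * indicator {0..2*pi} t) has_integral (2 * pi * cmean \<phi> r)) UNIV" .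
  have [measurable]: "cis \<in> borel_measurable borel"
    by (intro borel_measurable_continuous_onI continuous_intros)
  have "integral\<^sup>N lborel (\<lambda>t. ennreal (\<phi> (of_real r * cis t) * indicator {0..2*pi} t)) = ennreal (2 * pi * cmean \<phi> r)"
    by (rule nn_integral_has_integral_lborel[OF _ _ I]) (use assms in auto)
  then show ?thesis
    using assms(2) by (simp add: ennreal_mult ennreal_indicator)
qed

lemma circle_lebesgue_integral:
  assumes "continuous_on (sphere 0 r) \<phi>" "r \<ge> 0"
  shows "integrable lborel (\<lambda>t. indicator {0..2*pi} t * \<phi> (of_real r * cis t))"
    "(\<integral>t. indicator {0..2*pi} t * \<phi> (of_real r * cis t) \<partial>lborel) = 2 * pi * cmean \<phi> r"
proof -
  have *: "set_integrable lborel {0..2*pi} (\<lambda>t. \<phi> (of_real r * cis t))"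
    by (intro borel_integrable_atLeastAtMost' continuous_on_circle[OF assms])
  then show "integrable lborel (\<lambda>t. indicator {0..2*pi} t * \<phi> (of_real r * cis t))"
    by (simp add: set_integrable_def)
  show "(\<integral>t. indicator {0..2*pi} t * \<phi> (of_real r * cis t) \<partial>lborel) = 2 * pi * cmean \<phi> r"
    using set_borel_integral_eq_integral(2)[OF *] by (simp add: cmean_def set_lebesgue_integral_def)
qed

lemma borel_cis [measurable]: "cis \<in> borel_measurable borel"
  by (intro borel_measurable_continuous_onI continuous_intros)

lemma borel_entire: "G holomorphic_on UNIV \<Longrightarrow> G \<in> borel_measurable borel"
  by (intro borel_measurable_continuous_onI entire_continuous_on)

lemma polar_form: 
  obtains \<alpha> where "0 \<le> \<alpha>" "\<alpha> \<le> 2 * pi" "(w::complex) = of_real (norm w) * cis \<alpha>"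
proof
  show "w = of_real (norm w) * cis (Arg2pi w)"
    by (metis Arg2pi_eq cis_conv_exp)
qed (auto simp: Arg2pi less_imp_le)

lemma cmean_polar:
  assumes "continuous_on (sphere 0 (norm w)) \<phi>"
  shows "cmean (\<lambda>a. \<phi> (a * w)) 1 = cmean \<phi> (norm w)"
proof -
  obtain \<alpha> where \<alpha>: "0 \<le> \<alpha>" "\<alpha> \<le> 2 * pi" "w = of_real (norm w) * cis \<alpha>"
    by (rule polar_form)
  have "cmean (\<lambda>a. \<phi> (a * w)) 1 = cmean (\<lambda>a. \<phi> (cis \<alpha> * a)) (norm w)"
    unfolding cmean_def by (subst \<alpha>(3)) (simp add: mult_ac)
  also have "\<dots> = cmean \<phi> (norm w)"
    by (rule cmean_rotate) (use assms \<alpha> in auto)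
  finally show ?thesis .
qed

lemma continuous_on_rotated_circle:
  assumes "continuous_on (sphere 0 (norm w)) \<phi>"
  shows "continuous_on (sphere 0 1) (\<lambda>a::complex. \<phi> (a * w))"
  by (rule continuous_on_compose2[OF assms]) (auto intro!: continuous_intros simp: norm_mult)

text \<open>Since \<open>S\<close> is invariant under rotations, the inner integral may be turned by
  \<theta>. After exchanging the integrals, each fixed \<open>w\<close> contributes the mean of
  \<open>U\<close> over the circle of radius \<open>|r + w|\<close>, which is at most
  \<open>M\<close> for almost every \<open>w\<close>.\<close>

lemma tonelli_circle:
  fixes U :: "complex \<Rightarrow> real"
  assumes U[measurable]: "U \<in> borel_measurable borel" and pos: "\<And>z. U z \<ge> 0"
    and S[measurable]: "S \<in> sets borel" and rot: "\<And>a w. norm a = 1 \<Longrightarrow> a * w \<in> S \<longleftrightarrow> w \<in> S"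
    and sub: "S \<subseteq> cball 0 \<rho>" and r: "r \<ge> \<rho> + 1" and "finite Bad"
    and bound: "\<And>t. 1 \<le> t \<Longrightarrow> t \<le> r + \<rho> \<Longrightarrow> t \<notin> Bad \<Longrightarrow> continuous_on (sphere 0 t) U \<and> cmean U t \<le> M"
  shows "(\<integral>\<^sup>+\<theta>. (\<integral>\<^sup>+w. ennreal (U (of_real r * cis \<theta> + w)) * indicator S w \<partial>lborel) * indicator {0..2*pi} \<theta> \<partial>lborel)
        \<le> ennreal (2 * pi * M) * emeasure lborel S"
proof -
  have "(\<integral>\<^sup>+w. ennreal (U (of_real r * cis \<theta> + w)) * indicator S w \<partial>lborel) =
        (\<integral>\<^sup>+w. ennreal (U (cis \<theta> * (of_real r + w))) * indicator S w \<partial>lborel)" for \<theta>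
  proof -
    have "(\<integral>\<^sup>+w. ennreal (U (of_real r * cis \<theta> + cis \<theta> * w)) * indicator S (cis \<theta> * w) \<partial>lborel) =
          (\<integral>\<^sup>+w. ennreal (U (of_real r * cis \<theta> + w)) * indicator S w \<partial>lborel)"
      by (rule nn_integral_lborel_rotate) auto
    then show ?thesis
      using rot[of "cis \<theta>"] by (simp add: indicator_def algebra_simps cong: if_cong)
  qed
  then have "(\<integral>\<^sup>+\<theta>. (\<integral>\<^sup>+w. ennreal (U (of_real r * cis \<theta> + w)) * indicator S w \<partial>lborel) * indicator {0..2*pi} \<theta> \<partial>lborel)
     = (\<integral>\<^sup>+\<theta>. (\<integral>\<^sup>+w. ennreal (U (cis \<theta> * (of_real r + w))) * indicator S w * indicator {0..2*pi} \<theta> \<partial>lborel) \<partial>lborel)"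
    by (simp add: nn_integral_multc)
  also have "\<dots> = (\<integral>\<^sup>+w. (\<integral>\<^sup>+\<theta>. ennreal (U (cis \<theta> * (of_real r + w))) * indicator S w * indicator {0..2*pi} \<theta> \<partial>lborel) \<partial>lborel)"
    by (rule lborel_pair.Fubini'[symmetric]) measurable
  also have "\<dots> \<le> (\<integral>\<^sup>+w. ennreal (2 * pi * M) * indicator S w \<partial>lborel)"
  proof (rule nn_integral_mono_AE)
    show "AE w in lborel. (\<integral>\<^sup>+\<theta>. ennreal (U (cis \<theta> * (of_real r + w))) * indicator S w * indicator {0..2*pi} \<theta> \<partial>lborel)
            \<le> ennreal (2 * pi * M) * indicator S w"
      using AE_norm_notin_finite[OF \<open>finite Bad\<close>, of "of_real r"]
    proof eventually_elim
      fix w :: complex assume w: "norm (of_real r + w) \<notin> Bad"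
      show "(\<integral>\<^sup>+\<theta>. ennreal (U (cis \<theta> * (of_real r + w))) * indicator S w * indicator {0..2*pi} \<theta> \<partial>lborel)
            \<le> ennreal (2 * pi * M) * indicator S w"
      proof (cases "w \<in> S")
        case True
        then have nw: "norm w \<le> \<rho>" using sub by auto
        have rn: "norm (complex_of_real r) = r" using order_trans[OF norm_ge_zero nw] r by simp
        \<comment> \<open>Displacements have length at most \<rho> and \<open>r\<close> is at least
          \<rho> + 1, so the radius stays in the range covered by \<open>bound\<close>.\<close>
        have t: "1 \<le> norm (of_real r + w)" "norm (of_real r + w) \<le> r + \<rho>"
          using norm_diff_ineq[of "of_real r" w] norm_triangle_ineq[of "of_real r" w] nw r rn by linarith+
        have cU: "continuous_on (sphere 0 (norm (of_real r + w))) U" and mU: "cmean U (norm (of_real r + w)) \<le> M"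
          using bound[OF t w] by auto
        have "(\<integral>\<^sup>+\<theta>. ennreal (U (cis \<theta> * (of_real r + w))) * indicator S w * indicator {0..2*pi} \<theta> \<partial>lborel)
          = (\<integral>\<^sup>+\<theta>. ennreal (U (of_real 1 * cis \<theta> * (of_real r + w))) * indicator {0..2*pi} \<theta> \<partial>lborel)"
          using True by simp
        also have "\<dots> = ennreal (2 * pi * cmean (\<lambda>a. U (a * (of_real r + w))) 1)"
          by (rule circle_nn_integral) (use pos continuous_on_rotated_circle[OF cU] in auto)
        also have "\<dots> \<le> ennreal (2 * pi * M)"
          using cmean_polar[OF cU] mU by (intro ennreal_leI) simp
        finally show ?thesis using True by simp
      qed simp
    qed
  qed
  also have "\<dots> = ennreal (2 * pi * M) * emeasure lborel S"
    by (simp add: nn_integral_cmult)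
  finally show ?thesis .
qed


text \<open>This integrates the inequality on circles over the disc. In place of polar coordinates,
  the integral over the disc is averaged over all rotations of the integrand; for fixed
  \<open>w\<close> the average is a circle mean at radius \<open>|w|\<close>.\<close>

lemma area_submean:
  assumes H: "H holomorphic_on UNIV" "H 0 \<noteq> 0" and \<rho>: "\<rho> > 0"
    and int: "integrable lborel (\<lambda>w. indicator (ball 0 \<rho>) w * ln (norm (H w)))"
  shows "pi * \<rho>^2 * ln (norm (H 0)) \<le> (\<integral>w. indicator (ball 0 \<rho>) w * ln (norm (H w)) \<partial>lborel)"
proof -
  have [measurable]: "H \<in> borel_measurable borel"
    by (rule borel_entire[OF H(1)])
  define k where "k w = indicator (ball 0 \<rho>) w * ln (norm (H w))" for w
  have k[measurable]: "k \<in> borel_measurable borel"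
    unfolding k_def by measurable
  define I where "I = (\<integral>w. k w \<partial>lborel)"
  define K where "K \<theta> w = indicator {0..2*pi} \<theta> * k (cis \<theta> * w)" for \<theta> w
  have intk: "integrable lborel k"
    using int by (simp add: k_def[abs_def])
  have intI: "integrable lborel (\<lambda>\<theta>. indicator {0..2*pi} \<theta> * x)" for x :: real
    by simp
  have intK: "integrable (lborel \<Otimes>\<^sub>M lborel) (case_prod K)"
  proof (rule lborel_pair.Fubini_integrable)
    show "case_prod K \<in> borel_measurable (lborel \<Otimes>\<^sub>M lborel)"
      unfolding K_def by measurable
    have "(\<integral>w. norm (case_prod K (\<theta>, w)) \<partial>lborel) = indicator {0..2*pi} \<theta> * (\<integral>w. \<bar>k w\<bar> \<partial>lborel)" for \<theta>
      using integral_lborel_rotate[of "\<lambda>w. \<bar>k w\<bar>" "cis \<theta>"] by (simp add: K_def abs_mult)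
    then show "integrable lborel (\<lambda>\<theta>. \<integral>w. norm (case_prod K (\<theta>, w)) \<partial>lborel)"
      using intI by simp
    show "AE \<theta> in lborel. integrable lborel (\<lambda>w. case_prod K (\<theta>, w))"
      using integrable_lborel_rotate[OF intk] by (simp add: K_def)
  qed
  have "(\<integral>w. (\<integral>\<theta>. K \<theta> w \<partial>lborel) \<partial>lborel) = (\<integral>\<theta>. (\<integral>w. K \<theta> w \<partial>lborel) \<partial>lborel)"
    by (rule lborel_pair.Fubini_integral[OF intK])
  also have "\<dots> = (\<integral>\<theta>. indicator {0..2*pi} \<theta> * I \<partial>lborel)"
    using integral_lborel_rotate[OF k] by (simp add: K_def I_def)
  also have "\<dots> = 2 * pi * I"
    by simp
  finally have tot: "(\<integral>w. (\<integral>\<theta>. K \<theta> w \<partial>lborel) \<partial>lborel) = 2 * pi * I" .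
  have "2 * pi * (pi * \<rho>^2 * ln (norm (H 0))) = (\<integral>w. indicator (ball 0 \<rho>) w * (2 * pi * ln (norm (H 0))) \<partial>(lborel :: complex measure))"
    using \<rho> by (simp add: content_ball unit_ball_vol_2)
  also have "\<dots> \<le> (\<integral>w. (\<integral>\<theta>. K \<theta> w \<partial>lborel) \<partial>lborel)"
  proof (rule integral_mono_AE)
    show "integrable lborel (\<lambda>w::complex. indicator (ball 0 \<rho>) w * (2 * pi * ln (norm (H 0))))"
      using \<rho> by (simp add: emeasure_ball)
    show "integrable lborel (\<lambda>w. \<integral>\<theta>. K \<theta> w \<partial>lborel)"
      by (rule lborel_pair.integrable_snd[OF intK])
    \<comment> \<open>Radius 0 joins the irregular radii because \<open>submean_ln\<close> concerns
      positive radii.\<close>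
    have "finite (insert 0 {r. 0 \<le> r \<and> r \<le> \<rho> \<and> \<not> regular H r})"
      using finite_irregular[OF H] by simp
    from AE_norm_notin_finite[OF this, of 0]
    show "AE w in lborel. indicator (ball 0 \<rho>) w * (2 * pi * ln (norm (H 0))) \<le> (\<integral>\<theta>. K \<theta> w \<partial>lborel)"
    proof eventually_elim
      fix w :: complex assume w: "norm (0 + w) \<notin> insert 0 {r. 0 \<le> r \<and> r \<le> \<rho> \<and> \<not> regular H r}"
      show "indicator (ball 0 \<rho>) w * (2 * pi * ln (norm (H 0))) \<le> (\<integral>\<theta>. K \<theta> w \<partial>lborel)"
      proof (cases "w \<in> ball 0 \<rho>")
        case True
        then have reg: "regular H (norm w)" and pos: "norm w > 0" using w by auto
        have c: "continuous_on (sphere 0 (norm w)) (ln_norm H)"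
          by (rule regular_ln_continuous[OF H(1) reg])
        have "K \<theta> w = indicator {0..2*pi} \<theta> * ln (norm (H (of_real 1 * cis \<theta> * w)))" for \<theta>
          using True by (simp add: K_def k_def norm_mult)
        then have "(\<integral>\<theta>. K \<theta> w \<partial>lborel) = 2 * pi * cmean (\<lambda>a. ln (norm (H (a * w)))) 1"
          using circle_lebesgue_integral(2)[OF continuous_on_rotated_circle[OF c]] by simp
        also have "cmean (\<lambda>a. ln (norm (H (a * w)))) 1 = cmean (ln_norm H) (norm w)"
          by (rule cmean_polar[OF c])
        finally show ?thesis
          using submean_ln[OF H pos reg] True by simp
      qed (simp add: K_def k_def norm_mult)
    qed
  qed
  also have "\<dots> = 2 * pi * I" by (rule tot)
  finally show ?thesis
    by (simp add: I_def k_def)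
qed

lemma entire_shift:
  assumes "G holomorphic_on UNIV"
  shows "(\<lambda>w. G (w + c)) holomorphic_on UNIV" "(\<lambda>w. G (c + w)) holomorphic_on UNIV"
proof -
  have "G \<circ> (\<lambda>w. w + c) holomorphic_on UNIV" "G \<circ> (\<lambda>w. c + w) holomorphic_on UNIV"
    by (intro holomorphic_on_compose holomorphic_intros holomorphic_on_subset[OF assms] subset_UNIV)+
  then show "(\<lambda>w. G (w + c)) holomorphic_on UNIV" "(\<lambda>w. G (c + w)) holomorphic_on UNIV"
    by (simp_all add: o_def)
qed

definition shell :: "real \<Rightarrow> real \<Rightarrow> complex set" where
  "shell a b = cball 0 b - ball 0 a"

text \<open>The logarithm of the entire quotient at a point is at most its area mean over a disc around the
  point, which is a difference of two area means of \<open>ln |g/h|\<close> over discs that overlap up to a thin shell.\<close>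

lemma quotient_shell_bound:
  assumes g: "g holomorphic_on UNIV" "g z1 \<noteq> 0" and h: "h holomorphic_on UNIV" "h z2 \<noteq> 0"
    and F: "F holomorphic_on UNIV" "F z \<noteq> 0" and eq: "\<And>z. F z * g z * h (z + c) = g (z + c) * h z"
    and \<rho>: "\<rho> > 0"
    and fin: "(\<integral>\<^sup>+w. ennreal \<bar>ln (norm (g (z + w))) - ln (norm (h (z + w)))\<bar> * indicator (cball 0 (\<rho> + norm c)) w \<partial>lborel) < \<infinity>"
  shows "ennreal (pi * \<rho>^2 * ln (norm (F z))) \<le>
    (\<integral>\<^sup>+w. ennreal \<bar>ln (norm (g (z + w))) - ln (norm (h (z + w)))\<bar> * indicator (shell (\<rho> - norm c) (\<rho> + norm c)) w \<partial>lborel)"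
proof -
  have [measurable]: "g \<in> borel_measurable borel" "h \<in> borel_measurable borel" "F \<in> borel_measurable borel"
    using g h F borel_entire by auto
  define u where "u w = ln (norm (g (z + w))) - ln (norm (h (z + w)))" for w
  have [measurable]: "u \<in> borel_measurable borel" unfolding u_def by measurable
  define u1 where "u1 w = indicator (cball 0 (\<rho> + norm c)) w * u w" for w
  have int1: "integrable lborel u1"
  proof (rule integrableI_bounded)
    have "ennreal (norm (u1 w)) = ennreal \<bar>ln (norm (g (z + w))) - ln (norm (h (z + w)))\<bar> * indicator (cball 0 (\<rho> + norm c)) w" for w
      by (simp add: u1_def u_def abs_mult indicator_def)
    then show "(\<integral>\<^sup>+w. ennreal (norm (u1 w)) \<partial>lborel) < \<infinity>" using fin by simp
  qed (simp add: u1_def[abs_def])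
  define k0 where "k0 w = indicator (ball 0 \<rho>) w * u w" for w
  define k1 where "k1 w = indicator (ball c \<rho>) w * u w" for w
  have sub: "ball 0 \<rho> \<subseteq> cball 0 (\<rho> + norm c)" "ball c \<rho> \<subseteq> cball 0 (\<rho> + norm c)"
  proof -
    show "ball 0 \<rho> \<subseteq> cball 0 (\<rho> + norm c)"
      by (rule subset_trans[OF ball_subset_cball subset_cball]) simp
    have "norm w \<le> norm c + dist c w" for w
      using norm_triangle_ineq[of c "w - c"] by (simp add: dist_norm norm_minus_commute)
    then show "ball c \<rho> \<subseteq> cball 0 (\<rho> + norm c)"
      by (auto simp: dist_commute) (smt (verit))
  qed
  have i0: "integrable lborel k0"
  proof (rule Bochner_Integration.integrable_bound[OF int1])
    show "AE w in lborel. norm (k0 w) \<le> norm (u1 w)"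
    proof (rule AE_I2)
      fix w show "norm (k0 w) \<le> norm (u1 w)"
        using subsetD[OF sub(1), of w] by (auto simp: k0_def u1_def indicator_def)
    qed
  qed (simp add: k0_def[abs_def])
  have i1: "integrable lborel k1"
  proof (rule Bochner_Integration.integrable_bound[OF int1])
    show "AE w in lborel. norm (k1 w) \<le> norm (u1 w)"
      by (rule AE_I2) (use subsetD[OF sub(2)] in \<open>auto simp: k1_def u1_def indicator_def\<close>)
  qed (simp add: k1_def[abs_def])
  have i2: "integrable lborel (\<lambda>w. k1 (c + w))" "(\<integral>w. k1 (c + w) \<partial>lborel) = (\<integral>w. k1 w \<partial>lborel)"
    using lborel_integral_shift[OF i1] by auto
  define H where "H w = F (z + w)" for w
  have H: "H holomorphic_on UNIV" "H 0 \<noteq> 0"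
    using entire_shift(2)[OF F(1)] F(2) by (auto simp: H_def[abs_def])
  have [measurable]: "H \<in> borel_measurable borel" using H borel_entire by auto
  have ae: "AE w in lborel. indicator (ball 0 \<rho>) w * ln (norm (H w)) = k1 (c + w) - k0 w"
  proof -
    have "AE w in lborel. g (z + w) \<noteq> 0" "AE w in lborel. h (z + w) \<noteq> 0"
      "AE w in lborel. g (z + c + w) \<noteq> 0" "AE w in lborel. h (z + c + w) \<noteq> 0"
      using AE_entire_nonzero[OF entire_shift(2)[OF g(1)], of z "z1 - z"] AE_entire_nonzero[OF entire_shift(2)[OF h(1)], of z "z2 - z"]
            AE_entire_nonzero[OF entire_shift(2)[OF g(1)], of "z + c" "z1 - z - c"]
            AE_entire_nonzero[OF entire_shift(2)[OF h(1)], of "z + c" "z2 - z - c"] g(2) h(2)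
      by (simp_all add: algebra_simps)
    then show ?thesis
    proof eventually_elim
      fix w assume nz: "g (z + w) \<noteq> 0" "h (z + w) \<noteq> 0" "g (z + c + w) \<noteq> 0" "h (z + c + w) \<noteq> 0"
      have "norm (F (z + w)) * norm (g (z + w)) * norm (h (z + w + c)) = norm (g (z + w + c)) * norm (h (z + w))"
        using arg_cong[OF eq[of "z + w"], of norm] by (simp only: norm_mult)
      moreover have "F (z + w) \<noteq> 0"
        using eq[of "z + w"] nz by (auto simp: add_ac)
      ultimately have "ln (norm (F (z + w))) + ln (norm (g (z + w))) + ln (norm (h (z + w + c))) =
                       ln (norm (g (z + w + c))) + ln (norm (h (z + w)))"
        using nz by (simp add: add_ac mult_ac flip: ln_mult_pos)
      then have "ln (norm (H w)) = u (c + w) - u w"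
        by (simp add: u_def H_def add_ac)
      moreover have "c + w \<in> ball c \<rho> \<longleftrightarrow> w \<in> ball 0 \<rho>"
        by (simp add: dist_norm)
      ultimately show "indicator (ball 0 \<rho>) w * ln (norm (H w)) = k1 (c + w) - k0 w"
        by (simp add: k1_def k0_def indicator_def)
    qed
  qed
  have intH: "integrable lborel (\<lambda>w. indicator (ball 0 \<rho>) w * ln (norm (H w)))"
    using Bochner_Integration.integrable_diff[OF i2(1) i0] by (subst integrable_cong_AE[OF _ _ ae]) (auto simp: k0_def[abs_def] k1_def[abs_def])
  define us where "us w = \<bar>u w\<bar> * indicator (shell (\<rho> - norm c) (\<rho> + norm c)) w" for w
  have shm[measurable]: "shell a b \<in> sets borel" for a b unfolding shell_def by simp
  have ius: "integrable lborel us"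
  proof (rule Bochner_Integration.integrable_bound[OF int1])
    show "AE w in lborel. norm (us w) \<le> norm (u1 w)"
      by (rule AE_I2) (simp add: us_def u1_def indicator_def shell_def)
  qed (simp add: us_def[abs_def])
  have "pi * \<rho>^2 * ln (norm (F z)) \<le> (\<integral>w. indicator (ball 0 \<rho>) w * ln (norm (H w)) \<partial>lborel)"
    using area_submean[OF H \<rho> intH] by (simp add: H_def)
  also have "\<dots> = (\<integral>w. k1 (c + w) - k0 w \<partial>lborel)"
    by (rule integral_cong_AE[OF _ _ ae]) (auto simp: k0_def[abs_def] k1_def[abs_def])
  \<comment> \<open>Translation by \<open>c\<close> moves the first disc to centre \<open>c\<close>.
    What survives in the difference lives on the symmetric difference of the two discs, which lies
    in the shell.\<close>
  also have "\<dots> = (\<integral>w. k1 w - k0 w \<partial>lborel)"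
    using i0 i1 i2 by simp
  also have "\<dots> \<le> (\<integral>w. us w \<partial>lborel)"
  proof (rule integral_mono)
    fix w :: complex
    have "w \<in> ball c \<rho> \<Longrightarrow> w \<notin> ball 0 \<rho> \<Longrightarrow> w \<in> shell (\<rho> - norm c) (\<rho> + norm c)"
         "w \<notin> ball c \<rho> \<Longrightarrow> w \<in> ball 0 \<rho> \<Longrightarrow> w \<in> shell (\<rho> - norm c) (\<rho> + norm c)"
    proof -
      have "dist c w \<le> norm c + norm w" "norm w \<le> norm c + dist c w"
        using norm_triangle_ineq4[of c w] norm_triangle_ineq2[of w c] by (simp_all add: dist_norm norm_minus_commute)
      then show "w \<in> ball c \<rho> \<Longrightarrow> w \<notin> ball 0 \<rho> \<Longrightarrow> w \<in> shell (\<rho> - norm c) (\<rho> + norm c)"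
         "w \<notin> ball c \<rho> \<Longrightarrow> w \<in> ball 0 \<rho> \<Longrightarrow> w \<in> shell (\<rho> - norm c) (\<rho> + norm c)"
        using norm_ge_zero[of c] unfolding shell_def Diff_iff mem_ball mem_cball dist_0_norm by linarith+
    qed
    then show "k1 w - k0 w \<le> us w"
      by (auto simp: k1_def k0_def us_def indicator_def)
  qed (use i0 i1 ius in auto)
  finally have "ennreal (pi * \<rho>^2 * ln (norm (F z))) \<le> ennreal (\<integral>w. us w \<partial>lborel)"
    by (rule ennreal_leI)
  also have "\<dots> = (\<integral>\<^sup>+w. ennreal (us w) \<partial>lborel)"
    by (rule nn_integral_eq_integral[symmetric, OF ius]) (simp add: us_def)
  also have "\<dots> = (\<integral>\<^sup>+w. ennreal \<bar>ln (norm (g (z + w))) - ln (norm (h (z + w)))\<bar> * indicator (shell (\<rho> - norm c) (\<rho> + norm c)) w \<partial>lborel)"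
    by (intro nn_integral_cong) (simp add: us_def u_def indicator_def)
  finally show ?thesis .
qed

lemma emeasure_shell:
  assumes "0 \<le> a" "a \<le> b"
  shows "emeasure lborel (shell a b) = ennreal (pi * (b^2 - a^2))"
proof -
  have "emeasure lborel (shell a b) = emeasure lborel (cball 0 b :: complex set) - emeasure lborel (ball 0 a :: complex set)"
    unfolding shell_def by (rule emeasure_Diff) (use assms in \<open>auto simp: emeasure_ball\<close>)
  then show ?thesis
    using assms by (simp add: emeasure_ball emeasure_cball unit_ball_vol_2 ennreal_minus right_diff_distrib)
qed

text \<open>The pointwise shell estimate is averaged over the circle of radius \<open>r\<close>. The
  shell has area \<open>4 * pi * \<rho> * norm c\<close> and the disc \<open>pi * \<rho>^2\<close>,
  which is the origin of the factor \<open>4 * norm c / \<rho>\<close>; \<open>M\<close> bounds the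
  means over all circles that the displaced discs can meet.\<close>

lemma difference_bound:
  assumes g: "g holomorphic_on UNIV" "g z1 \<noteq> 0" and h: "h holomorphic_on UNIV" "h z2 \<noteq> 0"
    and F: "F holomorphic_on UNIV" and eq: "\<And>z. F z * g z * h (z + c) = g (z + c) * h z"
    and \<rho>: "\<rho> > norm c" and r: "r \<ge> \<rho> + norm c + 1"
    and M: "\<And>t. 1 \<le> t \<Longrightarrow> t \<le> r + (\<rho> + norm c) \<Longrightarrow> regular g t \<Longrightarrow> regular h t \<Longrightarrow>
               cmean (ln_ratio g h) t \<le> M" and "M \<ge> 0"
  shows "Tone F r \<le> 4 * norm c / \<rho> * M"
proof -
  have [measurable]: "g \<in> borel_measurable borel" "h \<in> borel_measurable borel" "F \<in> borel_measurable borel"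
    using g h F borel_entire by auto
  interpret F1: coprime_pair F "\<lambda>_. 1"
    by unfold_locales (use F in auto)
  define U where "U w = \<bar>ln (norm (g w)) - ln (norm (h w))\<bar>" for w
  have U[measurable]: "U \<in> borel_measurable borel" unfolding U_def by measurable
  define Bad where "Bad = {t. 0 \<le> t \<and> t \<le> r + (\<rho> + norm c) \<and> \<not> regular g t} \<union> {t. 0 \<le> t \<and> t \<le> r + (\<rho> + norm c) \<and> \<not> regular h t}"
  have finB: "finite Bad"
    unfolding Bad_def using finite_irregular[OF g] finite_irregular[OF h] by simp
  have \<rho>0: "\<rho> > 0" using \<rho> norm_ge_zero[of c] by linarith
  have bound: "continuous_on (sphere 0 t) U \<and> cmean U t \<le> M" if "1 \<le> t" "t \<le> r + (\<rho> + norm c)" "t \<notin> Bad" for t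
  proof -
    have reg: "regular g t" "regular h t" using that by (auto simp: Bad_def)
    then show ?thesis
      using M[OF that(1,2)] regular_ln_continuous[OF g(1) reg(1)] regular_ln_continuous[OF h(1) reg(2)]
      by (auto simp: U_def[abs_def] intro!: continuous_intros)
  qed
  have rot: "a * w \<in> shell x y \<longleftrightarrow> w \<in> shell x y" "a * w \<in> cball 0 y \<longleftrightarrow> w \<in> cball 0 y" if "norm a = 1" for a w x y
    using that by (simp_all add: shell_def norm_mult)
  let ?S = "shell (\<rho> - norm c) (\<rho> + norm c)" and ?B = "cball (0::complex) (\<rho> + norm c)"
  have [measurable]: "?S \<in> sets borel" unfolding shell_def by simp
  have rr: "r \<ge> 0" using r \<rho>0 norm_ge_zero[of c] by linarith
  have tS: "(\<integral>\<^sup>+\<theta>. (\<integral>\<^sup>+w. ennreal (U (of_real r * cis \<theta> + w)) * indicator ?S w \<partial>lborel) * indicator {0..2*pi} \<theta> \<partial>lborel)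
        \<le> ennreal (2 * pi * M) * emeasure lborel ?S"
    by (rule tonelli_circle[OF U _ _ _ _ _ finB bound]) (use r rot in \<open>auto simp: U_def shell_def\<close>)
  \<comment> \<open>The integral over the full disc supplies the finiteness, for almost every
    \<theta>, that the pointwise estimate requires.\<close>
  have tB: "(\<integral>\<^sup>+\<theta>. (\<integral>\<^sup>+w. ennreal (U (of_real r * cis \<theta> + w)) * indicator ?B w \<partial>lborel) * indicator {0..2*pi} \<theta> \<partial>lborel)
        \<le> ennreal (2 * pi * M) * emeasure lborel ?B"
    by (rule tonelli_circle[OF U _ _ _ _ _ finB bound]) (use r rot in \<open>auto simp: U_def\<close>)
  also have "\<dots> < \<infinity>"
    using \<rho>0 by (simp add: emeasure_cball ennreal_mult_less_top)
  finally have tB': "(\<integral>\<^sup>+\<theta>. (\<integral>\<^sup>+w. ennreal (U (of_real r * cis \<theta> + w)) * indicator ?B w \<partial>lborel) * indicator {0..2*pi} \<theta> \<partial>lborel) \<noteq> \<infinity>"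
    by simp
  have "AE \<theta> in lborel. (\<integral>\<^sup>+w. ennreal (U (of_real r * cis \<theta> + w)) * indicator ?B w \<partial>lborel) * indicator {0..2*pi} \<theta> \<noteq> \<infinity>"
    by (rule nn_integral_PInf_AE[OF _ tB']) measurable
  then have AE: "AE \<theta> in lborel. ennreal (Vone F (of_real r * cis \<theta>)) * indicator {0..2*pi} \<theta> \<le>
      ennreal (1 / (pi * \<rho>^2)) * ((\<integral>\<^sup>+w. ennreal (U (of_real r * cis \<theta> + w)) * indicator ?S w \<partial>lborel) * indicator {0..2*pi} \<theta>)"
  proof eventually_elim
    fix \<theta> :: real
    define z where "z = of_real r * cis \<theta>"
    assume fin: "(\<integral>\<^sup>+w. ennreal (U (of_real r * cis \<theta> + w)) * indicator ?B w \<partial>lborel) * indicator {0..2*pi} \<theta> \<noteq> \<infinity>"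
    have "ennreal (Vone F z) \<le> ennreal (1 / (pi * \<rho>^2)) * (\<integral>\<^sup>+w. ennreal (U (z + w)) * indicator ?S w \<partial>lborel)" if \<theta>: "\<theta> \<in> {0..2*pi}"
    proof (cases "norm (F z) > 1")
      case True
      then have Fz: "F z \<noteq> 0" by auto
      have "ennreal (1 / (pi * \<rho>^2)) * ennreal (pi * \<rho>^2 * ln (norm (F z))) \<le>
         ennreal (1 / (pi * \<rho>^2)) * (\<integral>\<^sup>+w. ennreal (U (z + w)) * indicator ?S w \<partial>lborel)"
        unfolding U_def
      proof (rule mult_left_mono[OF quotient_shell_bound[OF g h F Fz eq \<rho>0]])
        show "(\<integral>\<^sup>+w. ennreal \<bar>ln (norm (g (z + w))) - ln (norm (h (z + w)))\<bar> * indicator ?B w \<partial>lborel) < \<infinity>"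
          using fin \<theta> by (simp add: z_def U_def less_top)
      qed simp
      also have "ennreal (1 / (pi * \<rho>^2)) * ennreal (pi * \<rho>^2 * ln (norm (F z))) = ennreal (Vone F z)"
        using True \<rho>0 by (simp add: Vmax_def flip: ennreal_mult)
      finally show ?thesis .
    next
      case False
      then show ?thesis by (simp add: Vmax_def)
    qed
    then show "ennreal (Vone F (of_real r * cis \<theta>)) * indicator {0..2*pi} \<theta> \<le>
      ennreal (1 / (pi * \<rho>^2)) * ((\<integral>\<^sup>+w. ennreal (U (of_real r * cis \<theta> + w)) * indicator ?S w \<partial>lborel) * indicator {0..2*pi} \<theta>)"
      by (simp add: z_def indicator_def)
  qed
  have Vpos: "Vone F z \<ge> 0" for z by (simp add: Vmax_def)
  have Vm: "Vone F \<in> borel_measurable borel"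
    by (intro borel_measurable_continuous_onI F1.Vmax_continuous)
  have area: "emeasure lborel ?S = ennreal (4 * pi * \<rho> * norm c)"
    using \<rho> norm_ge_zero[of c] by (subst emeasure_shell) (auto simp: power2_eq_square algebra_simps)
  have "ennreal (2 * pi * Tone F r) = (\<integral>\<^sup>+\<theta>. ennreal (Vone F (of_real r * cis \<theta>)) * indicator {0..2*pi} \<theta> \<partial>lborel)"
    unfolding Tchar_def by (rule circle_nn_integral[symmetric, OF Vm Vpos F1.Vmax_continuous rr])
  also have "\<dots> \<le> (\<integral>\<^sup>+\<theta>. ennreal (1 / (pi * \<rho>^2)) * ((\<integral>\<^sup>+w. ennreal (U (of_real r * cis \<theta> + w)) * indicator ?S w \<partial>lborel) * indicator {0..2*pi} \<theta>) \<partial>lborel)"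
    by (rule nn_integral_mono_AE[OF AE])
  also have "\<dots> = ennreal (1 / (pi * \<rho>^2)) * (\<integral>\<^sup>+\<theta>. (\<integral>\<^sup>+w. ennreal (U (of_real r * cis \<theta> + w)) * indicator ?S w \<partial>lborel) * indicator {0..2*pi} \<theta> \<partial>lborel)"
    by (rule nn_integral_cmult) measurable
  also have "\<dots> \<le> ennreal (1 / (pi * \<rho>^2)) * (ennreal (2 * pi * M) * emeasure lborel ?S)"
    by (rule mult_left_mono[OF tS]) simp
  also have "\<dots> = ennreal (1 / (pi * \<rho>^2) * (2 * pi * M * (4 * pi * \<rho> * norm c)))"
    using \<open>M \<ge> 0\<close> \<rho>0 by (simp add: area flip: ennreal_mult)
  also have "1 / (pi * \<rho>^2) * (2 * pi * M * (4 * pi * \<rho> * norm c)) = 2 * pi * (4 * norm c / \<rho> * M)"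
    using \<rho>0 by (simp add: field_simps power2_eq_square)
  finally have "2 * pi * Tone F r \<le> 2 * pi * (4 * norm c / \<rho> * M)"
    using \<open>M \<ge> 0\<close> \<rho>0 by (subst (asm) ennreal_le_iff) auto
  then show ?thesis
    using pi_gt_zero by (simp only: mult_le_cancel_left_pos mult_pos_pos zero_less_numeral)
qed

section \<open>Logarithmic derivatives\<close>

text \<open>The derivative of the Schwarz integral: against the kernel \<open>\<zeta> / (\<zeta> - z)\<^sup>2\<close> the conjugate of \<open>H\<close>
  has mean zero on the circle, because the conjugate kernel extends holomorphically to the disc and
  vanishes at the origin.\<close>

lemma deriv_bound_Re:
  assumes H: "H holomorphic_on ball 0 R'" and R: "0 < R" "R < R'" and z: "norm z < R"
  shows "norm (deriv H z) \<le> 2 * R / (R - norm z)^2 * cmean (\<lambda>w. \<bar>Re (H w)\<bar>) R"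
proof -
  define k where "k \<zeta> = \<zeta> / (\<zeta> - z)^2" for \<zeta>
  define P where "P t = of_real R * cis t" for t
  have nP: "norm (P t) = R" for t using R by (simp add: P_def norm_mult)
  have Pz: "P t \<noteq> z" for t using nP[of t] z by auto
  have contH: "continuous_on (sphere 0 R) H"
    using R by (auto intro!: continuous_on_subset[OF holomorphic_on_imp_continuous_on[OF H]])
  have contP: "continuous_on X P" for X unfolding P_def by (intro continuous_intros)
  have contHP: "continuous_on X (\<lambda>t. H (P t))" for X
    by (rule continuous_on_compose2[OF contH contP]) (use nP in auto)
  have contk: "continuous_on X (\<lambda>t. k (P t))" for X
    unfolding k_def using Pz by (intro continuous_intros contP) auto
  have 1: "((\<lambda>t. H (P t) * k (P t)) has_integral (of_real (2*pi) * deriv H z)) {0..2*pi}"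
  proof -
    have "contour_integral (circlepath 0 R) (\<lambda>u. H u/(u-z)^2) = (2 * pi * \<i>) * deriv H z"
      by (rule Cauchy_contour_integral_circlepath_2)
         (use R z in \<open>auto intro!: holomorphic_on_imp_continuous_on holomorphic_on_subset[OF H]\<close>)
    then have "integral {0..2*pi} (\<lambda>t. H (P t) / (P t - z)^2 * of_real R * \<i> * cis t) = (2 * pi * \<i>) * deriv H z"
      unfolding circlepath_def by (subst (asm) contour_integral_part_circlepath_eq) (simp_all add: P_def)
    moreover have "(\<lambda>t. H (P t) / (P t - z)^2 * of_real R * \<i> * cis t) = (\<lambda>t. \<i> * (H (P t) * k (P t)))"
      by (simp add: k_def P_def fun_eq_iff)
    ultimately have "\<i> * integral {0..2*pi} (\<lambda>t. H (P t) * k (P t)) = \<i> * (of_real (2 * pi) * deriv H z)"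
      by simp
    then have eq: "integral {0..2*pi} (\<lambda>t. H (P t) * k (P t)) = of_real (2 * pi) * deriv H z"
      by (simp only: mult_cancel_left complex_i_not_zero) simp
    show ?thesis
      unfolding eq[symmetric]
      by (intro integrable_integral integrable_continuous_interval continuous_on_mult contHP contk)
  qed
  have 2: "((\<lambda>t. cnj (H (P t)) * k (P t)) has_integral 0) {0..2*pi}"
  proof -
    \<comment> \<open>The second bound exceeds \<open>R\<close> and, for
      \<open>z \<noteq> 0\<close>, stays below the modulus \<open>R^2 / |z|\<close> of the pole of
      the reflected kernel.\<close>
    define R'' where "R'' = min R' (2 * R^2 / (R + norm z))"
    have pos: "R + norm z > 0" using R norm_ge_zero[of z] by linarith
    have R'': "R < R''" using R z pos by (simp add: R''_def field_simps power2_eq_square)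
    have nz: "of_real (R^2) - cnj z * u \<noteq> 0" if "u \<in> ball 0 R''" for u
    proof
      assume "of_real (R^2) - cnj z * u = 0"
      then have "of_real (R^2) = cnj z * u" by simp
      then have "norm (complex_of_real (R^2)) = norm z * norm u"
        by (simp only: norm_mult complex_mod_cnj)
      then have "R^2 = norm z * norm u"
        by (simp only: norm_of_real abs_power2)
      also have "\<dots> \<le> norm z * (2 * R^2 / (R + norm z))"
        using that by (intro mult_left_mono) (auto simp: R''_def)
      also have "\<dots> < R^2"
      proof -
        have "2 * norm z / (R + norm z) < 1" using pos z by simp
        then have "R^2 * (2 * norm z / (R + norm z)) < R^2 * 1"
          using R by (intro mult_strict_left_mono) auto
        then show ?thesis by (simp add: mult_ac)
      qed
      finally show False by simp
    qed
    define K where "K u = H u * (of_real (R^2) * u / (of_real (R^2) - cnj z * u)^2)" for u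
    have "K holomorphic_on ball 0 R''"
      unfolding K_def by (intro holomorphic_intros holomorphic_on_subset[OF H]) (use nz in \<open>auto simp: R''_def\<close>)
    from holomorphic_circle_integral[OF this R(1) R'']
    have "((\<lambda>t. K (P t)) has_integral 0) {0..2*pi}"
      by (simp add: K_def P_def)
    then have "((\<lambda>t. cnj (K (P t))) has_integral cnj 0) {0..2*pi}"
      by (subst (asm) has_integral_cnj[symmetric]) (simp add: o_def)
    moreover have "cnj (K (P t)) = cnj (H (P t)) * k (P t)" for t
    proof -
      have "P t * cnj (P t) = of_real (R^2)"
        using complex_norm_square[of "P t"] nP[of t] by simp
      have c0: "cnj (P t) \<noteq> 0" using nP[of t] R by auto
      have d: "of_real (R^2) - z * cnj (P t) = (P t - z) * cnj (P t)"
        unfolding \<open>P t * cnj (P t) = of_real (R^2)\<close>[symmetric] by (rule left_diff_distrib[symmetric])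
      have "of_real (R^2) * cnj (P t) / (of_real (R^2) - z * cnj (P t))^2 =
            (P t * (cnj (P t) * cnj (P t))) / ((P t - z)^2 * (cnj (P t) * cnj (P t)))"
        unfolding d power_mult_distrib unfolding \<open>P t * cnj (P t) = of_real (R^2)\<close>[symmetric] power2_eq_square[of "cnj (P t)"] mult.assoc ..
      also have "\<dots> = k (P t)"
        unfolding k_def by (rule nonzero_mult_divide_mult_cancel_right) (use c0 in simp)
      finally have "of_real (R^2) * cnj (P t) / (of_real (R^2) - z * cnj (P t))^2 = k (P t)" .
      then show ?thesis
        unfolding K_def by (simp only: complex_cnj_mult complex_cnj_divide complex_cnj_power complex_cnj_diff
            complex_cnj_complex_of_real complex_cnj_cnj)
    qed
    ultimately show ?thesis by simp
  qed
  have int: "(\<lambda>t. 2 * R / (R - norm z)^2 * \<bar>Re (H (P t))\<bar>) integrable_on {0..2*pi}"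
    by (intro integrable_continuous_interval continuous_intros contHP)
  have "((\<lambda>t. H (P t) * k (P t) + cnj (H (P t)) * k (P t)) has_integral (of_real (2*pi) * deriv H z + 0)) {0..2*pi}"
    by (rule has_integral_add[OF 1 2])
  then have hi: "((\<lambda>t. H (P t) * k (P t) + cnj (H (P t)) * k (P t)) has_integral (of_real (2*pi) * deriv H z)) {0..2*pi}"
    by simp
  then have "norm (of_real (2*pi) * deriv H z) = norm (integral {0..2*pi} (\<lambda>t. H (P t) * k (P t) + cnj (H (P t)) * k (P t)))"
    by (simp add: integral_unique)
  also have "\<dots> \<le> integral {0..2*pi} (\<lambda>t. 2 * R / (R - norm z)^2 * \<bar>Re (H (P t))\<bar>)"
  proof (rule integral_norm_bound_integral[OF has_integral_integrable[OF hi] int])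
    fix t :: real
    \<comment> \<open>Adding the vanishing integral of the conjugate leaves only the real part of
      \<open>H\<close> against the kernel.\<close>
    have "H (P t) * k (P t) + cnj (H (P t)) * k (P t) = of_real (2 * Re (H (P t))) * k (P t)"
      by (simp add: complex_add_cnj flip: distrib_right)
    then have "norm (H (P t) * k (P t) + cnj (H (P t)) * k (P t)) = 2 * \<bar>Re (H (P t))\<bar> * (R / (norm (P t - z))^2)"
      by (simp add: norm_mult k_def norm_divide norm_power nP)
    also have "\<dots> \<le> 2 * \<bar>Re (H (P t))\<bar> * (R / (R - norm z)^2)"
    proof (intro mult_left_mono divide_left_mono power_mono)
      show "R - norm z \<le> norm (P t - z)" using norm_triangle_ineq2[of "P t" z] nP[of t] by simp
    qed (use R z Pz[of t] in auto)
    finally show "norm (H (P t) * k (P t) + cnj (H (P t)) * k (P t)) \<le> 2 * R / (R - norm z)^2 * \<bar>Re (H (P t))\<bar>"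
      by (simp add: mult_ac)
  qed
  also have "\<dots> = 2 * pi * (2 * R / (R - norm z)^2 * cmean (\<lambda>w. \<bar>Re (H w)\<bar>) R)"
    by (simp add: cmean_def P_def)
  finally have "2 * pi * norm (deriv H z) \<le> 2 * pi * (2 * R / (R - norm z)^2 * cmean (\<lambda>w. \<bar>Re (H w)\<bar>) R)"
    by (simp add: norm_mult)
  then show ?thesis
    using pi_gt_zero by (simp only: mult_le_cancel_left_pos mult_pos_pos zero_less_numeral)
qed

lemma DERIV_prod_linear_powers:
  assumes "finite S" "\<And>a. a \<in> S \<Longrightarrow> z \<noteq> (a::complex)"
  shows "((\<lambda>z. \<Prod>a\<in>S. (z - a) ^ k a) has_field_derivative
           (\<Prod>a\<in>S. (z - a) ^ k a) * (\<Sum>a\<in>S. of_nat (k a) / (z - a))) (at z)"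
  using assms
proof (induction S rule: finite_induct)
  case (insert x S)
  have zx: "z - x \<noteq> 0" using insert by auto
  have IH: "((\<lambda>z. \<Prod>a\<in>S. (z - a) ^ k a) has_field_derivative
           (\<Prod>a\<in>S. (z - a) ^ k a) * (\<Sum>a\<in>S. of_nat (k a) / (z - a))) (at z)"
    using insert by auto
  have "((\<lambda>z. (z - x) ^ k x) has_field_derivative (of_nat (k x) * (z - x) ^ (k x - 1))) (at z)"
    by (auto intro!: derivative_eq_intros)
  moreover have "of_nat (k x) * (z - x) ^ (k x - 1) = (z - x) ^ k x * (of_nat (k x) / (z - x))"
    using zx by (cases "k x") (simp_all add: field_simps)
  ultimately have *: "((\<lambda>z. (z - x) ^ k x) has_field_derivative ((z - x) ^ k x * (of_nat (k x) / (z - x)))) (at z)"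
    by simp
  have "((\<lambda>z. (z - x) ^ k x * (\<Prod>a\<in>S. (z - a) ^ k a)) has_field_derivative
     ((z - x) ^ k x * (of_nat (k x) / (z - x)) * (\<Prod>a\<in>S. (z - a) ^ k a) +
      (\<Prod>a\<in>S. (z - a) ^ k a) * (\<Sum>a\<in>S. of_nat (k a) / (z - a)) * (z - x) ^ k x)) (at z)"
    by (rule DERIV_mult'[OF * IH, THEN DERIV_cong]) (simp add: mult_ac)
  moreover have "(z - x) ^ k x * (of_nat (k x) / (z - x)) * (\<Prod>a\<in>S. (z - a) ^ k a) +
      (\<Prod>a\<in>S. (z - a) ^ k a) * (\<Sum>a\<in>S. of_nat (k a) / (z - a)) * (z - x) ^ k x =
      (\<Prod>a\<in>insert x S. (z - a) ^ k a) * (\<Sum>a\<in>insert x S. of_nat (k a) / (z - a))"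
    using insert.hyps by (simp add: algebra_simps)
  ultimately show ?case
    using insert.hyps by simp
qed simp

lemma log_deriv_factorization:
  assumes Z: "Z holomorphic_on ball 0 R" "Z z \<noteq> 0" and "z \<in> ball 0 R" and "finite S" "z \<notin> S"
    and G: "\<And>w. w \<in> ball 0 R \<Longrightarrow> G w = Z w * (\<Prod>a\<in>S. (w - a) ^ k a)"
  shows "deriv G z / G z = deriv Z z / Z z + (\<Sum>a\<in>S. of_nat (k a) / (z - a))"
proof -
  define P where "P w = (\<Prod>a\<in>S. (w - a) ^ k a)" for w
  have P0: "P z \<noteq> 0" using assms(4,5) by (auto simp: P_def)
  have dP: "(P has_field_derivative P z * (\<Sum>a\<in>S. of_nat (k a) / (z - a))) (at z)"
    unfolding P_def by (rule DERIV_prod_linear_powers) (use assms in auto)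
  have dZ: "(Z has_field_derivative deriv Z z) (at z)"
    using Z(1) assms(3) by (intro holomorphic_derivI) auto
  have "((\<lambda>w. Z w * P w) has_field_derivative (Z z * (P z * (\<Sum>a\<in>S. of_nat (k a) / (z - a))) + deriv Z z * P z)) (at z)"
    by (rule DERIV_mult'[OF dZ dP])
  then have "(G has_field_derivative (Z z * (P z * (\<Sum>a\<in>S. of_nat (k a) / (z - a))) + deriv Z z * P z)) (at z)"
    by (rule has_field_derivative_transform_within_open[where S = "ball 0 R"]) (use assms(3) G in \<open>auto simp: P_def\<close>)
  then have "deriv G z = Z z * (P z * (\<Sum>a\<in>S. of_nat (k a) / (z - a))) + deriv Z z * P z"
    by (rule DERIV_imp_deriv)
  moreover have "G z = Z z * P z" using G assms(3) by (simp add: P_def)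
  ultimately show ?thesis
    using P0 Z(2) by (simp add: field_simps)
qed

text \<open>From \<open>x \<le> B\<close> and \<open>0 \<le> B\<close> follows
  \<open>|x| \<le> 2 * B - x\<close>. Here \<open>B = ln (3 * R)\<close>, since
  \<open>|z - a| < 2 * R + 1\<close>, and the mean of \<open>x\<close> is
  \<open>ln (max R |a|)\<close>, which is nonnegative.\<close>

lemma cmean_abs_ln_dist:
  assumes "R \<ge> 1" "norm a \<noteq> R" "norm a < R + 1"
  shows "cmean (\<lambda>z. \<bar>ln (norm (z - a))\<bar>) R \<le> 2 * ln (3 * R)"
proof -
  have c: "continuous_on (sphere 0 R) (\<lambda>z. ln (norm (z - a)))"
    using assms by (intro continuous_intros) auto
  have "cmean (\<lambda>z. \<bar>ln (norm (z - a))\<bar>) R \<le> cmean (\<lambda>z. 2 * ln (3 * R) - ln (norm (z - a))) R"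
  proof (rule cmean_mono)
    fix z :: complex assume z: "norm z = R"
    then have "z \<noteq> a" using assms by auto
    have "norm (z - a) \<le> 3 * R" using norm_triangle_ineq4[of z a] z assms by simp
    then have "ln (norm (z - a)) \<le> ln (3 * R)"
      using \<open>z \<noteq> a\<close> assms by (subst ln_le_cancel_iff) auto
    moreover have "ln (3 * R) \<ge> 0" using assms by simp
    ultimately show "\<bar>ln (norm (z - a))\<bar> \<le> 2 * ln (3 * R) - ln (norm (z - a))" by linarith
  qed (use assms c in \<open>auto intro!: continuous_intros\<close>)
  also have "\<dots> = 2 * ln (3 * R) - ln (max R (norm a))"
    using assms c by (subst cmean_diff) (auto simp: cmean_ln_dist)
  also have "\<dots> \<le> 2 * ln (3 * R)"
    using assms by (auto simp: max_def)
  finally show ?thesis .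
qed

text \<open>A pointwise substitute for the lemma on the logarithmic derivative. Dividing the zeros
  in the disc of radius \<open>R + 1\<close> out of \<open>G1 / G2\<close> leaves
  \<open>exp H\<close>. Each zero contributes at most its multiplicity over \<delta>, while
  \<open>deriv H\<close> is controlled by the mean of \<open>|Re H|\<close>, and \<open>Re H\<close>
  differs from \<open>ln |G1 / G2|\<close> by logarithmic distances to the zeros.\<close>

lemma log_deriv_bound:
  assumes G1: "G1 holomorphic_on UNIV" "G1 z1 \<noteq> 0" and G2: "G2 holomorphic_on UNIV" "G2 z2 \<noteq> 0"
    and R: "R \<ge> 1" "regular G1 R" "regular G2 R" and z: "norm z \<le> R - 1" and \<delta>: "\<delta> > 0"
    and sep: "\<And>a. a \<in> zset G1 (R+1) \<union> zset G2 (R+1) \<Longrightarrow> norm (z - a) \<ge> \<delta>"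
  shows "norm (deriv G1 z / G1 z - deriv G2 z / G2 z) \<le>
     (zcount G1 (R+1) + zcount G2 (R+1)) / \<delta> +
     2 * R * (cmean (ln_ratio G1 G2) R + 2 * (zcount G1 (R+1) + zcount G2 (R+1)) * ln (3 * R))"
proof -
  have Rp: "R + 1 > 0" using R by simp
  obtain Z1 where Z1: "Z1 holomorphic_on ball 0 (R+1)" "\<And>z. z \<in> ball 0 (R+1) \<Longrightarrow> Z1 z \<noteq> 0"
    "\<And>z. z \<in> ball 0 (R+1) \<Longrightarrow> G1 z = Z1 z * (\<Prod>a\<in>zset G1 (R+1). (z - a) ^ zmult G1 a)"
    using zero_factorization[OF G1 Rp] by blast
  obtain Z2 where Z2: "Z2 holomorphic_on ball 0 (R+1)" "\<And>z. z \<in> ball 0 (R+1) \<Longrightarrow> Z2 z \<noteq> 0"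
    "\<And>z. z \<in> ball 0 (R+1) \<Longrightarrow> G2 z = Z2 z * (\<Prod>a\<in>zset G2 (R+1). (z - a) ^ zmult G2 a)"
    using zero_factorization[OF G2 Rp] by blast
  have fin: "finite (zset G1 (R+1))" "finite (zset G2 (R+1))"
    using finite_zset G1 G2 by auto
  obtain H where H: "H holomorphic_on ball 0 (R+1)" "\<And>z. z \<in> ball 0 (R+1) \<Longrightarrow> exp (H z) = Z1 z / Z2 z"
  proof (rule holomorphic_logarithm_exists[of "ball 0 (R+1)" "\<lambda>z. Z1 z / Z2 z" 0])
    show "(\<lambda>z. Z1 z / Z2 z) holomorphic_on ball 0 (R + 1)"
      by (intro holomorphic_intros Z1(1) Z2(1) Z2(2))
    show "Z1 z / Z2 z \<noteq> 0" if "z \<in> ball 0 (R+1)" for z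
      using Z1(2)[OF that] Z2(2)[OF that] by simp
  qed (use Rp in auto)
  have zb: "z \<in> ball 0 (R+1)" using z by simp
  have dH: "deriv H z = deriv Z1 z / Z1 z - deriv Z2 z / Z2 z"
  proof -
    have d: "(H has_field_derivative deriv H z) (at z)" "(Z1 has_field_derivative deriv Z1 z) (at z)" "(Z2 has_field_derivative deriv Z2 z) (at z)"
      using H(1) Z1(1) Z2(1) zb by (auto intro!: holomorphic_derivI)
    have "((\<lambda>w. exp (H w) * Z2 w) has_field_derivative (exp (H z) * deriv Z2 z + exp (H z) * deriv H z * Z2 z)) (at z)"
      using d by (auto intro!: derivative_eq_intros)
    then have "(Z1 has_field_derivative (exp (H z) * deriv Z2 z + exp (H z) * deriv H z * Z2 z)) (at z)"
      by (rule has_field_derivative_transform_within_open[where S = "ball 0 (R+1)"]) (use zb H(2) Z2(2) in auto)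
    then have "deriv Z1 z = exp (H z) * deriv Z2 z + exp (H z) * deriv H z * Z2 z"
      by (rule DERIV_imp_deriv)
    then show ?thesis
      using H(2)[OF zb] Z1(2)[OF zb] Z2(2)[OF zb] by (simp add: field_simps)
  qed
  let ?S1 = "\<Sum>a\<in>zset G1 (R+1). of_nat (zmult G1 a) / (z - a)"
  let ?S2 = "\<Sum>a\<in>zset G2 (R+1). of_nat (zmult G2 a) / (z - a)"
  have zn: "z \<notin> zset G1 (R+1)" "z \<notin> zset G2 (R+1)" using sep[of z] \<delta> by auto
  have "deriv G1 z / G1 z = deriv Z1 z / Z1 z + ?S1"
    by (rule log_deriv_factorization[OF Z1(1) Z1(2)[OF zb] zb fin(1) zn(1) Z1(3)])
  moreover have "deriv G2 z / G2 z = deriv Z2 z / Z2 z + ?S2"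
    by (rule log_deriv_factorization[OF Z2(1) Z2(2)[OF zb] zb fin(2) zn(2) Z2(3)])
  ultimately have split: "deriv G1 z / G1 z - deriv G2 z / G2 z = deriv H z + (?S1 - ?S2)"
    by (simp add: dH)
  have S: "norm (\<Sum>a\<in>zset G (R+1). of_nat (zmult G a) / (z - a)) \<le> zcount G (R+1) / \<delta>"
    if "\<And>a. a \<in> zset G (R+1) \<Longrightarrow> norm (z - a) \<ge> \<delta>" for G
  proof -
    have "norm (\<Sum>a\<in>zset G (R+1). of_nat (zmult G a) / (z - a)) \<le> (\<Sum>a\<in>zset G (R+1). real (zmult G a) / \<delta>)"
    proof (rule sum_norm_le)
      fix a assume a: "a \<in> zset G (R+1)"
      show "norm (of_nat (zmult G a) / (z - a)) \<le> real (zmult G a) / \<delta>"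
        using that[OF a] \<delta> by (simp add: norm_divide frac_le)
    qed
    then show ?thesis by (simp add: zcount_def sum_divide_distrib)
  qed
  have "norm (?S1 - ?S2) \<le> norm ?S1 + norm ?S2"
    by (rule norm_triangle_ineq4)
  also have "\<dots> \<le> (zcount G1 (R+1) + zcount G2 (R+1)) / \<delta>"
    using S[of G1] S[of G2] sep by (simp add: add_divide_distrib)
  finally have S12: "norm (?S1 - ?S2) \<le> (zcount G1 (R+1) + zcount G2 (R+1)) / \<delta>" .
  define L1 where "L1 w = (\<Sum>a\<in>zset G1 (R+1). real (zmult G1 a) * \<bar>ln (norm (w - a))\<bar>)" for w
  define L2 where "L2 w = (\<Sum>a\<in>zset G2 (R+1). real (zmult G2 a) * \<bar>ln (norm (w - a))\<bar>)" for w
  have lnG: "\<bar>ln (norm (G w)) - ln (norm (Z w))\<bar> \<le> (\<Sum>a\<in>zset G (R+1). real (zmult G a) * \<bar>ln (norm (w - a))\<bar>)"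
    if "norm w = R" "regular G R" "Z w \<noteq> 0" "finite (zset G (R+1))"
       "G w = Z w * (\<Prod>a\<in>zset G (R+1). (w - a) ^ zmult G a)" for G Z w
  proof -
    have ne: "w \<noteq> a" if "a \<in> zset G (R+1)" for a
      using that \<open>norm w = R\<close> \<open>regular G R\<close> by (auto simp: regular_def zset_def)
    have "norm (G w) = norm (Z w) * (\<Prod>a\<in>zset G (R+1). norm (w - a) ^ zmult G a)"
      by (simp add: that(5) norm_mult norm_power flip: prod_norm)
    also have "ln \<dots> = ln (norm (Z w)) + ln (\<Prod>a\<in>zset G (R+1). norm (w - a) ^ zmult G a)"
      using that(3) ne by (intro ln_mult_pos prod_pos) auto
    also have "ln (\<Prod>a\<in>zset G (R+1). norm (w - a) ^ zmult G a) = (\<Sum>a\<in>zset G (R+1). real (zmult G a) * ln (norm (w - a)))"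
      using ne that(4) by (subst ln_prod) (auto simp: ln_realpow)
    finally have "ln (norm (G w)) - ln (norm (Z w)) = (\<Sum>a\<in>zset G (R+1). real (zmult G a) * ln (norm (w - a)))"
      by simp
    also have "\<bar>\<dots>\<bar> \<le> (\<Sum>a\<in>zset G (R+1). real (zmult G a) * \<bar>ln (norm (w - a))\<bar>)"
      by (rule order_trans[OF sum_abs]) (simp add: abs_mult)
    finally show ?thesis .
  qed
  have cont: "continuous_on (sphere 0 R) (\<lambda>w. real (zmult G a) * \<bar>ln (norm (w - a))\<bar>)" if "a \<in> zset G (R+1)" "regular G R" for G a
    using that by (intro continuous_intros) (auto simp: regular_def zset_def)
  have meanL: "cmean (\<lambda>w. \<Sum>a\<in>zset G (R+1). real (zmult G a) * \<bar>ln (norm (w - a))\<bar>) R \<le> zcount G (R+1) * (2 * ln (3 * R))"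
    if "regular G R" "finite (zset G (R+1))" for G
  proof -
    have "cmean (\<lambda>w. \<Sum>a\<in>zset G (R+1). real (zmult G a) * \<bar>ln (norm (w - a))\<bar>) R =
          (\<Sum>a\<in>zset G (R+1). real (zmult G a) * cmean (\<lambda>w. \<bar>ln (norm (w - a))\<bar>) R)"
      using that cont R by (subst cmean_sum) (auto simp: cmean_cmult)
    also have "\<dots> \<le> (\<Sum>a\<in>zset G (R+1). real (zmult G a) * (2 * ln (3 * R)))"
      using that R by (intro sum_mono mult_left_mono cmean_abs_ln_dist) (auto simp: zset_def regular_def)
    finally show ?thesis by (simp add: zcount_def sum_distrib_right)
  qed
  have cL: "continuous_on (sphere 0 R) L1" "continuous_on (sphere 0 R) L2"
    unfolding L1_def L2_def using cont R by (auto intro!: continuous_on_sum)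
  have cG: "continuous_on (sphere 0 R) (ln_norm G1)" "continuous_on (sphere 0 R) (ln_norm G2)"
    using regular_ln_continuous G1 G2 R by auto
  have "cmean (\<lambda>w. \<bar>Re (H w)\<bar>) R \<le> cmean (\<lambda>w. \<bar>ln (norm (G1 w)) - ln (norm (G2 w))\<bar> + (L1 w + L2 w)) R"
  proof (rule cmean_mono)
    fix w :: complex assume w: "norm w = R"
    then have wb: "w \<in> ball 0 (R+1)" by simp
    have "Re (H w) = ln (norm (exp (H w)))" by simp
    also have "\<dots> = ln (norm (Z1 w)) - ln (norm (Z2 w))"
      using H(2)[OF wb] Z1(2)[OF wb] Z2(2)[OF wb] by (simp add: norm_divide ln_div)
    finally have "Re (H w) = ln (norm (Z1 w)) - ln (norm (Z2 w))" .
    moreover have "\<bar>ln (norm (G1 w)) - ln (norm (Z1 w))\<bar> \<le> L1 w"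
      unfolding L1_def by (rule lnG[where G = G1 and Z = Z1 and w = w, OF w R(2) Z1(2)[OF wb] fin(1) Z1(3)[OF wb]])
    moreover have "\<bar>ln (norm (G2 w)) - ln (norm (Z2 w))\<bar> \<le> L2 w"
      unfolding L2_def by (rule lnG[where G = G2 and Z = Z2 and w = w, OF w R(3) Z2(2)[OF wb] fin(2) Z2(3)[OF wb]])
    ultimately show "\<bar>Re (H w)\<bar> \<le> \<bar>ln (norm (G1 w)) - ln (norm (G2 w))\<bar> + (L1 w + L2 w)"
      by linarith
  next
    show "continuous_on (sphere 0 R) (\<lambda>w. \<bar>Re (H w)\<bar>)"
      using R by (intro continuous_intros) (auto intro!: continuous_on_subset[OF holomorphic_on_imp_continuous_on[OF H(1)]])
  qed (use cL cG R in \<open>auto intro!: continuous_intros\<close>)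
  also have "\<dots> = cmean (ln_ratio G1 G2) R + (cmean L1 R + cmean L2 R)"
    using cL cG R by (subst cmean_add, simp_all add: continuous_intros)+
  also have "\<dots> \<le> cmean (ln_ratio G1 G2) R + 2 * (zcount G1 (R+1) + zcount G2 (R+1)) * ln (3 * R)"
    using meanL[OF R(2) fin(1)] meanL[OF R(3) fin(2)] by (simp add: L1_def[abs_def] L2_def[abs_def] algebra_simps)
  finally have mRe: "cmean (\<lambda>w. \<bar>Re (H w)\<bar>) R \<le> cmean (ln_ratio G1 G2) R + 2 * (zcount G1 (R+1) + zcount G2 (R+1)) * ln (3 * R)" .
  have cpos: "0 \<le> cmean (\<lambda>w. \<bar>Re (H w)\<bar>) R"
    unfolding cmean_def by (intro divide_nonneg_pos Henstock_Kurzweil_Integration.integral_nonneg circle_integrable)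
      (use R in \<open>auto intro!: continuous_intros continuous_on_subset[OF holomorphic_on_imp_continuous_on[OF H(1)]]\<close>)
  have "norm (deriv H z) \<le> 2 * R / (R - norm z)^2 * cmean (\<lambda>w. \<bar>Re (H w)\<bar>) R"
    by (rule deriv_bound_Re[OF H(1)]) (use R z in auto)
  also have "\<dots> \<le> 2 * R * cmean (\<lambda>w. \<bar>Re (H w)\<bar>) R"
  proof (rule mult_right_mono[OF _ cpos])
    have "1 \<le> (R - norm z)^2" using z by (intro one_le_power) simp
    then show "2 * R / (R - norm z)^2 \<le> 2 * R"
      using R by (simp add: divide_le_eq mult_le_cancel_left1)
  qed
  also have "\<dots> \<le> 2 * R * (cmean (ln_ratio G1 G2) R + 2 * (zcount G1 (R+1) + zcount G2 (R+1)) * ln (3 * R))"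
    using mRe R by (intro mult_left_mono) auto
  finally show ?thesis
    unfolding split using norm_triangle_ineq[of "deriv H z" "?S1 - ?S2"] S12 by linarith
qed

section \<open>Circles that avoid zeros, and the number of zeros\<close>

lemma ex_separated_radius:
  fixes N :: "real set"
  assumes fin: "finite N" and card: "card N \<le> m"
  obtains r where "r0 \<le> r" "r \<le> r0 + 1" "\<And>x. x \<in> N \<Longrightarrow> \<bar>x - r\<bar> \<ge> 1 / (2 * (real m + 1))"
proof -
  \<comment> \<open>These are the midpoints of \<open>m + 1\<close> equal cells of the interval.
    Their spacing is twice the required distance, so a point of \<open>N\<close> spoils at most one
    of them and the pigeonhole principle leaves one free.\<close>
  define p where "p k = r0 + (2 * real k + 1) / (2 * (real m + 1))" for k
  have "\<exists>k\<le>m. \<forall>x\<in>N. \<bar>x - p k\<bar> \<ge> 1 / (2 * (real m + 1))"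
  proof (rule ccontr)
    assume "\<not> ?thesis"
    then have "\<forall>k\<in>{..m}. \<exists>x\<in>N. \<bar>x - p k\<bar> < 1 / (2 * (real m + 1))"
      by (metis atMost_iff not_le)
    then obtain X where X: "\<And>k. k \<in> {..m} \<Longrightarrow> X k \<in> N \<and> \<bar>X k - p k\<bar> < 1 / (2 * (real m + 1))"
      by metis
    have "inj_on X {..m}"
    proof (rule inj_onI)
      fix i j assume ij: "i \<in> {..m}" "j \<in> {..m}" "X i = X j"
      then have "\<bar>p i - p j\<bar> < 1 / (2 * (real m + 1)) + 1 / (2 * (real m + 1))"
        using X[of i] X[of j] by linarith
      also have "\<dots> = 1 / (real m + 1)" by (simp add: field_simps)
      finally have "\<bar>p i - p j\<bar> < 1 / (real m + 1)" .
      moreover have "p i - p j = (real i - real j) / (real m + 1)"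
      proof -
        have "p i - p j = ((2 * real i + 1) - (2 * real j + 1)) / (2 * (real m + 1))"
          by (simp add: p_def flip: diff_divide_distrib)
        also have "\<dots> = (2 * (real i - real j)) / (2 * (real m + 1))"
          by (simp add: algebra_simps)
        also have "\<dots> = (real i - real j) / (real m + 1)"
          by (rule mult_divide_mult_cancel_left) simp
        finally show ?thesis .
      qed
      ultimately have "\<bar>real i - real j\<bar> < 1"
        by (simp add: abs_divide divide_less_cancel)
      then show "i = j" by linarith
    qed
    then have "card {..m} \<le> card N"
      using X fin by (intro card_inj_on_le) auto
    then show False using card by simp
  qed
  then obtain k where k: "k \<le> m" "\<And>x. x \<in> N \<Longrightarrow> \<bar>x - p k\<bar> \<ge> 1 / (2 * (real m + 1))" by blast
  have "(2 * real k + 1) / (2 * (real m + 1)) \<le> 1"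
    using k(1) by simp
  then show ?thesis
    using k by (intro that[of "p k"]) (auto simp: p_def)
qed

lemma card_zset_le:
  assumes "G holomorphic_on UNIV" "G z0 \<noteq> 0"
  shows "real (card (zset G R)) \<le> zcount G R"
proof -
  have "real (card (zset G R)) = (\<Sum>a\<in>zset G R. 1)" by simp
  also have "\<dots> \<le> zcount G R"
    unfolding zcount_def using zmult_pos[OF assms] by (intro sum_mono) (auto simp: zset_def Suc_le_eq)
  finally show ?thesis .
qed

lemma zcount_mono:
  assumes "G holomorphic_on UNIV" "G z0 \<noteq> 0" "r \<le> s"
  shows "zcount G r \<le> zcount G s"
  unfolding zcount_def using assms(3) by (intro sum_mono2 finite_zset[OF assms(1,2)]) (auto simp: zset_def)

text \<open>A gap of at least 1 gives
  \<open>ln (r2 / r1) \<ge> ln (1 + 1 / r1) \<ge> 1 / (2 * r1)\<close>, which turns growth of the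
  means into a bound for the number of zeros.\<close>

lemma zcount_le_mean:
  assumes G: "G holomorphic_on UNIV" "G z0 \<noteq> 0" and r: "1 \<le> r1" "r1 + 1 \<le> r2" "regular G r1" "regular G r2"
  shows "zcount G r1 \<le> 2 * r1 * (cmean (ln_norm G) r2 - cmean (ln_norm G) r1)"
proof -
  have "1 / (2 * r1) \<le> ln (1 + 1 / r1)"
  proof -
    have "- ln (1 - 1 / (r1 + 1)) \<ge> 1 / (r1 + 1)"
      using ln_le_minus_one[of "1 - 1 / (r1 + 1)"] r by simp
    moreover have "1 - 1 / (r1 + 1) = inverse (1 + 1 / r1)"
      using r by (simp add: field_simps)
    moreover have "1 / (r1 + 1) \<ge> 1 / (2 * r1)" using r by (simp add: field_simps)
    ultimately show ?thesis
      using r by (simp add: ln_inverse add_pos_pos)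
  qed
  also have "\<dots> \<le> ln (r2 / r1)"
  proof -
    have "1 + 1 / r1 = (r1 + 1) / r1" using r by (simp add: field_simps)
    also have "\<dots> \<le> r2 / r1" using r by (intro divide_right_mono) auto
    finally show ?thesis using r by (subst ln_le_cancel_iff) (auto simp: add_pos_pos)
  qed
  finally have l: "1 / (2 * r1) \<le> ln (r2 / r1)" .
  have "zcount G r1 * (1 / (2 * r1)) \<le> zcount G r1 * ln (r2 / r1)"
    by (rule mult_left_mono[OF l zcount_nonneg])
  also have "\<dots> \<le> cmean (ln_norm G) r2 - cmean (ln_norm G) r1"
    by (rule cmean_ln_mono[OF G]) (use r in auto)
  finally show ?thesis using r by (simp add: field_simps)
qed

section \<open>Subexponential growth\<close>

definition subexp :: "(real \<Rightarrow> real) \<Rightarrow> bool" where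
  "subexp T \<longleftrightarrow> (\<forall>e>0. eventually (\<lambda>r. T r \<le> exp (e * r)) at_top)"

text \<open>Iteration gives \<open>T r \<le> T (r + n * M) / 2 ^ n\<close>, and the powers of 2 beat
  any subexponential growth along an arithmetic progression of radii.\<close>

lemma subexp_iterate:
  assumes sub: "subexp T" and M: "M > 0" and le: "\<And>r. r \<ge> r0 \<Longrightarrow> T r \<le> T (r + M) / 2" and "r \<ge> r0"
  shows "T r \<le> 0"
proof -
  have it: "T r \<le> T (r + real n * M) / 2 ^ n" for n
  proof (induction n)
    case (Suc n)
    have "r + real n * M \<ge> r0" using assms(4) M by (simp add: add_increasing2)
    then have "T (r + real n * M) / 2^n \<le> T (r + real n * M + M) / 2 / 2^n"
      by (intro divide_right_mono le) auto
    with Suc show ?case by (simp add: algebra_simps)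
  qed simp
  \<comment> \<open>With this choice \<open>exp (e * M)\<close> is \<open>sqrt 2\<close>, so the
    growth over one step of length \<open>M\<close> is less than the factor 2 gained.\<close>
  define e where "e = ln 2 / (2 * M)"
  have e: "e > 0" using M by (simp add: e_def)
  have "eventually (\<lambda>x. T x \<le> exp (e * x)) at_top" using sub e by (simp add: subexp_def)
  moreover have "filterlim (\<lambda>n. r + real n * M) at_top sequentially"
    by (intro filterlim_tendsto_add_at_top[OF tendsto_const]
              filterlim_at_top_mult_tendsto_pos[OF tendsto_const M filterlim_real_sequentially])
  ultimately have "eventually (\<lambda>n. T (r + real n * M) \<le> exp (e * (r + real n * M))) sequentially"
    by (auto simp: filterlim_iff)
  then have "eventually (\<lambda>n. T r \<le> exp (e * r) * (1 / sqrt 2) ^ n) sequentially"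
  proof eventually_elim
    fix n assume "T (r + real n * M) \<le> exp (e * (r + real n * M))"
    then have "T r \<le> exp (e * (r + real n * M)) / 2 ^ n"
      using it[of n] by (meson divide_right_mono order_trans zero_le_power zero_le_numeral)
    also have "e * (r + real n * M) = e * r + real n * (ln 2 / 2)"
      using M by (simp add: e_def distrib_left)
    also have "exp \<dots> = exp (e * r) * exp (ln 2 / 2) ^ n"
      by (simp only: exp_add exp_of_nat_mult)
    also have "exp (ln 2 / 2 :: real) = sqrt 2"
      by (simp flip: ln_sqrt)
    also have "exp (e * r) * sqrt 2 ^ n / 2 ^ n = exp (e * r) * (sqrt 2 / 2) ^ n"
      by (simp add: power_divide)
    also have "sqrt 2 / 2 = 1 / sqrt (2::real)" by (simp add: real_div_sqrt)
    finally show "T r \<le> exp (e * r) * (1 / sqrt 2) ^ n" .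
  qed
  moreover have "(\<lambda>n. exp (e * r) * (1 / sqrt 2) ^ n) \<longlonglongrightarrow> exp (e * r) * 0"
    by (intro tendsto_mult tendsto_const LIMSEQ_realpow_zero) auto
  ultimately show ?thesis
    by (intro tendsto_lowerbound[of _ 0 sequentially]) auto
qed

section \<open>Removable quotients, logarithmic derivatives, Wronskians\<close>

lemma entire_isCont: "G holomorphic_on UNIV \<Longrightarrow> isCont G z"
  using entire_continuous_on[of G UNIV] continuous_on_eq_continuous_at[OF open_UNIV, of G] by blast

text \<open>Local boundedness makes every singularity of \<open>P / N\<close> removable, and the
  product identity extends to the zeros of \<open>N\<close> by continuity.\<close>

lemma removable_quotient:
  assumes P: "P holomorphic_on UNIV" and N: "N holomorphic_on UNIV" "N z1 \<noteq> 0"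
    and bdd: "\<And>z0. \<exists>B. eventually (\<lambda>z. norm (P z) \<le> B * norm (N z)) (at z0)"
  obtains Q where "Q holomorphic_on UNIV" "\<And>z. P z = Q z * N z"
proof -
  define f where "f z = P z / N z" for z
  have evN: "eventually (\<lambda>w. N w \<noteq> 0) (at z)" for z by (rule entire_eventually_nonzero[OF N])
  have fana: "f analytic_on {z}" if "N z \<noteq> 0" for z
    unfolding f_def using that by (intro analytic_intros holomorphic_on_imp_analytic_at[OF P] holomorphic_on_imp_analytic_at[OF N(1)]) auto
  have isoev: "\<exists>e>0. \<forall>w\<in>ball z e - {z}. N w \<noteq> 0" for z
    using evN[of z] by (auto simp: eventually_at dist_commute)
  have lim: "isolated_singularity_at f z \<and> (\<exists>c. f \<midarrow>z\<rightarrow> c)" for z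
  proof -
    obtain e where e: "e > 0" "\<And>w. w \<in> ball z e - {z} \<Longrightarrow> N w \<noteq> 0" using isoev by metis
    have hol: "f holomorphic_on ball z e - {z}"
      unfolding f_def using e by (intro holomorphic_intros holomorphic_on_subset[OF P] holomorphic_on_subset[OF N(1)]) auto
    obtain B where "eventually (\<lambda>w. norm (P w) \<le> B * norm (N w)) (at z)" using bdd by blast
    then have "eventually (\<lambda>w. norm (f w) \<le> B) (at z)"
      using evN[of z] by eventually_elim (simp add: f_def norm_divide divide_le_eq)
    then obtain q where q: "q holomorphic_on ball z e" "\<forall>w\<in>ball z e - {z}. q w = f w"
      using holomorphic_on_extend_bounded[OF hol] e(1) by auto
    have "q \<midarrow>z\<rightarrow> q z"
      using q(1) e(1) by (metis centre_in_ball continuous_on_interior continuous_within holomorphic_on_imp_continuous_on interior_ball)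
    then have "f \<midarrow>z\<rightarrow> q z"
      by (rule Lim_transform_within_open[of _ _ _ _ "ball z e"]) (use e q in auto)
    moreover have "isolated_singularity_at f z"
      unfolding isolated_singularity_at_def
      by (intro exI[of _ e] conjI e(1)) (use hol in \<open>simp add: analytic_on_open open_Diff\<close>)
    ultimately show ?thesis by blast
  qed
  define Q where "Q = remove_sings f"
  have Qana: "Q analytic_on {z}" for z
    unfolding Q_def using lim[of z] remove_sings_analytic_at by blast
  have Q: "Q holomorphic_on UNIV"
    using Qana analytic_on_analytic_at analytic_imp_holomorphic by blast
  have eq: "P z = Q z * N z" if "N z \<noteq> 0" for z
    using fana[OF that] that by (simp add: Q_def f_def)
  have "P z = Q z * N z" for z
  proof (rule tendsto_unique)
    have c: "isCont P z" "isCont (\<lambda>w. Q w * N w) z"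
      by (intro continuous_intros entire_isCont P Q N(1))+
    show "P \<midarrow>z\<rightarrow> P z" using c(1) by (simp add: isCont_def)
    have "(\<lambda>w. Q w * N w) \<midarrow>z\<rightarrow> Q z * N z" using c(2) by (simp add: isCont_def)
    then show "P \<midarrow>z\<rightarrow> Q z * N z"
      by (rule Lim_transform_eventually) (use evN[of z] eq in \<open>auto elim!: eventually_mono\<close>)
  qed simp
  with Q that show ?thesis by blast
qed

lemma entire_mult_nonzero:
  assumes "G holomorphic_on UNIV" "\<exists>z. G z \<noteq> 0" "H holomorphic_on UNIV" "\<exists>z. H z \<noteq> 0"
  shows "\<exists>z. G z * H z \<noteq> (0::complex)"
proof -
  have "eventually (\<lambda>w. G w \<noteq> 0 \<and> H w \<noteq> 0) (at 0)"
    using assms entire_eventually_nonzero by (auto intro: eventually_conj)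
  then have "\<exists>w. G w \<noteq> 0 \<and> H w \<noteq> 0"
    using eventually_happens' at_neq_bot by blast
  then show ?thesis by auto
qed

lemma entire_eventually_bounded:
  assumes "G holomorphic_on UNIV"
  shows "eventually (\<lambda>z. norm (G z) \<le> norm (G z0) + 1) (at z0)"
proof -
  have "isCont G z0" by (rule entire_isCont[OF assms])
  then have "((\<lambda>z. norm (G z)) \<longlongrightarrow> norm (G z0)) (at z0)"
    by (intro tendsto_norm) (simp add: isCont_def)
  then show ?thesis
    by (rule eventually_mono[OF order_tendstoD(2), of _ _ _ "norm (G z0) + 1"]) auto
qed

lemma entire_deriv: "G holomorphic_on UNIV \<Longrightarrow> deriv G holomorphic_on UNIV"
  by (rule holomorphic_deriv) auto

text \<open>A logarithmic derivative has at most simple poles, whatever the multiplicity of the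
  zero, so a simple zero of \<open>D\<close> cancels each of them. This is the point at which
  multiplicities drop out of the second main theorem.\<close>

lemma log_deriv_locally_bounded:
  assumes X: "X holomorphic_on UNIV" "X z1 \<noteq> 0" and D: "D holomorphic_on UNIV" and van: "X z0 = 0 \<Longrightarrow> D z0 = 0"
  shows "\<exists>B. eventually (\<lambda>z. norm (D z * deriv X z) \<le> B * norm (X z)) (at z0)"
proof (cases "X z0 = 0")
  case False
  have DX: "(\<lambda>z. D z * deriv X z) holomorphic_on UNIV"
    by (intro holomorphic_intros D entire_deriv X)
  have "isCont X z0" by (rule entire_isCont[OF X(1)])
  then have "((\<lambda>z. norm (X z)) \<longlongrightarrow> norm (X z0)) (at z0)"
    by (intro tendsto_norm) (simp add: isCont_def)
  then have ev: "eventually (\<lambda>z. norm (X z) > norm (X z0) / 2) (at z0)"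
    by (rule order_tendstoD(1)) (use False in simp)
  let ?b = "norm (D z0 * deriv X z0) + 1"
  have "eventually (\<lambda>z. norm (D z * deriv X z) \<le> (2 * ?b / norm (X z0)) * norm (X z)) (at z0)"
    using ev entire_eventually_bounded[OF DX, of z0]
  proof eventually_elim
    fix z assume z: "norm (X z) > norm (X z0) / 2" "norm (D z * deriv X z) \<le> ?b"
    have "?b = (2 * ?b / norm (X z0)) * (norm (X z0) / 2)" using False by simp
    also have "\<dots> \<le> (2 * ?b / norm (X z0)) * norm (X z)"
      using z by (intro mult_left_mono divide_nonneg_nonneg) auto
    finally show "norm (D z * deriv X z) \<le> (2 * ?b / norm (X z0)) * norm (X z)" using z(2) by linarith
  qed
  then show ?thesis by blast
next
  case True
  then have D0: "D z0 = 0" by (rule van)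
  have "\<not> X constant_on UNIV" using X(2) True unfolding constant_on_def by (metis UNIV_I)
  then obtain Y r n where Y: "0 < n" "0 < r" "Y holomorphic_on ball z0 r"
      "\<And>w. w \<in> ball z0 r \<Longrightarrow> X w = (w - z0)^n * Y w" "\<And>w. w \<in> ball z0 r \<Longrightarrow> Y w \<noteq> 0"
    using holomorphic_factor_zero_nonconstant[OF X(1) open_UNIV Convex.connected_UNIV UNIV_I True] by metis
  have "D field_differentiable (at z0)"
    using D holomorphic_on_imp_differentiable_at by blast
  then obtain D' where "(D has_field_derivative D') (at z0)"
    by (auto simp: field_differentiable_def)
  then have "((\<lambda>z. (D z - D z0) / (z - z0)) \<longlongrightarrow> D') (at z0)"
    by (simp add: has_field_derivative_iff)
  then have "((\<lambda>z. norm (D z / (z - z0))) \<longlongrightarrow> norm D') (at z0)"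
    using D0 by (intro tendsto_norm) simp
  then have evD: "eventually (\<lambda>z. norm (D z / (z - z0)) < norm D' + 1) (at z0)"
    by (rule order_tendstoD(2)) simp
  have contY: "continuous_on (ball z0 r) (\<lambda>w. of_nat n + (w - z0) * deriv Y w / Y w)"
    using Y by (intro continuous_intros holomorphic_on_imp_continuous_on holomorphic_deriv) auto
  then have "((\<lambda>w. norm (of_nat n + (w - z0) * deriv Y w / Y w)) \<longlongrightarrow> norm (of_nat n + (z0 - z0) * deriv Y z0 / Y z0)) (at z0)"
  proof (intro tendsto_norm)
    have "isCont (\<lambda>w. of_nat n + (w - z0) * deriv Y w / Y w) z0"
      using contY Y(2) by (simp add: continuous_on_eq_continuous_at)
    then show "((\<lambda>w. of_nat n + (w - z0) * deriv Y w / Y w) \<longlongrightarrow> of_nat n + (z0 - z0) * deriv Y z0 / Y z0) (at z0)"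
      by (simp only: isCont_def)
  qed
  then have evY: "eventually (\<lambda>w. norm (of_nat n + (w - z0) * deriv Y w / Y w) < real n + 1) (at z0)"
    by (rule order_tendstoD(2)) simp
  have evb: "eventually (\<lambda>w. w \<in> ball z0 r \<and> w \<noteq> z0) (at z0)"
    using Y(2) by (auto simp: eventually_at dist_commute)
  have "eventually (\<lambda>z. norm (D z * deriv X z) \<le> ((norm D' + 1) * (real n + 1)) * norm (X z)) (at z0)"
    using evD evY evb
  proof eventually_elim
    fix z assume z: "norm (D z / (z - z0)) < norm D' + 1" "norm (of_nat n + (z - z0) * deriv Y z / Y z) < real n + 1"
      "z \<in> ball z0 r \<and> z \<noteq> z0"
    have nz: "z - z0 \<noteq> 0" "Y z \<noteq> 0" using z(3) Y(5) by auto
    have dY: "(Y has_field_derivative deriv Y z) (at z)"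
      using Y(3) z(3) by (intro holomorphic_derivI) auto
    have "((\<lambda>w. (w - z0)^n * Y w) has_field_derivative ((z - z0)^n * deriv Y z + of_nat n * (z - z0)^(n-1) * Y z)) (at z)"
      by (rule derivative_eq_intros dY refl | simp)+
    then have "(X has_field_derivative ((z - z0)^n * deriv Y z + of_nat n * (z - z0)^(n-1) * Y z)) (at z)"
      by (rule has_field_derivative_transform_within_open[where S = "ball z0 r"]) (use z(3) Y(4) in auto)
    then have "deriv X z = (z - z0)^n * deriv Y z + of_nat n * (z - z0)^(n-1) * Y z"
      by (rule DERIV_imp_deriv)
    also have "(z - z0)^n = (z - z0) * (z - z0)^(n-1)"
      using Y(1) by (cases n) auto
    finally have dX: "deriv X z = (z - z0)^(n-1) * ((z - z0) * deriv Y z + of_nat n * Y z)"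
      by (simp add: algebra_simps)
    have Xz: "X z = (z - z0) * (z - z0)^(n-1) * Y z"
      using Y(1,4) z(3) by (cases n) auto
    have "D z * deriv X z = (D z / (z - z0)) * (of_nat n + (z - z0) * deriv Y z / Y z) * X z"
      using nz unfolding dX Xz by (simp add: field_simps)
    then have "norm (D z * deriv X z) = norm (D z / (z - z0)) * norm (of_nat n + (z - z0) * deriv Y z / Y z) * norm (X z)"
      by (simp only: norm_mult)
    also have "\<dots> \<le> ((norm D' + 1) * (real n + 1)) * norm (X z)"
      using z by (intro mult_right_mono mult_mono) auto
    finally show "norm (D z * deriv X z) \<le> ((norm D' + 1) * (real n + 1)) * norm (X z)" .
  qed
  then show ?thesis by blast
qed

text \<open>The derivative of \<open>X / Y\<close> vanishes near a point where \<open>Y\<close> is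
  nonzero; the identity theorem spreads the resulting relation over the plane.\<close>

lemma wronskian_zero:
  assumes X: "X holomorphic_on UNIV" and Y: "Y holomorphic_on UNIV" "\<exists>z. Y z \<noteq> 0"
    and W: "\<And>z. X z * deriv Y z = deriv X z * Y z"
  obtains k where "\<And>z. X z = k * Y z"
proof -
  obtain z0 where z0: "Y z0 \<noteq> 0" using Y by blast
  obtain e where e: "e > 0" "\<And>w. dist z0 w < e \<Longrightarrow> Y w \<noteq> 0"
    using continuous_at_avoid[OF entire_isCont[OF Y(1)] z0] by blast
  have "\<exists>k. \<forall>w\<in>ball z0 e. X w / Y w = k"
  proof (rule has_field_derivative_zero_constant)
    fix w assume w: "w \<in> ball z0 e"
    have "((\<lambda>w. X w / Y w) has_field_derivative ((deriv X w * Y w - X w * deriv Y w) / (Y w * Y w))) (at w)"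
      using e(2)[of w] w by (intro DERIV_divide holomorphic_derivI[OF X open_UNIV] holomorphic_derivI[OF Y(1) open_UNIV]) simp_all
    moreover have "(deriv X w * Y w - X w * deriv Y w) / (Y w * Y w) = 0"
      by (simp add: W[of w])
    ultimately show "((\<lambda>w. X w / Y w) has_field_derivative 0) (at w within ball z0 e)"
      by (simp only: has_field_derivative_at_within)
  qed simp
  then obtain k where k: "\<And>w. w \<in> ball z0 e \<Longrightarrow> X w / Y w = k" by blast
  have "X z - k * Y z = 0" for z
  proof (rule analytic_continuation_open[of "ball z0 e" UNIV "\<lambda>z. X z - k * Y z" "\<lambda>_. 0"])
    show "X w - k * Y w = 0" if "w \<in> ball z0 e" for w
      using k[OF that] e(2)[of w] that by (simp add: field_simps)
    show "(\<lambda>z. X z - k * Y z) holomorphic_on UNIV"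
      by (intro holomorphic_intros X Y(1))
    show "ball z0 e \<noteq> {}" using e(1) by simp
  qed (simp_all add: Convex.connected_UNIV)
  then show ?thesis using that[of k] by simp
qed

section \<open>A second main theorem for three small targets\<close>

text \<open>The targets of \<open>g / h\<close> are \<open>1\<close>, \<open>1/F1\<close>, \<open>1/F2\<close>: the form \<open>L i\<close> vanishes where the \<open>i\<close>-th one is attained, and
  the coefficients \<open>a i\<close> below make \<open>X 0 + X 1 + X 2 = 0\<close>, so that any two of the \<open>X i\<close> have the same
  Wronskian up to sign. The zeros of the forms are counted without multiplicity by those of \<open>D\<close>.\<close>

locale three_targets = coprime_pair g h for g h +
  fixes F1 F2 D :: "complex \<Rightarrow> complex" and M :: "complex \<Rightarrow> real" and K :: real
  assumes gh_nz: "\<exists>z. g z \<noteq> 0" "\<exists>z. h z \<noteq> 0"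
    and F1: "F1 holomorphic_on UNIV" and F2: "F2 holomorphic_on UNIV" and D: "D holomorphic_on UNIV"
    and distinct: "\<exists>z. F2 z - F1 z \<noteq> 0" "\<exists>z. 1 - F2 z \<noteq> 0" "\<exists>z. F1 z - 1 \<noteq> 0"
    and D_nz: "\<exists>z. D z \<noteq> 0"
    and van: "\<And>z. g z - h z = 0 \<or> F1 z * g z - h z = 0 \<or> F2 z * g z - h z = 0 \<Longrightarrow> D z = 0"
    and M_cont: "continuous_on UNIV M" and M_nonneg: "\<And>z. 0 \<le> M z"
    and M_F1: "\<And>z. norm (F1 z) \<le> exp (M z)" and M_F2: "\<And>z. norm (F2 z) \<le> exp (M z)"
    and M_D: "\<And>z. norm (D z) \<le> K * exp (4 * M z)" and K: "K \<ge> 1"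
    and M_mono: "\<And>r s. 0 \<le> r \<Longrightarrow> r \<le> s \<Longrightarrow> cmean M r \<le> cmean M s"
begin

text \<open>The cross product of \<open>(1, 1, 1)\<close> and \<open>(1, F1, F2)\<close>. It is
  orthogonal to both vectors, so the multiples of \<open>g\<close> and of \<open>h\<close> cancel
  separately in the sum of the \<open>X i\<close>.\<close>

definition a :: "nat \<Rightarrow> complex \<Rightarrow> complex" where
  "a i z = (if i = 0 then F2 z - F1 z else if i = 1 then 1 - F2 z else F1 z - 1)"

definition L :: "nat \<Rightarrow> complex \<Rightarrow> complex" where
  "L i z = (if i = 0 then g z - h z else if i = 1 then F1 z * g z - h z else F2 z * g z - h z)"

definition X :: "nat \<Rightarrow> complex \<Rightarrow> complex" where
  "X i z = a i z * L i z"

definition W :: "complex \<Rightarrow> complex" where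
  "W z = X 0 z * deriv (X 1) z - deriv (X 0) z * X 1 z"

definition A3 :: "complex \<Rightarrow> complex" where
  "A3 z = a 0 z * a 1 z * a 2 z"

definition X3 :: "complex \<Rightarrow> complex" where
  "X3 z = X 0 z * X 1 z * X 2 z"

lemma a_hol: "a i holomorphic_on UNIV"
proof -
  have "(\<lambda>z. F2 z - F1 z) holomorphic_on UNIV" "(\<lambda>z. 1 - F2 z) holomorphic_on UNIV" "(\<lambda>z. F1 z - 1) holomorphic_on UNIV"
    by (intro holomorphic_intros F1 F2)+
  then show ?thesis
    unfolding a_def[abs_def] by (cases "i = 0"; cases "i = 1") simp_all
qed

lemma L_hol: "L i holomorphic_on UNIV"
proof -
  have "(\<lambda>z. g z - h z) holomorphic_on UNIV" "(\<lambda>z. F1 z * g z - h z) holomorphic_on UNIV" "(\<lambda>z. F2 z * g z - h z) holomorphic_on UNIV"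
    by (intro holomorphic_intros F1 F2 g h)+
  then show ?thesis
    unfolding L_def[abs_def] by (cases "i = 0"; cases "i = 1") simp_all
qed

lemma X_hol: "X i holomorphic_on UNIV"
  unfolding X_def by (intro holomorphic_intros a_hol L_hol)

lemma A3_hol: "A3 holomorphic_on UNIV" and X3_hol: "X3 holomorphic_on UNIV" and W_hol: "W holomorphic_on UNIV"
  unfolding A3_def X3_def W_def by (intro holomorphic_intros a_hol X_hol entire_deriv)+

lemma a_nz: "\<exists>z. a i z \<noteq> 0"
  using distinct by (auto simp: a_def)

lemma L_van: "L i z = 0 \<Longrightarrow> D z = 0"
  using van[of z] by (auto simp: L_def split: if_splits)

lemma L_nz: "\<exists>z. L i z \<noteq> 0"
  using D_nz L_van by blast

lemma X_nz: "\<exists>z. X i z \<noteq> 0"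
  unfolding X_def by (rule entire_mult_nonzero[OF a_hol a_nz L_hol L_nz])

lemma A3_nz: "\<exists>z. A3 z \<noteq> 0"
  unfolding A3_def by (intro entire_mult_nonzero a_hol a_nz holomorphic_intros)

lemma X3_nz: "\<exists>z. X3 z \<noteq> 0"
  unfolding X3_def by (intro entire_mult_nonzero X_hol X_nz holomorphic_intros)

lemma X_sum: "X 2 z = - X 0 z - X 1 z"
  by (simp add: X_def a_def L_def algebra_simps)

lemma X_deriv_sum: "deriv (X 2) z = - deriv (X 0) z - deriv (X 1) z"
proof -
  have d: "(X i has_field_derivative deriv (X i) z) (at z)" for i
    by (rule holomorphic_derivI[OF X_hol]) auto
  have "X 2 = (\<lambda>z. - X 0 z - X 1 z)" by (simp add: fun_eq_iff X_sum)
  then have "(X 2 has_field_derivative (- deriv (X 0) z - deriv (X 1) z)) (at z)"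
    using d by (auto intro!: derivative_eq_intros)
  then show ?thesis by (rule DERIV_imp_deriv)
qed

lemma W_pair:
  "W z = X 1 z * deriv (X 2) z - deriv (X 1) z * X 2 z"
  "W z = X 2 z * deriv (X 0) z - deriv (X 2) z * X 0 z"
  by (simp_all add: W_def X_sum X_deriv_sum algebra_simps)

lemma exp_Vmax: "exp (Vmax g h z) = max (norm (g z)) (norm (h z))"
  using Vmax_arg_pos[of z] by (simp add: Vmax_def)

lemma a_bound: "norm (a i z) \<le> 2 * exp (M z)"
proof -
  have "1 \<le> exp (M z)" using M_nonneg by simp
  moreover have "norm (a i z) \<le> norm (F2 z) + norm (F1 z) \<or> norm (a i z) \<le> 1 + norm (F2 z) \<or> norm (a i z) \<le> norm (F1 z) + 1"
    using norm_triangle_ineq4[of "F2 z" "F1 z"] norm_triangle_ineq4[of 1 "F2 z"] norm_triangle_ineq4[of "F1 z" 1]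
    by (auto simp: a_def)
  ultimately show ?thesis using M_F1[of z] M_F2[of z] by linarith
qed

lemma A3_bound: "norm (A3 z) \<le> 8 * exp (3 * M z)"
proof -
  have "norm (A3 z) = norm (a 0 z) * norm (a 1 z) * norm (a 2 z)" by (simp add: A3_def norm_mult)
  also have "\<dots> \<le> (2 * exp (M z)) * (2 * exp (M z)) * (2 * exp (M z))"
    by (intro mult_mono a_bound) auto
  also have "\<dots> = 8 * exp (3 * M z)" by (simp flip: exp_add)
  finally show ?thesis .
qed

lemma X_bound: "norm (X i z) \<le> 4 * exp (Vmax g h z + 2 * M z)"
proof -
  have m: "norm (g z) \<le> exp (Vmax g h z)" "norm (h z) \<le> exp (Vmax g h z)"
    by (simp_all add: exp_Vmax)
  have e1: "1 \<le> exp (M z)" using M_nonneg by simp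
  have *: "norm (k * g z - h z) \<le> 2 * exp (M z) * exp (Vmax g h z)" if "norm k \<le> exp (M z)" for k
  proof -
    have "norm (k * g z - h z) \<le> norm k * norm (g z) + norm (h z)"
      using norm_triangle_ineq4[of "k * g z" "h z"] by (simp add: norm_mult)
    also have "\<dots> \<le> exp (M z) * exp (Vmax g h z) + exp (M z) * exp (Vmax g h z)"
    proof (intro add_mono mult_mono that m)
      have "norm (h z) \<le> 1 * exp (Vmax g h z)" using m by simp
      also have "\<dots> \<le> exp (M z) * exp (Vmax g h z)" using e1 by (intro mult_right_mono) auto
      finally show "norm (h z) \<le> exp (M z) * exp (Vmax g h z)" .
    qed auto
    finally show ?thesis by simp
  qed
  have "norm (L i z) \<le> 2 * exp (M z) * exp (Vmax g h z)"
    using *[of 1] *[of "F1 z"] *[of "F2 z"] e1 M_F1[of z] M_F2[of z] by (auto simp: L_def)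
  then have "norm (X i z) \<le> (2 * exp (M z)) * (2 * exp (M z) * exp (Vmax g h z))"
    unfolding X_def norm_mult by (intro mult_mono a_bound) auto
  also have "\<dots> = 4 * exp (Vmax g h z + 2 * M z)"
    by (simp add: algebra_simps flip: exp_add)
  finally show ?thesis .
qed

text \<open>Two of the forms determine \<open>g\<close> and \<open>h\<close>: the difference of
  \<open>L 1\<close> and \<open>L 0\<close> is \<open>(F1 - 1) * g\<close>, and
  \<open>F1 - 1\<close> is \<open>a 2\<close>. The factor \<open>A3\<close> clears the denominators
  of this inversion.\<close>

lemma gh_recover:
  assumes m: "norm (X 0 z) \<le> m" "norm (X 1 z) \<le> m"
  shows "norm (A3 z) * exp (Vmax g h z) \<le> 8 * exp (2 * M z) * m"
proof -
  have m0: "0 \<le> m" using m norm_ge_zero order_trans by blast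
  have eg: "A3 z * g z = a 0 z * X 1 z - a 1 z * X 0 z"
    by (simp add: A3_def X_def a_def L_def algebra_simps)
  have eh: "A3 z * h z = A3 z * g z - a 1 z * a 2 z * X 0 z"
    by (simp add: A3_def X_def L_def algebra_simps)
  have "norm (A3 z * g z) \<le> norm (a 0 z) * norm (X 1 z) + norm (a 1 z) * norm (X 0 z)"
    unfolding eg using norm_triangle_ineq4[of "a 0 z * X 1 z" "a 1 z * X 0 z"] by (simp add: norm_mult)
  also have "\<dots> \<le> 2 * exp (M z) * m + 2 * exp (M z) * m"
    by (intro add_mono mult_mono a_bound m) auto
  finally have g1: "norm (A3 z * g z) \<le> 4 * exp (M z) * m" by (simp add: mult_ac)
  have ee: "exp (M z) * m \<le> exp (2 * M z) * m"
    using m0 M_nonneg[of z] by (intro mult_right_mono) auto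
  have "norm (A3 z * h z) \<le> norm (A3 z * g z) + norm (a 1 z) * norm (a 2 z) * norm (X 0 z)"
    unfolding eh using norm_triangle_ineq4[of "A3 z * g z" "a 1 z * a 2 z * X 0 z"] by (simp add: norm_mult)
  also have "\<dots> \<le> 4 * exp (M z) * m + 2 * exp (M z) * (2 * exp (M z)) * m"
    by (intro add_mono mult_mono a_bound m g1) auto
  also have "2 * exp (M z) * (2 * exp (M z)) = 4 * exp (2 * M z)"
    by (simp flip: exp_add)
  finally have "norm (A3 z * h z) \<le> 8 * exp (2 * M z) * m" using ee by simp
  moreover have "norm (A3 z * g z) \<le> 8 * exp (2 * M z) * m" using g1 ee mult_nonneg_nonneg[OF exp_ge_zero m0, of "2 * M z"] by simp
  ultimately show ?thesis
    by (auto simp: exp_Vmax norm_mult max_def)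
qed

text \<open>Cartan's argument: any two of the \<open>X i\<close> give the same Wronskian, so at each
  point the two forms other than the largest can be used. This gains the largest value, from which
  \<open>exp (Vmax g h z)\<close> is recovered. \<open>E\<close> will be \<open>D z * A3 z\<close>
  where poles are to be removed and 1 on a good circle.\<close>

lemma core_bound:
  assumes B: "\<And>i j. i < 3 \<Longrightarrow> j < 3 \<Longrightarrow> norm (E * (X i z * deriv (X j) z - deriv (X i) z * X j z)) \<le> B * norm (X i z * X j z)"
    and "B \<ge> 0"
  shows "norm (E * W z * A3 z) * exp (Vmax g h z) \<le> 8 * exp (2 * M z) * B * norm (X3 z)"
proof -
  define m where "m = max (norm (X 0 z)) (max (norm (X 1 z)) (norm (X 2 z)))"
  have EW: "norm (E * W z) * m \<le> B * norm (X3 z)"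
  proof -
    have "norm (E * W z) * norm (X 2 z) \<le> B * norm (X 0 z * X 1 z) * norm (X 2 z)"
      using B[of 0 1] by (intro mult_right_mono) (simp_all add: W_def)
    moreover have "norm (E * W z) * norm (X 0 z) \<le> B * norm (X 1 z * X 2 z) * norm (X 0 z)"
      using B[of 1 2] by (intro mult_right_mono) (simp_all add: W_pair(1))
    moreover have "norm (E * W z) * norm (X 1 z) \<le> B * norm (X 2 z * X 0 z) * norm (X 1 z)"
      using B[of 2 0] by (intro mult_right_mono) (simp_all add: W_pair(2))
    ultimately show ?thesis
      by (auto simp: m_def max_def X3_def norm_mult mult_ac)
  qed
  have "norm (E * W z * A3 z) * exp (Vmax g h z) = norm (E * W z) * (norm (A3 z) * exp (Vmax g h z))"
    by (simp add: norm_mult)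
  also have "\<dots> \<le> norm (E * W z) * (8 * exp (2 * M z) * m)"
    by (intro mult_left_mono gh_recover) (auto simp: m_def)
  also have "\<dots> = 8 * exp (2 * M z) * (norm (E * W z) * m)" by simp
  also have "\<dots> \<le> 8 * exp (2 * M z) * (B * norm (X3 z))"
    by (intro mult_left_mono EW) auto
  finally show ?thesis by simp
qed

text \<open>\<open>D * A3\<close> clears the simple poles of the logarithmic derivatives of the \<open>X i\<close>. The second factor \<open>A3\<close>
  is needed because the \<open>X i\<close> may vanish simultaneously, but only at zeros of \<open>A3\<close>.\<close>

lemma wronskian_quotient:
  obtains Q where "Q holomorphic_on UNIV" "\<And>z. D z * A3 z * W z * A3 z = Q z * X3 z"
proof -
  obtain z1 where z1: "X3 z1 \<noteq> 0" using X3_nz by blast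
  have DA: "(\<lambda>z. D z * A3 z) holomorphic_on UNIV" by (intro holomorphic_intros D A3_hol)
  have hol: "(\<lambda>z. D z * A3 z * W z * A3 z) holomorphic_on UNIV" by (intro holomorphic_intros D A3_hol W_hol)
  have bdd: "\<exists>B. eventually (\<lambda>z. norm (D z * A3 z * W z * A3 z) \<le> B * norm (X3 z)) (at z0)" for z0
  proof -
    have "\<exists>B. eventually (\<lambda>z. norm (D z * A3 z * deriv (X i) z) \<le> B * norm (X i z)) (at z0)" if "i < 3" for i
    proof -
      obtain x where x: "X i x \<noteq> 0" using X_nz by blast
      have "D z0 * A3 z0 = 0" if "X i z0 = 0"
      proof -
        have "i = 0 \<or> i = 1 \<or> i = 2" using \<open>i < 3\<close> by auto
        then show ?thesis
          using that L_van[of i z0] by (auto simp: X_def A3_def)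
      qed
      then show ?thesis by (rule log_deriv_locally_bounded[OF X_hol x DA])
    qed
    then obtain B where B: "\<And>i. i < 3 \<Longrightarrow> eventually (\<lambda>z. norm (D z * A3 z * deriv (X i) z) \<le> B i * norm (X i z)) (at z0)"
      by metis
    define b where "b = \<bar>B 0\<bar> + \<bar>B 1\<bar> + \<bar>B 2\<bar>"
    have bB: "B i + B j \<le> 2 * b" if "i < 3" "j < 3" for i j
    proof -
      have Bb: "B i \<le> b" if "i < 3" for i
      proof -
        have "i = 0 \<or> i = 1 \<or> i = 2" using that by auto
        then show ?thesis by (auto simp: b_def)
      qed
      show ?thesis using Bb[OF that(1)] Bb[OF that(2)] by simp
    qed
    \<comment> \<open>This factor remains when the bound is solved for the numerator. It is
      continuous, as \<open>g\<close> and \<open>h\<close> have no common zero, hence bounded near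
      \<open>z0\<close>.\<close>
    define \<Phi> where "\<Phi> z = exp (2 * M z - Vmax g h z)" for z
    have "continuous_on UNIV \<Phi>"
      unfolding \<Phi>_def by (intro continuous_intros M_cont Vmax_continuous)
    then have "(\<Phi> \<longlongrightarrow> \<Phi> z0) (at z0)"
      by (simp add: continuous_on_eq_continuous_at isCont_def)
    then have ev\<Phi>: "eventually (\<lambda>z. \<Phi> z < \<Phi> z0 + 1) (at z0)"
      by (rule order_tendstoD(2)) simp
    have "eventually (\<lambda>z. norm (D z * A3 z * deriv (X 0) z) \<le> B 0 * norm (X 0 z)) (at z0)"
         "eventually (\<lambda>z. norm (D z * A3 z * deriv (X 1) z) \<le> B 1 * norm (X 1 z)) (at z0)"
         "eventually (\<lambda>z. norm (D z * A3 z * deriv (X 2) z) \<le> B 2 * norm (X 2 z)) (at z0)"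
      using B by simp_all
    with ev\<Phi> have "eventually (\<lambda>z. norm (D z * A3 z * W z * A3 z) \<le> (8 * (\<Phi> z0 + 1) * (2 * b)) * norm (X3 z)) (at z0)"
    proof eventually_elim
      fix z assume \<Phi>: "\<Phi> z < \<Phi> z0 + 1" and B': "norm (D z * A3 z * deriv (X 0) z) \<le> B 0 * norm (X 0 z)"
        "norm (D z * A3 z * deriv (X 1) z) \<le> B 1 * norm (X 1 z)" "norm (D z * A3 z * deriv (X 2) z) \<le> B 2 * norm (X 2 z)"
      have Bi: "norm (D z * A3 z * deriv (X i) z) \<le> B i * norm (X i z)" if "i < 3" for i
      proof -
        have "i = 0 \<or> i = 1 \<or> i = 2" using that by auto
        then show ?thesis using B' by auto
      qed
      have b0: "2 * b \<ge> 0" by (simp add: b_def)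
      have "norm (D z * A3 z * W z * A3 z) * exp (Vmax g h z) \<le> 8 * exp (2 * M z) * (2 * b) * norm (X3 z)"
      proof (rule core_bound[OF _ b0])
        fix i j :: nat assume ij: "i < 3" "j < 3"
        have "norm (D z * A3 z * (X i z * deriv (X j) z - deriv (X i) z * X j z)) =
              norm ((D z * A3 z * deriv (X j) z) * X i z - (D z * A3 z * deriv (X i) z) * X j z)"
          by (simp add: algebra_simps)
        also have "\<dots> \<le> norm (D z * A3 z * deriv (X j) z) * norm (X i z) + norm (D z * A3 z * deriv (X i) z) * norm (X j z)"
          by (metis norm_mult norm_triangle_ineq4)
        also have "\<dots> \<le> B j * norm (X j z) * norm (X i z) + B i * norm (X i z) * norm (X j z)"
          by (intro add_mono mult_right_mono Bi ij) auto
        also have "\<dots> = (B i + B j) * norm (X i z * X j z)"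
          by (simp add: norm_mult algebra_simps)
        also have "\<dots> \<le> 2 * b * norm (X i z * X j z)"
          by (intro mult_right_mono bB ij) auto
        finally show "norm (D z * A3 z * (X i z * deriv (X j) z - deriv (X i) z * X j z)) \<le> 2 * b * norm (X i z * X j z)" .
      qed
      then have "norm (D z * A3 z * W z * A3 z) \<le> 8 * \<Phi> z * (2 * b) * norm (X3 z)"
        by (simp add: \<Phi>_def exp_diff field_simps)
      also have "\<dots> \<le> 8 * (\<Phi> z0 + 1) * (2 * b) * norm (X3 z)"
        using \<Phi> b0 by (intro mult_right_mono mult_left_mono) auto
      finally show "norm (D z * A3 z * W z * A3 z) \<le> (8 * (\<Phi> z0 + 1) * (2 * b)) * norm (X3 z)" .
    qed
    then show ?thesis by blast
  qed
  show ?thesis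
    using removable_quotient[OF hol X3_hol z1 bdd] that by blast
qed

lemma Mmean_cont: "continuous_on S M"
  using M_cont continuous_on_subset by blast

text \<open>If the Wronskian vanishes, then \<open>X 0 = k * X 1\<close> can be solved for
  \<open>g / h = p / q\<close>, where \<open>p\<close> and \<open>q\<close> involve only the small
  functions. Coprimality gives \<open>p = s * g\<close> and \<open>q = s * h\<close> with
  \<open>s\<close> entire, and the mean of \<open>ln |s|\<close> is bounded below.\<close>

lemma degenerate_bound:
  assumes W0: "\<And>z. W z = 0"
  obtains C where "\<And>r. r \<ge> 1 \<Longrightarrow> Tchar g h r \<le> 2 * cmean M (r + 1) + C"
proof -
  have "X 0 z * deriv (X 1) z = deriv (X 0) z * X 1 z" for z
    using W0[of z] by (simp add: W_def)
  then obtain k where k: "\<And>z. X 0 z = k * X 1 z"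
    using wronskian_zero[OF X_hol X_hol X_nz] by blast
  define p where "p z = a 0 z - k * a 1 z" for z
  define q where "q z = a 0 z - k * a 1 z * F1 z" for z
  have p: "p holomorphic_on UNIV" and q: "q holomorphic_on UNIV"
    unfolding p_def q_def by (intro holomorphic_intros a_hol F1)+
  have gq: "g z * q z = h z * p z" for z
    using k[of z] by (simp add: X_def L_def p_def q_def algebra_simps)
  obtain z1 where z1: "g z1 \<noteq> 0" using gh_nz by blast
  have bdd: "\<exists>B. eventually (\<lambda>z. norm (p z) \<le> B * norm (g z)) (at z0)" for z0
  proof (cases "g z0 = 0")
    case False
    have "isCont (\<lambda>z. p z / g z) z0"
      using False by (intro continuous_intros entire_isCont p g)
    then have "((\<lambda>z. norm (p z / g z)) \<longlongrightarrow> norm (p z0 / g z0)) (at z0)"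
      by (intro tendsto_norm) (simp add: isCont_def)
    then have "eventually (\<lambda>z. norm (p z / g z) < norm (p z0 / g z0) + 1) (at z0)"
      by (rule order_tendstoD(2)) simp
    then have "eventually (\<lambda>z. norm (p z) \<le> (norm (p z0 / g z0) + 1) * norm (g z)) (at z0)"
      using entire_eventually_nonzero[OF g z1, of z0]
      by eventually_elim (simp add: norm_divide divide_less_eq)
    then show ?thesis by blast
  next
    case True
    \<comment> \<open>At a zero of \<open>g\<close> the identity \<open>g * q = h * p\<close> is
      read as \<open>p = (q / h) * g\<close>.\<close>
    then have hz: "h z0 \<noteq> 0" using coprime by blast
    have "isCont (\<lambda>z. q z / h z) z0"
      using hz by (intro continuous_intros entire_isCont q h)
    then have "((\<lambda>z. norm (q z / h z)) \<longlongrightarrow> norm (q z0 / h z0)) (at z0)"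
      by (intro tendsto_norm) (simp add: isCont_def)
    then have "eventually (\<lambda>z. norm (q z / h z) < norm (q z0 / h z0) + 1) (at z0)"
      by (rule order_tendstoD(2)) simp
    then have "eventually (\<lambda>z. norm (p z) \<le> (norm (q z0 / h z0) + 1) * norm (g z)) (at z0)"
      using entire_eventually_nonzero[OF h hz, of z0]
    proof eventually_elim
      fix z assume z: "norm (q z / h z) < norm (q z0 / h z0) + 1" "h z \<noteq> 0"
      then have "p z = (q z / h z) * g z" using gq[of z] by (simp add: field_simps)
      then have "norm (p z) = norm (q z / h z) * norm (g z)" by (simp only: norm_mult)
      also have "\<dots> \<le> (norm (q z0 / h z0) + 1) * norm (g z)"
        using z by (intro mult_right_mono) auto
      finally show "norm (p z) \<le> (norm (q z0 / h z0) + 1) * norm (g z)" .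
    qed
    then show ?thesis by blast
  qed
  obtain s where s: "s holomorphic_on UNIV" "\<And>z. p z = s z * g z"
    using removable_quotient[OF p g z1 bdd] by blast
  have s_nz: "\<exists>z. s z \<noteq> 0"
  proof (rule ccontr)
    assume "\<nexists>z. s z \<noteq> 0"
    then have p0: "p z = 0" for z using s(2) by simp
    have "g z * q z = 0" for z using gq[of z] p0 by simp
    then have q0: "q z = 0" for z
      using entire_mult_nonzero[OF g gh_nz(1) q] by blast
    have "k * (a 1 z * a 2 z) = 0" for z
    proof -
      \<comment> \<open>If \<open>s\<close> vanished identically, so would \<open>p\<close> and
        \<open>q\<close>; this identity then forces \<open>k = 0\<close> and hence
        \<open>X 0 = 0\<close>.\<close>
      have "k * (a 1 z * a 2 z) = p z - q z"
        by (simp add: p_def q_def a_def algebra_simps)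
      then show ?thesis using p0[of z] q0[of z] by simp
    qed
    moreover have "\<exists>z. a 1 z * a 2 z \<noteq> 0"
      by (rule entire_mult_nonzero[OF a_hol a_nz a_hol a_nz])
    ultimately have "k = 0" by (metis mult_eq_0_iff)
    then show False using k X_nz[of 0] by simp
  qed
  then obtain z2 where z2: "s z2 \<noteq> 0" by blast
  obtain C1 where C1: "C1 \<ge> 0" "\<And>r. r \<ge> 1 \<Longrightarrow> regular s r \<Longrightarrow> - C1 \<le> cmean (ln_norm s) r"
    using cmean_ln_lower[OF s(1) z2] by metis
  define C2 where "C2 = ln (2 + 2 * norm k)"
  have sg: "(\<lambda>z. s z * g z) holomorphic_on UNIV" by (intro holomorphic_intros s g)
  obtain z3 where z3: "s z3 * g z3 \<noteq> 0" using entire_mult_nonzero[OF s(1) s_nz g gh_nz(1)] by blast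
  show ?thesis
  proof (rule that)
    fix r0 :: real assume r0: "r0 \<ge> 1"
    then obtain r where r: "r0 < r" "r < r0 + 1" "regular (\<lambda>z. s z * g z) r"
      using ex_regular[OF sg z3, of r0 "r0 + 1"] by auto
    have regs: "regular s r" using r(3) by (simp add: regular_def)
    have "Tchar g h r \<le> cmean (\<lambda>z. (C2 + 2 * M z) - ln (norm (s z))) r"
      unfolding Tchar_def
    proof (rule cmean_mono)
      fix z :: complex assume z: "norm z = r"
      then have nz: "s z \<noteq> 0" "g z \<noteq> 0" using r(3) by (auto simp: regular_def)
      have qz: "q z = s z * h z" using gq[of z] s(2)[of z] nz by simp
      have e1: "1 \<le> exp (M z)" "exp (M z) \<le> exp (2 * M z)" using M_nonneg[of z] by auto
      have ee: "exp (M z) * exp (M z) = exp (2 * M z)" by (simp flip: exp_add)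
      have ka: "norm (k * a 1 z) \<le> norm k * (2 * exp (M z))"
        unfolding norm_mult by (intro mult_left_mono a_bound) auto
      have "norm (p z) \<le> norm (a 0 z) + norm (k * a 1 z)"
        unfolding p_def by (rule norm_triangle_ineq4)
      also have "\<dots> \<le> 2 * exp (2 * M z) + norm k * (2 * exp (2 * M z))"
      proof (rule add_mono)
        show "norm (a 0 z) \<le> 2 * exp (2 * M z)" using a_bound[of 0 z] e1 by linarith
        have "norm k * (2 * exp (M z)) \<le> norm k * (2 * exp (2 * M z))"
          by (intro mult_left_mono) (use e1 in simp_all)
        then show "norm (k * a 1 z) \<le> norm k * (2 * exp (2 * M z))" using ka by linarith
      qed
      finally have pb: "norm (p z) \<le> (2 + 2 * norm k) * exp (2 * M z)" by (simp add: algebra_simps)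
      have "norm (q z) \<le> norm (a 0 z) + norm (k * a 1 z) * norm (F1 z)"
        unfolding q_def by (metis norm_triangle_ineq4 norm_mult)
      also have "\<dots> \<le> 2 * exp (2 * M z) + norm k * (2 * exp (M z)) * exp (M z)"
      proof (intro add_mono mult_mono ka M_F1)
        show "norm (a 0 z) \<le> 2 * exp (2 * M z)" using a_bound[of 0 z] e1 by linarith
      qed auto
      also have "\<dots> = (2 + 2 * norm k) * exp (2 * M z)" unfolding ee[symmetric] by (simp add: algebra_simps)
      finally have qb: "norm (q z) \<le> (2 + 2 * norm k) * exp (2 * M z)" .
      have "norm (s z) * exp (Vmax g h z) = max (norm (p z)) (norm (q z))"
        by (simp add: exp_Vmax s(2) qz norm_mult max_mult_distrib_left)
      also have "\<dots> \<le> (2 + 2 * norm k) * exp (2 * M z)" using pb qb by simp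
      also have "2 + 2 * norm k = exp C2"
        unfolding C2_def using norm_ge_zero[of k] by (subst exp_ln) linarith+
      finally have "ln (norm (s z) * exp (Vmax g h z)) \<le> ln (exp C2 * exp (2 * M z))"
        using nz by (subst ln_le_cancel_iff) auto
      then show "Vmax g h z \<le> (C2 + 2 * M z) - ln (norm (s z))"
        using nz by (simp add: ln_mult_pos)
    qed (use r0 r regular_ln_continuous[OF s(1) regs] in \<open>auto intro!: continuous_intros Vmax_continuous Mmean_cont\<close>)
    also have "\<dots> = C2 + 2 * cmean M r - cmean (ln_norm s) r"
      using r0 r regular_ln_continuous[OF s(1) regs] by (simp add: cmean_diff cmean_add cmean_cmult continuous_intros Mmean_cont)
    also have "\<dots> \<le> 2 * cmean M (r0 + 1) + (C1 + C2)"
      using C1(2)[OF _ regs] M_mono[of r "r0 + 1"] r r0 by simp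
    finally show "Tchar g h r0 \<le> 2 * cmean M (r0 + 1) + (C1 + C2)"
      using Tchar_mono[of r0 r] r r0 by simp
  qed
qed


lemma ln_ratio_mean:
  obtains C where "C \<ge> 0"
    "\<And>i t. i < 3 \<Longrightarrow> t \<ge> 1 \<Longrightarrow> regular X3 t \<Longrightarrow> - C \<le> cmean (ln_norm (X i)) t"
    "\<And>i t. i < 3 \<Longrightarrow> t \<ge> 1 \<Longrightarrow> regular X3 t \<Longrightarrow> cmean (ln_norm (X i)) t \<le> Tchar g h t + 2 * cmean M t + C"
    "\<And>i j t. i < 3 \<Longrightarrow> j < 3 \<Longrightarrow> t \<ge> 1 \<Longrightarrow> regular X3 t \<Longrightarrow>
       cmean (ln_ratio (X i) (X j)) t \<le> 2 * (Tchar g h t + 2 * cmean M t + C)"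
proof -
  have reg: "regular (X i) t" if "i < 3" "regular X3 t" for i t
  proof -
    have "i = 0 \<or> i = 1 \<or> i = 2" using that(1) by auto
    then show ?thesis using that(2) by (auto simp: regular_def X3_def)
  qed
  have "\<exists>C\<ge>0. \<forall>t\<ge>1. regular (X i) t \<longrightarrow> - C \<le> cmean (ln_norm (X i)) t" for i
  proof -
    obtain x where x: "X i x \<noteq> 0" using X_nz by blast
    show ?thesis using cmean_ln_lower[OF X_hol x] by metis
  qed
  then obtain c where c: "\<And>i. c i \<ge> 0" "\<And>i t. t \<ge> 1 \<Longrightarrow> regular (X i) t \<Longrightarrow> - c i \<le> cmean (ln_norm (X i)) t"
    by metis
  define C where "C = ln 4 + c 0 + c 1 + c 2"
  have cC: "ln 4 + c i \<le> C" if "i < 3" for i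
  proof -
    have "i = 0 \<or> i = 1 \<or> i = 2" using that by auto
    then show ?thesis using c(1)[of 0] c(1)[of 1] c(1)[of 2] by (auto simp: C_def)
  qed
  have ln4: "0 \<le> ln (4::real)" by simp
  define S where "S z = ln 4 + (Vmax g h z + 2 * M z)" for z
  have contS: "continuous_on U S" for U
    unfolding S_def by (intro continuous_intros Vmax_continuous Mmean_cont)
  have meanS: "cmean S t = ln 4 + (Tchar g h t + 2 * cmean M t)" if "t \<ge> 1" for t
    unfolding S_def Tchar_def using that
    by (simp add: cmean_add cmean_cmult continuous_intros Vmax_continuous Mmean_cont)
  have XS: "ln (norm (X i z)) \<le> S z" if "X i z \<noteq> 0" for i z
  proof -
    have "ln (norm (X i z)) \<le> ln (4 * exp (Vmax g h z + 2 * M z))"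
      using X_bound[of i z] that by (subst ln_le_cancel_iff) auto
    then show ?thesis by (simp add: S_def ln_mult_pos)
  qed
  show ?thesis
  proof (rule that)
    show "C \<ge> 0" using ln4 c(1) by (simp add: C_def)
  next
    fix i :: nat and t :: real assume a: "i < 3" "t \<ge> 1" "regular X3 t"
    have "- c i \<le> cmean (ln_norm (X i)) t" by (rule c(2)[OF a(2) reg[OF a(1,3)]])
    then show "- C \<le> cmean (ln_norm (X i)) t" using cC[OF a(1)] ln4 by linarith
    have "cmean (ln_norm (X i)) t \<le> cmean S t"
    proof (rule cmean_mono[OF regular_ln_continuous[OF X_hol reg[OF a(1,3)]] contS])
      show "ln (norm (X i z)) \<le> S z" if "norm z = t" for z
        using XS reg[OF a(1,3)] that by (auto simp: regular_def)
    qed (use a in simp)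
    then show "cmean (ln_norm (X i)) t \<le> Tchar g h t + 2 * cmean M t + C"
      using meanS[OF a(2)] cC[OF a(1)] c(1)[of i] by simp
  next
    fix i j :: nat and t :: real assume a: "i < 3" "j < 3" "t \<ge> 1" "regular X3 t"
    note ci = regular_ln_continuous[OF X_hol reg[OF a(1,4)]] and cj = regular_ln_continuous[OF X_hol reg[OF a(2,4)]]
    have "cmean (ln_ratio (X i) (X j)) t \<le>
          cmean (\<lambda>z. (2 * S z - ln (norm (X i z))) - ln (norm (X j z))) t"
    proof (rule cmean_mono)
      fix z :: complex assume z: "norm z = t"
      have "ln (norm (X i z)) \<le> S z" "ln (norm (X j z)) \<le> S z"
        using XS reg[OF a(1,4)] reg[OF a(2,4)] z by (auto simp: regular_def)
      then show "\<bar>ln (norm (X i z)) - ln (norm (X j z))\<bar> \<le> (2 * S z - ln (norm (X i z))) - ln (norm (X j z))"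
        by linarith
    qed (use a ci cj in \<open>auto intro!: continuous_intros contS\<close>)
    also have "\<dots> = 2 * cmean S t - cmean (ln_norm (X i)) t - cmean (ln_norm (X j)) t"
      using a ci cj by (simp add: cmean_diff cmean_cmult continuous_intros contS)
    also have "\<dots> \<le> 2 * cmean S t + c i + c j"
      using c(2)[OF a(3) reg[OF a(1,4)]] c(2)[OF a(3) reg[OF a(2,4)]] by simp
    also have "\<dots> \<le> 2 * (Tchar g h t + 2 * cmean M t + C)"
      using meanS[OF a(3)] cC[OF a(1)] cC[OF a(2)] by simp
    finally show "cmean (ln_ratio (X i) (X j)) t \<le> 2 * (Tchar g h t + 2 * cmean M t + C)" .
  qed
qed

text \<open>Near every radius there is a circle whose distance from the zeros of all
  \<open>X i\<close> is at least the reciprocal of a polynomial in the radius and the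
  characteristic. The polynomial bound obtained on it turns into logarithmic terms later. One good
  circle in each interval of length 2 is enough because the characteristic increases.\<close>

lemma log_deriv_circle_bound:
  assumes P: "P holomorphic_on UNIV" "P xp \<noteq> 0"
  obtains C where "C \<ge> 0" "\<And>r. r \<ge> 1 \<Longrightarrow> 1 \<le> Tchar g h r + 2 * cmean M r + C"
    "\<And>r0. r0 \<ge> 1 \<Longrightarrow> \<exists>r. r0 \<le> r \<and> r \<le> r0 + 2 \<and> regular X3 r \<and> regular P r \<and>
       (\<forall>z i j. norm z = r \<longrightarrow> i < 3 \<longrightarrow> j < 3 \<longrightarrow>
         norm (deriv (X j) z / X j z - deriv (X i) z / X i z) \<le>
         600 * (r0 + 9)^3 * (Tchar g h (r0 + 9) + 2 * cmean M (r0 + 9) + C)^2)"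
proof -
  obtain C0 where C0: "C0 \<ge> 0"
    "\<And>i t. i < 3 \<Longrightarrow> t \<ge> 1 \<Longrightarrow> regular X3 t \<Longrightarrow> - C0 \<le> cmean (ln_norm (X i)) t"
    "\<And>i t. i < 3 \<Longrightarrow> t \<ge> 1 \<Longrightarrow> regular X3 t \<Longrightarrow> cmean (ln_norm (X i)) t \<le> Tchar g h t + 2 * cmean M t + C0"
    "\<And>i j t. i < 3 \<Longrightarrow> j < 3 \<Longrightarrow> t \<ge> 1 \<Longrightarrow> regular X3 t \<Longrightarrow>
       cmean (ln_ratio (X i) (X j)) t \<le> 2 * (Tchar g h t + 2 * cmean M t + C0)"
    by (rule ln_ratio_mean) blast
  \<comment> \<open>Large enough for \<open>Y\<close> to be at least 1 and at least
    \<open>C0\<close> at every nonnegative radius.\<close>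
  define C where "C = C0 + 1 + \<bar>Tchar g h 0\<bar> + C0"
  define Y where "Y t = Tchar g h t + 2 * cmean M t + C" for t
  have M0: "cmean M t \<ge> 0" if "t \<ge> 0" for t
    using cmean_mono[of t "\<lambda>_. 0" M] M_nonneg Mmean_cont that by simp
  have Y1: "Y t \<ge> 1" "Y t \<ge> C0" if "t \<ge> 0" for t
    using Tchar_mono[of 0 t] M0[OF that] that C0(1) by (simp_all add: Y_def C_def)
  have Ymono: "Y s \<le> Y t" if "0 \<le> s" "s \<le> t" for s t
    using Tchar_mono[OF that] M_mono[OF that] by (simp add: Y_def)
  obtain x3 where x3: "X3 x3 \<noteq> 0" using X3_nz by blast
  have reg: "regular (X i) t" if "i < 3" "regular X3 t" for i t
  proof -
    have "i = 0 \<or> i = 1 \<or> i = 2" using that(1) by auto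
    then show ?thesis using that(2) by (auto simp: regular_def X3_def)
  qed
  have main: "\<exists>r. r0 \<le> r \<and> r \<le> r0 + 2 \<and> regular X3 r \<and> regular P r \<and>
       (\<forall>z i j. norm z = r \<longrightarrow> i < 3 \<longrightarrow> j < 3 \<longrightarrow>
         norm (deriv (X j) z / X j z - deriv (X i) z / X i z) \<le> 600 * (r0 + 9)^3 * (Y (r0 + 9))^2)"
    if r0: "r0 \<ge> 1" for r0
  proof -
    define \<rho> where "\<rho> = r0 + 9"
    define y where "y = Y \<rho>"
    have \<rho>: "\<rho> \<ge> 10" and y: "y \<ge> 1" "y \<ge> C0" using r0 Y1[of \<rho>] by (auto simp: \<rho>_def y_def)
    \<comment> \<open>\<open>R\<close> serves the derivative estimate, \<open>r1\<close> lies beyond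
      \<open>R + 1\<close> so as to count the zeros involved, and the growth from \<open>r1\<close>
      to \<open>r2\<close> bounds this count. All three stay below \<open>r0 + 8\<close>, hence
      below \<rho>.\<close>
    obtain R where R: "r0 + 3 < R" "R < r0 + 4" "regular X3 R"
      using ex_regular[OF X3_hol x3, of "r0 + 3" "r0 + 4"] r0 by auto
    obtain r1 where r1: "R + 1 < r1" "r1 < R + 2" "regular X3 r1"
      using ex_regular[OF X3_hol x3, of "R + 1" "R + 2"] r0 R by auto
    obtain r2 where r2: "r1 + 1 < r2" "r2 < r1 + 2" "regular X3 r2"
      using ex_regular[OF X3_hol x3, of "r1 + 1" "r1 + 2"] r0 R r1 by auto
    have n: "zcount (X i) (R + 1) \<le> 4 * \<rho> * y" if i: "i < 3" for i
    proof -
      obtain x where x: "X i x \<noteq> 0" using X_nz by blast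
      have "zcount (X i) (R + 1) \<le> zcount (X i) r1"
        by (rule zcount_mono[OF X_hol x]) (use r1 in simp)
      also have "\<dots> \<le> 2 * r1 * (cmean (ln_norm (X i)) r2 - cmean (ln_norm (X i)) r1)"
        by (rule zcount_le_mean[OF X_hol x]) (use r0 R r1 r2 reg[OF i] in auto)
      also have "\<dots> \<le> 2 * \<rho> * (2 * y)"
      proof (rule mult_mono)
        have "cmean (ln_norm (X i)) r2 \<le> Y r2"
          using C0(3)[OF i _ r2(3)] r0 R r1 r2 C0(1) by (simp add: Y_def C_def)
        also have "\<dots> \<le> y" unfolding y_def by (rule Ymono) (use r0 R r1 r2 in \<open>auto simp: \<rho>_def\<close>)
        finally show "cmean (ln_norm (X i)) r2 - cmean (ln_norm (X i)) r1 \<le> 2 * y"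
          using C0(2)[OF i _ r1(3)] r0 R r1 y by simp
        have "0 \<le> zcount (X i) r1" by (rule zcount_nonneg)
        show "0 \<le> cmean (ln_norm (X i)) r2 - cmean (ln_norm (X i)) r1"
          using cmean_ln_mono'[OF X_hol x, of r1 r2] reg[OF i r1(3)] reg[OF i r2(3)] r0 R r1 r2 by simp
      qed (use \<rho> r0 R r1 in \<open>auto simp: \<rho>_def\<close>)
      finally show ?thesis by (simp add: mult_ac)
    qed
    define N where "N = norm ` (zset (X 0) (R+1) \<union> zset (X 1) (R+1) \<union> zset (X 2) (R+1))"
    have finz: "finite (zset (X i) (R+1))" for i
    proof -
      obtain x where "X i x \<noteq> 0" using X_nz by blast
      then show ?thesis by (rule finite_zset[OF X_hol])
    qed
    have cardz: "real (card (zset (X i) (R+1))) \<le> 4 * \<rho> * y" if "i < 3" for i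
    proof -
      obtain x where "X i x \<noteq> 0" using X_nz by blast
      then show ?thesis using card_zset_le[OF X_hol, of i x "R+1"] n[OF that] by linarith
    qed
    define m where "m = card (zset (X 0) (R+1)) + card (zset (X 1) (R+1)) + card (zset (X 2) (R+1))"
    have finN: "finite N" unfolding N_def using finz by simp
    have "card N \<le> m"
    proof -
      have "card N \<le> card (zset (X 0) (R+1) \<union> zset (X 1) (R+1) \<union> zset (X 2) (R+1))"
        unfolding N_def using finz by (intro card_image_le) simp
      also have "\<dots> \<le> m" unfolding m_def by (meson add_le_mono1 card_Un_le order_trans)
      finally show ?thesis .
    qed
    then obtain r' where r': "r0 \<le> r'" "r' \<le> r0 + 1" "\<And>x. x \<in> N \<Longrightarrow> \<bar>x - r'\<bar> \<ge> 1 / (2 * (real m + 1))"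
      using ex_separated_radius[OF finN, of m r0] by blast
    \<comment> \<open>Half of the guaranteed separation: the radius can still be moved by less than
      \<delta> to make it regular for \<open>P\<close>.\<close>
    define \<delta> where "\<delta> = 1 / (4 * (real m + 1))"
    have \<delta>: "\<delta> > 0" "\<delta> \<le> 1" and \<delta>2: "1 / (2 * (real m + 1)) = 2 * \<delta>" by (simp_all add: \<delta>_def field_simps)
    obtain r where r0r: "r' < r" "r < r' + \<delta>" "regular P r"
      using ex_regular[OF P, of r' "r' + \<delta>"] r' r0 \<delta> by auto
    have r: "r0 \<le> r" "r \<le> r0 + 2" "\<And>x. x \<in> N \<Longrightarrow> \<bar>x - r\<bar> \<ge> \<delta>"
    proof -
      show "r0 \<le> r" "r \<le> r0 + 2" using r0r r' \<delta> by linarith+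
      show "\<bar>x - r\<bar> \<ge> \<delta>" if "x \<in> N" for x
        using r'(3)[OF that] r0r unfolding \<delta>2 by linarith
    qed
    have ry1: "\<rho> * y \<ge> 10" using mult_mono[OF \<rho> y(1)] \<rho> y by simp
    have mb: "real m \<le> 12 * \<rho> * y"
      using cardz[of 0] cardz[of 1] cardz[of 2] by (simp add: m_def)
    \<comment> \<open>Here \<open>1 / \<delta>\<close> is \<open>4 * (m + 1)\<close>, which is at
      most \<open>48 * \<rho> * y + 4\<close>, and \<open>\<rho> * y\<close> is at least 10.\<close>
    have inv: "1 / \<delta> \<le> 56 * \<rho> * y"
      using mb ry1 by (simp add: \<delta>_def)
    have sep: "norm (z - a) \<ge> \<delta>" if "norm z = r" "i < 3" "a \<in> zset (X i) (R+1)" for z a i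
    proof -
      have "i = 0 \<or> i = 1 \<or> i = 2" using that(2) by auto
      then have "norm a \<in> N" using that(3) by (auto simp: N_def)
      from r(3)[OF this] have "\<bar>norm a - norm z\<bar> \<ge> \<delta>" using that(1) by simp
      then show ?thesis using norm_triangle_ineq3[of z a] by linarith
    qed
    have regr: "regular X3 r"
      unfolding regular_def
    proof (intro allI impI notI)
      fix z :: complex assume z: "norm z = r" "X3 z = 0"
      then have "X 0 z = 0 \<or> X 1 z = 0 \<or> X 2 z = 0" by (simp add: X3_def disj_assoc)
      moreover have "(0::nat) < 3" "(1::nat) < 3" "(2::nat) < 3" by simp_all
      ultimately obtain i where "i < 3" "X i z = 0" by blast
      then have "norm (z - z) \<ge> \<delta>" using z r R by (intro sep[of z i]) (auto simp: zset_def)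
      then show False using \<delta> by simp
    qed
    have "norm (deriv (X j) z / X j z - deriv (X i) z / X i z) \<le> 600 * \<rho>^3 * y^2"
      if z: "norm z = r" and ij: "i < 3" "j < 3" for z i j
    proof -
      obtain xi xj where x: "X i xi \<noteq> 0" "X j xj \<noteq> 0" using X_nz by metis
      let ?n = "zcount (X j) (R+1) + zcount (X i) (R+1)"
      have nb: "?n \<le> 8 * \<rho> * y" using n[OF ij(1)] n[OF ij(2)] by simp
      have n0: "0 \<le> ?n" using zcount_nonneg by (simp add: add_nonneg_nonneg)
      have "norm (deriv (X j) z / X j z - deriv (X i) z / X i z) \<le> ?n / \<delta> +
          2 * R * (cmean (ln_ratio (X j) (X i)) R + 2 * ?n * ln (3 * R))"
        by (rule log_deriv_bound[OF X_hol x(2) X_hol x(1)])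
           (use R r0 r z \<delta> reg ij sep[OF z ij(1)] sep[OF z ij(2)] in auto)
      also have "\<dots> \<le> (8 * \<rho> * y) * (56 * \<rho> * y) + 2 * \<rho> * (2 * y + 2 * (8 * \<rho> * y) * (3 * \<rho>))"
      proof (intro add_mono)
        show "?n / \<delta> \<le> (8 * \<rho> * y) * (56 * \<rho> * y)"
          using mult_mono[OF nb inv] \<delta> \<rho> y n0 by simp
        have "cmean (ln_ratio (X j) (X i)) R \<le> 2 * Y R"
          using C0(4)[OF ij(2,1) _ R(3)] r0 R C0(1) by (simp add: Y_def C_def)
        also have "Y R \<le> y" unfolding y_def by (rule Ymono) (use r0 R in \<open>auto simp: \<rho>_def\<close>)
        finally have c: "cmean (ln_ratio (X j) (X i)) R \<le> 2 * y" by simp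
        have "ln (3 * R) \<le> 3 * R" using ln_le_minus_one[of "3 * R"] r0 R by simp
        then have l: "ln (3 * R) \<le> 3 * \<rho>" "0 \<le> ln (3 * R)" using r0 R by (auto simp: \<rho>_def)
        have nl: "2 * ?n * ln (3 * R) \<le> 2 * (8 * \<rho> * y) * (3 * \<rho>)"
          using nb l n0 \<rho> y by (intro mult_mono) auto
        have c0: "0 \<le> cmean (ln_ratio (X j) (X i)) R"
          using cmean_mono[of R "\<lambda>_. 0" "\<lambda>z. \<bar>ln (norm (X j z)) - ln (norm (X i z))\<bar>"]
            regular_ln_continuous[OF X_hol reg[OF ij(1) R(3)]] regular_ln_continuous[OF X_hol reg[OF ij(2) R(3)]] r0 R
          by (simp add: continuous_intros)
        show "2 * R * (cmean (ln_ratio (X j) (X i)) R + 2 * ?n * ln (3 * R)) \<le>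
              2 * \<rho> * (2 * y + 2 * (8 * \<rho> * y) * (3 * \<rho>))"
        proof (rule mult_mono)
          show "cmean (ln_ratio (X j) (X i)) R + 2 * ?n * ln (3 * R) \<le>
              2 * y + 2 * (8 * \<rho> * y) * (3 * \<rho>)"
            by (rule add_mono[OF c nl])
          show "0 \<le> cmean (ln_ratio (X j) (X i)) R + 2 * ?n * ln (3 * R)"
            using l by (intro add_nonneg_nonneg c0 mult_nonneg_nonneg zcount_nonneg) auto
          show "2 * R \<le> 2 * \<rho>" using R by (simp add: \<rho>_def)
        qed (use \<rho> in simp)
      qed
      \<comment> \<open>The expanded coefficients 448, 4 and 96 add up to 548.\<close>
      also have "\<dots> \<le> 600 * \<rho>^3 * y^2"
      proof -
        have e1: "\<rho>^2 \<le> \<rho>^3" "\<rho> \<le> \<rho>^3" using \<rho> power_increasing[of 2 3 \<rho>] power_increasing[of 1 3 \<rho>] by auto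
        have e2: "y \<le> y^2" using y power_increasing[of 1 2 y] by auto
        have "\<rho>^2 * y^2 \<le> \<rho>^3 * y^2" "\<rho> * y \<le> \<rho>^3 * y^2" "\<rho>^3 * y \<le> \<rho>^3 * y^2"
          using e1 e2 \<rho> y by (auto intro!: mult_mono)
        moreover have "(8 * \<rho> * y) * (56 * \<rho> * y) + 2 * \<rho> * (2 * y + 2 * (8 * \<rho> * y) * (3 * \<rho>)) =
                 448 * (\<rho>^2 * y^2) + 4 * (\<rho> * y) + 96 * (\<rho>^3 * y)"
          by (simp add: power2_eq_square power3_eq_cube algebra_simps)
        moreover have "0 \<le> \<rho>^3 * y^2" using \<rho> by simp
        ultimately show ?thesis by (simp only: mult.assoc[of 600])
      qed
      finally show ?thesis .
    qed
    then show ?thesis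
      using r r0r(3) regr by (auto simp: \<rho>_def y_def)
  qed
  show ?thesis
  proof (rule that[of C])
    show "C \<ge> 0" using C0(1) by (simp add: C_def)
    show "1 \<le> Tchar g h r + 2 * cmean M r + C" if "r \<ge> 1" for r
      using Y1(1)[of r] that by (simp add: Y_def)
  qed (use main in \<open>simp_all add: Y_def\<close>)
qed

text \<open>Circle means are taken of the logarithm of \<open>|Q| * exp (Vmax g h)\<close>, where
  \<open>Q\<close> is the entire quotient whose poles \<open>D\<close> has absorbed. The mean of
  \<open>ln |Q|\<close> is bounded below, so no counting function remains. The logarithmic terms
  stem from the polynomial bound for the logarithmic derivatives.\<close>

theorem second_main:
  obtains C where "C \<ge> 0" "\<And>r. r \<ge> 1 \<Longrightarrow> 1 \<le> Tchar g h r + 2 * cmean M r + C"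
    "\<And>r. r \<ge> 1 \<Longrightarrow> Tchar g h r \<le> 9 * cmean M (r + 9) + 3 * ln (r + 9) +
        2 * ln (Tchar g h (r + 9) + 2 * cmean M (r + 9) + C) + C"
proof -
  have M0: "cmean M t \<ge> 0" if "t \<ge> 0" for t
    using cmean_mono[of t "\<lambda>_. 0" M] M_nonneg Mmean_cont that by simp
  show ?thesis
  proof (cases "\<exists>z. W z \<noteq> 0")
    case False
    then obtain C2 where C2: "\<And>r. r \<ge> 1 \<Longrightarrow> Tchar g h r \<le> 2 * cmean M (r + 1) + C2"
      using degenerate_bound by blast
    define C1 where "C1 = 1 + \<bar>Tchar g h 0\<bar>"
    have C1: "C1 \<ge> 0" "\<And>r. r \<ge> 1 \<Longrightarrow> 1 \<le> Tchar g h r + 2 * cmean M r + C1"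
    proof -
      fix r :: real assume "r \<ge> 1"
      then show "1 \<le> Tchar g h r + 2 * cmean M r + C1"
        using Tchar_mono[of 0 r] M0[of r] by (simp add: C1_def)
    qed (simp add: C1_def)
    show ?thesis
    proof (rule that[of "C1 + \<bar>C2\<bar>"])
      fix r :: real assume r: "r \<ge> 1"
      show "1 \<le> Tchar g h r + 2 * cmean M r + (C1 + \<bar>C2\<bar>)" using C1(2)[OF r] by simp
      have "Tchar g h r \<le> 2 * cmean M (r + 9) + \<bar>C2\<bar>"
        using C2[OF r] M_mono[of "r + 1" "r + 9"] r by simp
      moreover have "0 \<le> ln (r + 9)" using r by simp
      moreover have "0 \<le> ln (Tchar g h (r + 9) + 2 * cmean M (r + 9) + (C1 + \<bar>C2\<bar>))"
        using C1(2)[of "r + 9"] r by (intro ln_ge_zero) simp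
      ultimately show "Tchar g h r \<le> 9 * cmean M (r + 9) + 3 * ln (r + 9) +
        2 * ln (Tchar g h (r + 9) + 2 * cmean M (r + 9) + (C1 + \<bar>C2\<bar>)) + (C1 + \<bar>C2\<bar>)"
        using M0[of "r + 9"] r C1(1) by linarith
    qed (use C1 in simp)
  next
    case True
    obtain Q where Q: "Q holomorphic_on UNIV" "\<And>z. D z * A3 z * W z * A3 z = Q z * X3 z"
      by (rule wronskian_quotient) blast
    have "\<exists>z. D z * A3 z * W z * A3 z \<noteq> 0"
      by (intro entire_mult_nonzero holomorphic_intros D A3_hol W_hol A3_nz D_nz True)
    then obtain x where x: "Q x \<noteq> 0" using Q(2) by auto
  obtain C1 where C1: "C1 \<ge> 0" "\<And>r. r \<ge> 1 \<Longrightarrow> 1 \<le> Tchar g h r + 2 * cmean M r + C1"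
    "\<And>r0. r0 \<ge> 1 \<Longrightarrow> \<exists>r. r0 \<le> r \<and> r \<le> r0 + 2 \<and> regular X3 r \<and> regular Q r \<and>
       (\<forall>z i j. norm z = r \<longrightarrow> i < 3 \<longrightarrow> j < 3 \<longrightarrow>
         norm (deriv (X j) z / X j z - deriv (X i) z / X i z) \<le>
         600 * (r0 + 9)^3 * (Tchar g h (r0 + 9) + 2 * cmean M (r0 + 9) + C1)^2)"
    by (rule log_deriv_circle_bound[OF Q(1) x]) blast
  define Y where "Y t = Tchar g h t + 2 * cmean M t + C1" for t
    obtain C3 where C3: "C3 \<ge> 0" "\<And>r. r \<ge> 1 \<Longrightarrow> regular Q r \<Longrightarrow> - C3 \<le> cmean (ln_norm Q) r"
      using cmean_ln_lower[OF Q(1) x] by metis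
    define C where "C = C1 + C3 + ln (38400 * K)"
    have lnK: "ln (38400 * K) \<ge> 0" using K by simp
    show ?thesis
    proof (rule that[of C])
      show "C \<ge> 0" using C1 C3 lnK by (simp add: C_def)
      show "1 \<le> Tchar g h r + 2 * cmean M r + C" if "r \<ge> 1" for r
        using C1(2)[OF that] C3(1) lnK by (simp add: C_def)
      fix r0 :: real assume r0: "r0 \<ge> 1"
      define y where "y = Y (r0 + 9)"
      have y: "y \<ge> 1" using C1(2)[of "r0 + 9"] r0 by (simp add: y_def Y_def)
      obtain r where r: "r0 \<le> r" "r \<le> r0 + 2" "regular X3 r" "regular Q r"
        and LD: "\<And>z i j. norm z = r \<Longrightarrow> i < 3 \<Longrightarrow> j < 3 \<Longrightarrow>
           norm (deriv (X j) z / X j z - deriv (X i) z / X i z) \<le> 600 * (r0 + 9)^3 * y^2"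
        using C1(3)[OF r0] unfolding y_def Y_def by blast
      define B where "B = 600 * (r0 + 9)^3 * y^2"
      have B: "B > 0" using r0 y by (simp add: B_def)
      \<comment> \<open>The exponent 9 is 4 from \<open>D\<close>, 3 from one factor
        \<open>A3\<close> and 2 from \<open>core_bound\<close>; the constant is 8 times 8, and with
        the 600 in \<open>B\<close> it makes the 38400 in \<open>C\<close>.\<close>
      have pt: "norm (Q z) * exp (Vmax g h z) \<le> 64 * K * B * exp (9 * M z)" if z: "norm z = r" for z
      proof -
        have Xi: "X i z \<noteq> 0" if "i < 3" for i
        proof -
          have "i = 0 \<or> i = 1 \<or> i = 2" using that by auto
          then show ?thesis using r(3) z by (auto simp: regular_def X3_def)
        qed
        have X3z: "X3 z \<noteq> 0" using r(3) z by (simp add: regular_def)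
        have "norm (1 * W z * A3 z) * exp (Vmax g h z) \<le> 8 * exp (2 * M z) * B * norm (X3 z)"
        proof (rule core_bound)
          fix i j :: nat assume ij: "i < 3" "j < 3"
          have "1 * (X i z * deriv (X j) z - deriv (X i) z * X j z) =
                (deriv (X j) z / X j z - deriv (X i) z / X i z) * (X i z * X j z)"
            using Xi[OF ij(1)] Xi[OF ij(2)] by (simp add: field_simps)
          then have "norm (1 * (X i z * deriv (X j) z - deriv (X i) z * X j z)) =
                norm (deriv (X j) z / X j z - deriv (X i) z / X i z) * norm (X i z * X j z)"
            by (simp only: norm_mult)
          also have "\<dots> \<le> B * norm (X i z * X j z)"
            unfolding B_def by (intro mult_right_mono LD z ij) auto
          finally show "norm (1 * (X i z * deriv (X j) z - deriv (X i) z * X j z)) \<le> B * norm (X i z * X j z)" .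
        qed (use B in simp)
        then have w: "norm (W z * A3 z) * exp (Vmax g h z) \<le> 8 * exp (2 * M z) * B * norm (X3 z)" by simp
        have "norm (Q z) * exp (Vmax g h z) * norm (X3 z) = norm (D z * A3 z) * (norm (W z * A3 z) * exp (Vmax g h z))"
          using arg_cong[OF Q(2)[of z], of norm] by (simp add: norm_mult mult_ac)
        also have "\<dots> \<le> (K * exp (4 * M z) * (8 * exp (3 * M z))) * (8 * exp (2 * M z) * B * norm (X3 z))"
          unfolding norm_mult[of "D z"] using K
          by (intro mult_mono w M_D A3_bound) (auto intro!: mult_nonneg_nonneg)
        also have "\<dots> = 64 * K * B * (exp (4 * M z) * exp (3 * M z) * exp (2 * M z)) * norm (X3 z)"
          by simp
        also have "exp (4 * M z) * exp (3 * M z) * exp (2 * M z) = exp (9 * M z)"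
          by (simp flip: exp_add)
        finally show ?thesis using X3z by simp
      qed
      have ln_pt: "ln (norm (Q z)) + Vmax g h z \<le> ln (64 * K * B) + 9 * M z" if "norm z = r" "Q z \<noteq> 0" for z
      proof -
        have "ln (norm (Q z) * exp (Vmax g h z)) \<le> ln (64 * K * B * exp (9 * M z))"
          using pt[OF that(1)] that(2) K B by (subst ln_le_cancel_iff) auto
        then show ?thesis using that(2) K B by (simp add: ln_mult_pos)
      qed
      have bound: "Tchar g h r0 \<le> C3 + ln (64 * K * B) + 9 * cmean M (r0 + 9)"
      proof -
        have "Tchar g h r \<le> C3 + ln (64 * K * B) + 9 * cmean M (r0 + 9)"
        proof -
          note cQ = regular_ln_continuous[OF Q(1) r(4)]
          have "cmean (\<lambda>z. ln (norm (Q z)) + Vmax g h z) r \<le> cmean (\<lambda>z. ln (64 * K * B) + 9 * M z) r"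
            by (rule cmean_mono) (use ln_pt r r0 cQ in \<open>auto intro!: continuous_intros Vmax_continuous Mmean_cont simp: regular_def\<close>)
          then have "cmean (ln_norm Q) r + Tchar g h r \<le> ln (64 * K * B) + 9 * cmean M r"
            using r r0 cQ by (simp add: cmean_add cmean_cmult Tchar_def continuous_intros Vmax_continuous Mmean_cont)
          then show ?thesis
            using C3(2)[OF _ r(4)] M_mono[of r "r0 + 9"] r r0 by simp
        qed
        then show ?thesis using Tchar_mono[of r0 r] r r0 by simp
      qed
      have "64 * K * B = 38400 * K * (r0 + 9)^3 * y^2" by (simp add: B_def)
      then have "ln (64 * K * B) = ln (38400 * K) + 3 * ln (r0 + 9) + 2 * ln y"
        using K r0 y by (simp add: ln_mult_pos ln_realpow)
      moreover have "ln y \<le> ln (Tchar g h (r0 + 9) + 2 * cmean M (r0 + 9) + C)"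
        using y C3(1) lnK by (simp add: y_def Y_def C_def)
      ultimately show "Tchar g h r0 \<le> 9 * cmean M (r0 + 9) + 3 * ln (r0 + 9) +
        2 * ln (Tchar g h (r0 + 9) + 2 * cmean M (r0 + 9) + C) + C"
        using bound C1(1) by (simp add: C_def)
    qed
  qed
qed

end

section \<open>Consequences of slow growth\<close>

lemma coprime_pair_one: "F holomorphic_on UNIV \<Longrightarrow> coprime_pair F (\<lambda>_. 1)"
  by unfold_locales auto

lemma Tchar_one_nonneg:
  assumes "F holomorphic_on UNIV" "r \<ge> 0"
  shows "Tone F r \<ge> 0"
proof -
  interpret coprime_pair F "\<lambda>_. 1" by (rule coprime_pair_one[OF assms(1)])
  show ?thesis
    unfolding Tchar_def
    using cmean_mono[of r "\<lambda>_. 0" "Vone F"] Vmax_continuous assms(2) by (simp add: Vmax_def)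
qed

text \<open>Monotonicity forces the characteristic to vanish at every radius. A continuous
  nonnegative function with mean 0 is 0 on the circle, so \<open>|F| \<le> 1\<close> and Liouville's
  theorem applies.\<close>

lemma entire_constant_of_small_mean:
  assumes F: "F holomorphic_on UNIV"
    and small: "\<And>e r0. e > 0 \<Longrightarrow> \<exists>r\<ge>r0. Tone F r \<le> e"
  shows "\<exists>k. \<forall>z. F z = k"
proof -
  interpret coprime_pair F "\<lambda>_. 1" by (rule coprime_pair_one[OF F])
  have zero: "Tone F r = 0" if "r \<ge> 0" for r
  proof (rule antisym)
    show "Tone F r \<le> 0"
    proof (rule field_le_epsilon)
      fix e :: real assume "e > 0"
      then obtain s where "s \<ge> r" "Tone F s \<le> e" using small by blast
      then show "Tone F r \<le> 0 + e" using Tchar_mono[OF that, of s] by simp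
    qed
  qed (rule Tchar_one_nonneg[OF F that])
  have "norm (F z) \<le> 1" for z
  proof -
    obtain \<alpha> where \<alpha>: "0 \<le> \<alpha>" "\<alpha> \<le> 2 * pi" "z = of_real (norm z) * cis \<alpha>" by (rule polar_form)
    have "integral {0..2*pi} (\<lambda>t. Vone F (of_real (norm z) * cis t)) = 0"
      using zero[of "norm z"] by (simp add: Tchar_def cmean_def)
    moreover have "Vone F w \<ge> 0" for w by (simp add: Vmax_def)
    ultimately have "\<forall>t\<in>{0..2*pi}. Vone F (of_real (norm z) * cis t) = 0"
      using integral_eq_0_iff[OF continuous_on_circle[OF Vmax_continuous], of "norm z" 0 "2*pi"] by simp
    then have "Vone F (of_real (norm z) * cis \<alpha>) = 0"
      using \<alpha>(1,2) by simp
    then have "Vone F z = 0"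
      unfolding \<alpha>(3)[symmetric] .
    then have "ln (max (norm (F z)) 1) = 0" by (simp add: Vmax_def)
    then have "max (norm (F z)) 1 = 1"
      by (subst (asm) ln_eq_zero_iff) (simp_all add: less_max_iff_disj)
    then show ?thesis by (simp add: max_def split: if_splits)
  qed
  then have "bounded (range F)" by (auto simp: bounded_iff)
  then obtain k where "\<And>z. F z = k"
    using Liouville_theorem[OF F] unfolding constant_on_def by blast
  then show ?thesis by blast
qed

context coprime_pair
begin

text \<open>One constant serves all multipliers and shifts, as needed for \<open>c\<close>,
  \<open>2 * c\<close> and \<open>3 * c\<close> together. The choice of \<rho> stays open: a
  multiple of \<open>norm c\<close> gives a small factor at bounded cost in the radius, a multiple
  of \<open>r\<close> gives a factor tending to 0.\<close>

lemma difference_quotient_char: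
  assumes nz: "\<exists>z. g z \<noteq> 0" "\<exists>z. h z \<noteq> 0"
  obtains C where "C \<ge> 0" "\<And>r. r \<ge> 0 \<Longrightarrow> 0 \<le> 2 * Tchar g h r + C"
    "\<And>F c \<rho> r. F holomorphic_on UNIV \<Longrightarrow> (\<And>z. F z * g z * h (z + c) = g (z + c) * h z) \<Longrightarrow>
       \<rho> > norm c \<Longrightarrow> r \<ge> \<rho> + norm c + 1 \<Longrightarrow>
       Tone F r \<le> 4 * norm c / \<rho> * (2 * Tchar g h (r + (\<rho> + norm c)) + C)"
proof -
  obtain z1 z2 where z: "g z1 \<noteq> 0" "h z2 \<noteq> 0" using nz by blast
  obtain C0 where C0: "C0 \<ge> 0" "\<And>r. r \<ge> 1 \<Longrightarrow> regular g r \<Longrightarrow> regular h r \<Longrightarrow>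
       cmean (ln_ratio g h) r \<le> 2 * Tchar g h r + C0"
    using cmean_ln_quotient[OF nz] by blast
  define C where "C = C0 + 2 * \<bar>Tchar g h 0\<bar>"
  have nn: "0 \<le> 2 * Tchar g h r + C" if "r \<ge> 0" for r
    using Tchar_mono[of 0 r] that C0(1) by (simp add: C_def)
  show ?thesis
  proof (rule that)
    show "C \<ge> 0" using C0(1) by (simp add: C_def)
    show "0 \<le> 2 * Tchar g h r + C" if "r \<ge> 0" for r by (rule nn[OF that])
    fix F c \<rho> r
    assume F: "F holomorphic_on UNIV" "\<And>z. F z * g z * h (z + c) = g (z + c) * h z" and \<rho>: "\<rho> > norm c" "r \<ge> \<rho> + norm c + 1"
    show "Tone F r \<le> 4 * norm c / \<rho> * (2 * Tchar g h (r + (\<rho> + norm c)) + C)"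
    proof (rule difference_bound[OF g z(1) h z(2) F \<rho>])
      fix t assume t: "1 \<le> t" "t \<le> r + (\<rho> + norm c)" "regular g t" "regular h t"
      show "cmean (ln_ratio g h) t \<le> 2 * Tchar g h (r + (\<rho> + norm c)) + C"
        using C0(2)[OF t(1,3,4)] Tchar_mono[of t "r + (\<rho> + norm c)"] t by (simp add: C_def)
    next
      show "0 \<le> 2 * Tchar g h (r + (\<rho> + norm c)) + C"
        using \<rho> norm_ge_zero[of c] by (intro nn) linarith
    qed
  qed
qed

text \<open>With \<open>\<rho> = r / 3\<close> the factor is \<open>12 * norm c / r\<close>, which
  outweighs logarithmic growth; multiplying the radius by a constant changes its logarithm only by a
  constant.\<close>

lemma slow_growth_constant:
  assumes nz: "\<exists>z. g z \<noteq> 0" "\<exists>z. h z \<noteq> 0"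
    and F: "F holomorphic_on UNIV" "\<And>z. F z * g z * h (z + c) = g (z + c) * h z"
    and slow: "\<And>r. r \<ge> r1 \<Longrightarrow> Tchar g h r \<le> A * ln (r + 9) + B"
  shows "\<exists>k. \<forall>z. F z = k"
proof (rule entire_constant_of_small_mean[OF F(1)])
  fix e r0 :: real assume e: "e > 0"
  obtain C where C: "C \<ge> 0"
    "\<And>F c \<rho> r. F holomorphic_on UNIV \<Longrightarrow> (\<And>z. F z * g z * h (z + c) = g (z + c) * h z) \<Longrightarrow>
       \<rho> > norm c \<Longrightarrow> r \<ge> \<rho> + norm c + 1 \<Longrightarrow>
       Tone F r \<le> 4 * norm c / \<rho> * (2 * Tchar g h (r + (\<rho> + norm c)) + C)"
    by (rule difference_quotient_char[OF nz]) blast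
  have "((\<lambda>r. 4 * norm c * (3 * (1 / r) * (2 * B + C) + 6 * A * (ln (3 * r) / (3 * r)) * 3)) \<longlongrightarrow> 4 * norm c * (3 * 0 * (2 * B + C) + 6 * A * 0 * 3)) at_top"
  proof (intro tendsto_intros)
    show "((\<lambda>r. 1 / r) \<longlongrightarrow> 0) (at_top :: real filter)"
      using tendsto_inverse_0_at_top[OF filterlim_ident] by (simp add: inverse_eq_divide)
    have "filterlim (\<lambda>r::real. 3 * r) at_top at_top"
      by (rule filterlim_tendsto_pos_mult_at_top[OF tendsto_const _ filterlim_ident]) simp
    then show "((\<lambda>r::real. ln (3 * r) / (3 * r)) \<longlongrightarrow> 0) at_top"
      by (rule filterlim_compose[OF ln_x_over_x_tendsto_0])
  qed
  then have "eventually (\<lambda>r. 4 * norm c * (3 * (1 / r) * (2 * B + C) + 6 * A * (ln (3 * r) / (3 * r)) * 3) < e) at_top"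
    by (rule order_tendstoD(2)) (use e in simp)
  moreover have "eventually (\<lambda>r. r \<ge> max r0 (max r1 (max 9 (3 * norm c + 3)))) at_top"
    by (rule eventually_ge_at_top)
  ultimately have "eventually (\<lambda>r. Tone F r \<le> e \<and> r \<ge> r0) at_top"
  proof eventually_elim
    fix r assume small: "4 * norm c * (3 * (1 / r) * (2 * B + C) + 6 * A * (ln (3 * r) / (3 * r)) * 3) < e"
      and r: "max r0 (max r1 (max 9 (3 * norm c + 3))) \<le> r"
    have r': "r \<ge> r1" "r \<ge> 9" "r / 3 > norm c" "r \<ge> r / 3 + norm c + 1" using r norm_ge_zero[of c] by auto
    have "Tone F r \<le> 4 * norm c / (r / 3) * (2 * Tchar g h (r + (r / 3 + norm c)) + C)"
      by (rule C(2)[OF F r'(3,4)])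
    also have "\<dots> \<le> 4 * norm c / (r / 3) * (2 * (A * ln (3 * r) + B) + C)"
    proof (intro mult_left_mono add_right_mono)
      \<comment> \<open>The radius \<open>3 * r - 9\<close> makes the argument of \<open>ln\<close>
        in \<open>slow\<close> equal to \<open>3 * r\<close>.\<close>
      have "Tchar g h (r + (r / 3 + norm c)) \<le> Tchar g h (3 * r - 9)"
        using r' by (intro Tchar_mono) auto
      also have "\<dots> \<le> A * ln (3 * r) + B" using slow[of "3 * r - 9"] r' by simp
      finally show "Tchar g h (r + (r / 3 + norm c)) \<le> A * ln (3 * r) + B" .
    qed (use r' in auto)
    also have "\<dots> = 4 * norm c * (3 * (1 / r) * (2 * B + C) + 6 * A * (ln (3 * r) / (3 * r)) * 3)"
      using r' by (simp add: field_simps)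
    finally show "Tone F r \<le> e \<and> r \<ge> r0" using small r by simp
  qed
  then obtain r where "Tone F r \<le> e" "r \<ge> r0"
    using eventually_happens'[OF trivial_limit_at_top_linorder] by blast
  then show "\<exists>r\<ge>r0. Tone F r \<le> e" by blast
qed

end

section \<open>Iteration of the growth inequalities\<close>

lemma subexp_mono:
  assumes "subexp T" "eventually (\<lambda>r. S r \<le> T r) at_top"
  shows "subexp S"
  unfolding subexp_def
proof (intro allI impI)
  fix e :: real assume "e > 0"
  then have "eventually (\<lambda>r. T r \<le> exp (e * r)) at_top" using assms(1) by (simp add: subexp_def)
  with assms(2) show "eventually (\<lambda>r. S r \<le> exp (e * r)) at_top"
    by eventually_elim simp
qed

text \<open>The hypothesis makes the multiplicative difference of \<open>E\<close> equal to \<open>E\<^sup>-\<^sup>2\<close>, whose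
  logarithmic mean is twice that of \<open>E\<close> up to a constant; so the difference estimate bounds
  the characteristic of \<open>E\<close> by a fraction of itself.\<close>

lemma antiperiodic_constant:
  assumes E: "E holomorphic_on UNIV" and nz: "\<And>z. E z \<noteq> 0" and inv: "\<And>z. E z * E (z + c) = 1" and c: "c \<noteq> 0"
    and sub: "subexp (Tone E)"
  shows "\<exists>k. \<forall>z. E z = k"
proof -
  interpret coprime_pair E "\<lambda>_. 1" by (rule coprime_pair_one[OF E])
  define F where "F z = (inverse (E z))^2" for z
  have F: "F holomorphic_on UNIV" unfolding F_def by (intro holomorphic_intros E) (use nz in auto)
  have Feq: "F z * E z * 1 = E (z + c) * 1" for z
  proof -
    have "E (z + c) = inverse (E z)" using inv[of z] nz[of z] by (simp add: field_simps)
    then show ?thesis using nz[of z] by (simp add: F_def power2_eq_square)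
  qed
  have enz: "\<exists>z. E z \<noteq> 0" "\<exists>z::complex. (1::complex) \<noteq> 0" using nz by auto
  obtain C where C: "C \<ge> 0" "\<And>r. r \<ge> 0 \<Longrightarrow> 0 \<le> 2 * Tone E r + C"
    "\<And>F c \<rho> r. F holomorphic_on UNIV \<Longrightarrow> (\<And>z. F z * E z * 1 = E (z + c) * 1) \<Longrightarrow>
       \<rho> > norm c \<Longrightarrow> r \<ge> \<rho> + norm c + 1 \<Longrightarrow>
       Tone F r \<le> 4 * norm c / \<rho> * (2 * Tone E (r + (\<rho> + norm c)) + C)"
    by (rule difference_quotient_char[OF enz]) blast
  \<comment> \<open>log+ |F| is twice log+ of \<open>1 / |E|\<close>, that is twice the difference
    of log+ |E| and ln |E|; the mean of ln |E| is its value at 0 because \<open>E\<close> is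
    zero-free.\<close>
  have TF: "Tone F r = 2 * (Tone E r - ln (norm (E 0)))" if "r > 0" for r
  proof -
    have "Vone F z = 2 * (Vone E z - ln (norm (E z)))" for z
    proof (cases "norm (E z) \<ge> 1")
      case True
      then have "norm (F z) \<le> 1"
        by (simp add: F_def norm_power norm_inverse power_le_one inverse_le_1_iff)
      then show ?thesis using True by (simp add: Vmax_def max_def)
    next
      case False
      then have "norm (F z) \<ge> 1" using nz[of z]
        by (simp add: F_def norm_power norm_inverse one_le_power one_le_inverse_iff)
      moreover have "ln (norm (F z)) = - 2 * ln (norm (E z))"
        using nz[of z] by (simp add: F_def norm_power norm_inverse ln_realpow ln_inverse)
      ultimately show ?thesis using False by (simp add: Vmax_def max_def)
    qed
    then have "Vone F = (\<lambda>z. 2 * (Vone E z - ln (norm (E z))))" by (rule ext)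
    then have "Tone F r = cmean (\<lambda>z. 2 * (Vone E z - ln (norm (E z)))) r"
      by (simp only: Tchar_def)
    also have "\<dots> = 2 * (Tone E r - cmean (ln_norm E) r)"
      unfolding cmean_cmult Tchar_def using that nz
      by (subst cmean_diff) (auto intro!: Vmax_continuous continuous_on_ln_norm entire_continuous_on E)
    also have "cmean (ln_norm E) r = ln (norm (E 0))"
      by (rule cmean_ln_nonvanishing[of _ "r + 1"]) (use that nz in \<open>auto intro: holomorphic_on_subset[OF E]\<close>)
    finally show ?thesis .
  qed
  \<comment> \<open>The choice \<open>\<rho> = 16 * norm c\<close> gives the factor 1/4 in the
    difference estimate; \<open>m\<close> is \<open>\<rho> + norm c\<close>.\<close>
  define m where "m = 17 * norm c"
  have m: "m > 0" using c by (simp add: m_def)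
  define D where "D = 2 * (C + \<bar>ln (norm (E 0))\<bar>)"
  define r0 where "r0 = m + 1"
  have step: "Tone E r \<le> Tone E (r + m) / 4 + C / 8 + \<bar>ln (norm (E 0))\<bar>" if "r \<ge> r0" for r
  proof -
    have "r > 0" using that m by (simp add: r0_def)
    have "Tone F r \<le> 4 * norm c / (16 * norm c) * (2 * Tone E (r + (16 * norm c + norm c)) + C)"
      by (rule C(3)[OF F Feq]) (use c that in \<open>auto simp: r0_def m_def\<close>)
    also have "4 * norm c / (16 * norm c) = 1 / 4" using c by simp
    finally show ?thesis using TF[OF \<open>r > 0\<close>] by (simp add: m_def)
  qed
  have bdd: "Tone E r - D \<le> 0" if "r \<ge> r0" for r
  proof (rule subexp_iterate[OF _ m _ that])
    show "subexp (\<lambda>r. Tone E r - D)"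
      by (rule subexp_mono[OF sub]) (use C(1) in \<open>simp add: D_def\<close>)
    fix r assume r: "r \<ge> r0"
    have "0 \<le> Tone E (r + m)"
      by (rule Tchar_one_nonneg[OF E]) (use r m in \<open>simp add: r0_def\<close>)
    then show "Tone E r - D \<le> (Tone E (r + m) - D) / 2"
      using step[OF r] C(1) by (simp add: D_def field_simps)
  qed
  \<comment> \<open>A bounded characteristic is logarithmic growth with coefficient 0.\<close>
  obtain k where k: "\<And>z. F z = k"
    using slow_growth_constant[OF enz F Feq, of r0 0 D] bdd by auto
  have "norm (E z) = norm (E 0)" for z
  proof -
    have "(norm (E z))^2 = (norm (E 0))^2"
    proof -
      have "inverse ((E z)^2) = inverse ((E 0)^2)"
        using k[of z] k[of 0] by (simp add: F_def power_inverse)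
      then have "(E z)^2 = (E 0)^2" by (simp only: inverse_eq_iff_eq)
      then show ?thesis by (simp flip: norm_power)
    qed
    then show ?thesis by simp
  qed
  then have "bounded (range E)"
    by (intro boundedI[of _ "norm (E 0)"]) (metis imageE order_refl)
  then obtain k where "\<And>z. E z = k"
    using Liouville_theorem[OF E] unfolding constant_on_def by blast
  then show ?thesis by blast
qed


text \<open>The slope 1/32 lets twice the logarithm of the characteristic fit, beside the other
  terms, into a total factor of 1/4.\<close>

lemma ln_le_fraction:
  assumes "(y::real) > 0"
  shows "ln y \<le> y / 32 + ln 32"
proof -
  have "ln (y / 32) \<le> y / 32 - 1" using assms by (intro ln_le_minus_one) simp
  then show ?thesis using assms by (simp add: ln_div)
qed

text \<open>With \<rho> equal to 4000 times \<open>norm c\<close>, the \<open>j\<close>-th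
  multiplier costs \<open>j / 1000\<close> of \<open>2 * Tchar g h + C\<close>, in all 6/1000. Even
  after the factor 9 of the second main theorem and the logarithmic term the total stays within 1/4.
  The 4003 adds the largest shift, \<open>3 * c\<close>, to \<rho>.\<close>

lemma three_targets_slow_growth:
  assumes tt: "three_targets g h F1 F2 D (\<lambda>z. Vone F1 z + Vone F2 z + Vone F3 z) K"
    and F3: "F3 holomorphic_on UNIV"
    and e1: "\<And>z. F1 z * g z * h (z + c) = g (z + c) * h z"
    and e2: "\<And>z. F2 z * g z * h (z + 2 * c) = g (z + 2 * c) * h z"
    and e3: "\<And>z. F3 z * g z * h (z + 3 * c) = g (z + 3 * c) * h z"
    and c: "c \<noteq> 0" and sub: "subexp (Tchar g h)"
  obtains r1 A B where "\<And>r. r \<ge> r1 \<Longrightarrow> Tchar g h r \<le> A * ln (r + 9) + B"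
proof -
  define M where "M z = Vone F1 z + Vone F2 z + Vone F3 z" for z
  interpret three_targets g h F1 F2 D M K
    using tt by (simp add: M_def[abs_def])
  define d where "d = norm c"
  have d: "d > 0" using c by (simp add: d_def)
  have nd: "norm c = 1 * d" "norm (2 * c) = 2 * d" "norm (3 * c) = 3 * d" by (simp_all add: d_def norm_mult)
  obtain C where C: "C \<ge> 0" "\<And>r. r \<ge> 0 \<Longrightarrow> 0 \<le> 2 * Tchar g h r + C"
    "\<And>F c \<rho> r. F holomorphic_on UNIV \<Longrightarrow> (\<And>z. F z * g z * h (z + c) = g (z + c) * h z) \<Longrightarrow>
       \<rho> > norm c \<Longrightarrow> r \<ge> \<rho> + norm c + 1 \<Longrightarrow>
       Tone F r \<le> 4 * norm c / \<rho> * (2 * Tchar g h (r + (\<rho> + norm c)) + C)"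
    by (rule difference_quotient_char[OF gh_nz]) blast
  have Mmean: "cmean M r \<le> 6 / 1000 * (2 * Tchar g h (r + 4003 * d) + C)" if r: "r \<ge> 4003 * d + 1" for r
  proof -
    have r0: "r \<ge> 0" using r d by simp
    have one: "Tone F r \<le> j / 1000 * (2 * Tchar g h (r + 4003 * d) + C)"
      if F: "F holomorphic_on UNIV" "\<And>z. F z * g z * h (z + c') = g (z + c') * h z" and j: "norm c' = j * d" "0 < j" "j \<le> 3" for F c' j
    proof -
      have jd: "j * d \<le> 3 * d" "j * d > 0" using j d by (auto intro: mult_right_mono)
      have "Tone F r \<le> 4 * norm c' / (4000 * d) * (2 * Tchar g h (r + (4000 * d + norm c')) + C)"
        by (rule C(3)[OF F]) (use jd r d j(1) in linarith)+
      also have "4 * norm c' / (4000 * d) = j / 1000" using j d by simp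
      also have "j / 1000 * (2 * Tchar g h (r + (4000 * d + norm c')) + C) \<le> j / 1000 * (2 * Tchar g h (r + 4003 * d) + C)"
      proof -
        have "Tchar g h (r + (4000 * d + norm c')) \<le> Tchar g h (r + 4003 * d)"
          using j(1) jd r0 d by (intro Tchar_mono) linarith+
        then show ?thesis using j by (intro mult_left_mono) auto
      qed
      finally show ?thesis .
    qed
    note cp = coprime_pair.Vmax_continuous[OF coprime_pair_one]
    have "cmean M r = Tone F1 r + Tone F2 r + Tone F3 r"
      unfolding M_def Tchar_def using r0
      by (simp add: cmean_add continuous_intros cp F1 F2 F3)
    moreover have "Tone F1 r \<le> 1 / 1000 * (2 * Tchar g h (r + 4003 * d) + C)"
      by (rule one[OF F1 e1 nd(1)]) simp_all
    moreover have "Tone F2 r \<le> 2 / 1000 * (2 * Tchar g h (r + 4003 * d) + C)"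
      by (rule one[OF F2 e2 nd(2)]) simp_all
    moreover have "Tone F3 r \<le> 3 / 1000 * (2 * Tchar g h (r + 4003 * d) + C)"
      by (rule one[OF F3 e3 nd(3)]) simp_all
    ultimately show ?thesis by (simp add: field_simps)
  qed
  obtain C' where C': "C' \<ge> 0" "\<And>r. r \<ge> 1 \<Longrightarrow> 1 \<le> Tchar g h r + 2 * cmean M r + C'"
    "\<And>r. r \<ge> 1 \<Longrightarrow> Tchar g h r \<le> 9 * cmean M (r + 9) + 3 * ln (r + 9) +
        2 * ln (Tchar g h (r + 9) + 2 * cmean M (r + 9) + C') + C'"
    by (rule second_main) blast
  define m where "m = 9 + 4003 * d"
  have m: "m > 0" using d by (simp add: m_def)
  define r1 where "r1 = 4003 * d + 1"
  define B where "B = C + 2 * C' + 2 * ln 32"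
  have l32: "0 \<le> ln (32::real)" by simp
  have key: "Tchar g h r \<le> Tchar g h (r + m) / 4 + 3 * ln (r + 9) + B" if r: "r \<ge> r1" for r
  proof -
    have r': "r \<ge> 1" "r + 9 \<ge> 4003 * d + 1" using r d by (simp_all add: r1_def)
    define T where "T = Tchar g h (r + m)"
    define y where "y = Tchar g h (r + 9) + 2 * cmean M (r + 9) + C'"
    have nn: "0 \<le> 2 * T + C" unfolding T_def using r' m by (intro C(2)) simp
    have Mm: "cmean M (r + 9) \<le> 6 / 1000 * (2 * T + C)"
      using Mmean[OF r'(2)] by (simp add: T_def m_def add.assoc)
    have "Tchar g h (r + 9) \<le> T"
      unfolding T_def using r' d by (intro Tchar_mono) (simp_all add: m_def)
    then have y: "y \<le> T + 12 / 1000 * (2 * T + C) + C'" "y \<ge> 1"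
      using Mm C'(2)[of "r + 9"] r' unfolding y_def by linarith+
    have "Tchar g h r \<le> 9 * cmean M (r + 9) + 3 * ln (r + 9) + 2 * ln y + C'"
      unfolding y_def by (rule C'(3)[OF r'(1)])
    also have "\<dots> \<le> 9 * (6 / 1000 * (2 * T + C)) + 3 * ln (r + 9) + 2 * (y / 32 + ln 32) + C'"
    proof (intro add_mono mult_left_mono Mm order_refl)
      show "ln y \<le> y / 32 + ln 32" using y(2) by (intro ln_le_fraction) simp
    qed simp_all
    also have "\<dots> \<le> T / 4 + 3 * ln (r + 9) + B"
      using y(1) nn C(1) C'(1) by (simp add: B_def field_simps)
    finally show ?thesis by (simp add: T_def)
  qed
  \<comment> \<open>Subtracting \<open>12 * ln (r + 9) + E\<close> removes the inhomogeneous terms: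
    3 - 12 lies below -6, half of the subtracted multiple, and \<open>E\<close> covers the constants
    and the change of \<open>ln\<close> over one step.\<close>
  define E where "E = 2 * (B + 6 * ln (1 + m) + C)"
  have "Tchar g h r - 12 * ln (r + 9) - E \<le> 0" if r: "r \<ge> r1" for r
  proof (rule subexp_iterate[where T = "\<lambda>r. Tchar g h r - 12 * ln (r + 9) - E", OF _ m _ r])
    have E0: "E \<ge> 0" using C(1) C'(1) l32 m by (simp add: E_def B_def)
    show "subexp (\<lambda>r. Tchar g h r - 12 * ln (r + 9) - E)"
    proof (rule subexp_mono[OF sub])
      show "eventually (\<lambda>r. Tchar g h r - 12 * ln (r + 9) - E \<le> Tchar g h r) at_top"
        using eventually_ge_at_top[of 0]
      proof eventually_elim
        fix r :: real assume "r \<ge> 0"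
        then have "0 \<le> ln (r + 9)" by simp
        then show "Tchar g h r - 12 * ln (r + 9) - E \<le> Tchar g h r" using E0 by linarith
      qed
    qed
    fix r assume r: "r \<ge> r1"
    then have r': "r \<ge> 1" using d by (simp add: r1_def)
    have "r + m + 9 \<le> (r + 9) * (1 + m)" using r' m by (simp add: algebra_simps)
    then have "ln (r + m + 9) \<le> ln ((r + 9) * (1 + m))" using r' m by (subst ln_le_cancel_iff) auto
    also have "\<dots> = ln (r + 9) + ln (1 + m)" using r' m by (simp add: ln_mult_pos)
    finally have l: "ln (r + m + 9) \<le> ln (r + 9) + ln (1 + m)" .
    have l0: "0 \<le> ln (r + 9)" using r' by simp
    have "0 \<le> 2 * Tchar g h (r + m) + C" using r' m by (intro C(2)) simp
    then show "Tchar g h r - 12 * ln (r + 9) - E \<le> (Tchar g h (r + m) - 12 * ln (r + m + 9) - E) / 2"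
      using key[OF r] l l0 C(1) unfolding E_def by (simp add: field_simps)
  qed
  then show ?thesis by (intro that[of r1 12 E]) (simp add: algebra_simps)
qed

section \<open>Functions sharing values with their shift\<close>

lemma subexp_shift:
  assumes T: "subexp T" and m: "m \<ge> 0"
  shows "subexp (\<lambda>r. T (r + m) + C)"
  unfolding subexp_def
proof (intro allI impI)
  fix e :: real assume e: "e > 0"
  have "eventually (\<lambda>r. T r \<le> exp (e / 2 * r)) at_top"
    using T[unfolded subexp_def, rule_format, of "e / 2"] e by simp
  then have 1: "eventually (\<lambda>r. T (r + m) \<le> exp (e / 2 * (r + m))) at_top"
    by (rule eventually_compose_filterlim)
       (rule filterlim_at_top_mono[OF filterlim_ident always_eventually], use m in simp)
  have "filterlim (\<lambda>r. e / 2 * r) at_top at_top"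
    by (rule filterlim_tendsto_pos_mult_at_top[OF tendsto_const _ filterlim_ident]) (use e in simp)
  then have "filterlim (\<lambda>r. exp (e / 2 * r)) at_top at_top"
    by (rule filterlim_compose[OF exp_at_top])
  then have 2: "eventually (\<lambda>r. exp (e / 2 * r) \<ge> exp (e / 2 * m) + \<bar>C\<bar>) at_top"
    by (simp add: filterlim_at_top)
  show "eventually (\<lambda>r. T (r + m) + C \<le> exp (e * r)) at_top"
    using 1 2 eventually_ge_at_top[of 0]
  proof eventually_elim
    fix r :: real
    assume a: "T (r + m) \<le> exp (e / 2 * (r + m))" "exp (e / 2 * r) \<ge> exp (e / 2 * m) + \<bar>C\<bar>" "r \<ge> 0"
    have x1: "1 \<le> exp (e / 2 * r)" using a(3) e by simp
    have "T (r + m) + C \<le> exp (e / 2 * r) * exp (e / 2 * m) + \<bar>C\<bar> * exp (e / 2 * r)"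
      using a(1) mult_left_mono[OF x1, of "\<bar>C\<bar>"] by (simp add: distrib_left exp_add)
    also have "\<dots> = exp (e / 2 * r) * (exp (e / 2 * m) + \<bar>C\<bar>)" by (simp add: algebra_simps)
    also have "\<dots> \<le> exp (e / 2 * r) * exp (e / 2 * r)" using a(2) by (intro mult_left_mono) auto
    also have "\<dots> = exp (e * r)" by (simp flip: exp_add)
    finally show "T (r + m) + C \<le> exp (e * r)" .
  qed
qed

lemma entire_mult_eq_0:
  assumes "G holomorphic_on UNIV" "\<exists>z. G z \<noteq> 0" "H holomorphic_on UNIV" "\<And>z. G z * H z = (0::complex)"
  shows "H z = 0"
  using entire_mult_nonzero[OF assms(1-3)] assms(4) by blast

text \<open>The inclusions for zeros and poles are condensed into the existence of the entire
  multiplier \<open>F\<close>. Coprimality turns \<open>g z = h z\<close> into the value 1 of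
  \<open>g / h\<close>, so \<open>share\<close> is the hypothesis on 1-points, and it gives
  \<open>F z = A\<close> there.\<close>

locale shift_sharing = coprime_pair g h for g h +
  fixes F :: "complex \<Rightarrow> complex" and c A :: complex
  assumes gh_nz: "\<exists>z. g z \<noteq> 0" "\<exists>z. h z \<noteq> 0"
    and nonconst: "\<not> (\<exists>k. \<forall>z. g z = k * h z)"
    and F: "F holomorphic_on UNIV" and F_eq: "\<And>z. F z * g z * h (z + c) = g (z + c) * h z"
    and share: "\<And>z. g z = h z \<Longrightarrow> h (z + c) \<noteq> 0 \<and> g (z + c) = A * h (z + c)"
    and c: "c \<noteq> 0" and A: "A \<noteq> 0"
    and sub: "subexp (Tchar g h)"
begin

lemma shift_nz: "\<exists>z. g (z + b) \<noteq> 0" "\<exists>z. h (z + b) \<noteq> 0"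
  using gh_nz by (metis diff_add_cancel)+

lemma F_at_one:
  assumes "g z = h z"
  shows "F z = A"
proof -
  have "g z \<noteq> 0" using coprime[of z] assms by auto
  then show ?thesis using F_eq[of z] share[OF assms] assms by simp
qed

lemma F_nz: "\<exists>z. F z \<noteq> 0"
proof (rule ccontr)
  assume "\<nexists>z. F z \<noteq> 0"
  then have "g (z + c) * h z = 0" for z using F_eq[of z] by simp
  then show False
    using entire_mult_nonzero[OF entire_shift(1)[OF g] shift_nz(1) h gh_nz(2)] by blast
qed

text \<open>If \<open>F\<close> is a constant \<open>k\<close> other than \<open>A\<close>, then
  \<open>f = g / h\<close> omits 1, and shifting back it omits \<open>1 / k\<close> and
  \<open>1 / k^2\<close> as well. For \<open>k\<close> different from 1 and -1 these are three
  distinct values, too many for a nonconstant function.\<close>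

lemma constant_multiplier:
  assumes k: "\<And>z. F z = k"
  shows "k = A \<or> k = 1"
proof (rule ccontr)
  assume "\<not> (k = A \<or> k = 1)"
  then have kA: "k \<noteq> A" and k1: "k \<noteq> 1" by auto
  have k0: "k \<noteq> 0" using F_nz k by auto
  have n0: "g z \<noteq> h z" for z using F_at_one[of z] k kA by auto
  have n1: "k * g z \<noteq> h z" for z
  proof
    assume eq: "k * g z = h z"
    have hz: "h z \<noteq> 0" using coprime[of z] eq k0 by auto
    have "h z * h (z + c) = h z * g (z + c)" using F_eq[of z] by (simp add: k eq)
    then show False using hz n0[of "z + c"] by simp
  qed
  have n2: "k^2 * g z \<noteq> h z" for z
  proof
    assume eq: "k^2 * g z = h z"
    have hz: "h z \<noteq> 0" using coprime[of z] eq k0 by auto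
    have "k^2 * g z * h (z + c) = k * g (z + c) * h z" using arg_cong[OF F_eq[of z], of "(*) k"] by (simp add: k power2_eq_square mult_ac)
    then have "h z * h (z + c) = h z * (k * g (z + c))" by (simp add: eq)
    then show False using hz n1[of "z + c"] by simp
  qed
  show False
  proof (cases "k = -1")
    case False
    \<comment> \<open>A Moebius transform of \<open>f\<close> that sends the omitted values 1,
      \<open>1 / k\<close> and \<open>1 / k^2\<close> to infinity, 0 and
      \<open>k / (k + 1)\<close>.\<close>
    define Y where "Y z = (k * g z - h z) / (g z - h z)" for z
    have "Y holomorphic_on UNIV"
      unfolding Y_def by (intro holomorphic_intros g h) (use n0 in auto)
    moreover have "range Y \<inter> {0, k / (k + 1)} = {}"
    proof -
      have "Y z \<noteq> 0" "Y z \<noteq> k / (k + 1)" for z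
      proof -
        show "Y z \<noteq> 0" using n0[of z] n1[of z] by (simp add: Y_def)
        show "Y z \<noteq> k / (k + 1)"
        proof
          assume "Y z = k / (k + 1)"
          moreover have "k + 1 \<noteq> 0" using False by (simp add: add_eq_0_iff2)
          ultimately have "(k * g z - h z) * (k + 1) = k * (g z - h z)"
            using n0[of z] by (simp add: Y_def frac_eq_eq)
          then have "k^2 * g z = h z" by (simp add: algebra_simps power2_eq_square)
          then show False using n2 by blast
        qed
      qed
      then show ?thesis unfolding disjoint_iff by (metis imageE insertE singletonD)
    qed
    moreover have "0 \<noteq> k / (k + 1)" using k0 False by (simp add: add_eq_0_iff2)
    ultimately obtain y where y: "Y = (\<lambda>_. y)" using little_Picard by blast
    have yz: "(k - y) * g z = (1 - y) * h z" for z
    proof -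
      have "(k * g z - h z) / (g z - h z) = y" using fun_cong[OF y, of z] by (simp add: Y_def)
      then have "k * g z - h z = y * (g z - h z)" using n0[of z] by (simp add: field_simps)
      then show ?thesis by (simp add: algebra_simps)
    qed
    show False
    proof (cases "k = y")
      case True
      then have "h z = 0" for z using yz[of z] k1 by simp
      then show False using gh_nz by blast
    next
      case False
      then have "g z = ((1 - y) / (k - y)) * h z" for z using yz[of z] by (simp add: field_simps)
      then show False using nonconst by blast
    qed
  next
    case True
    have p0: "g z + h z \<noteq> 0" for z using n1[of z] True by (auto simp: add_eq_0_iff)
    have m0: "g z - h z \<noteq> 0" for z using n0[of z] by simp
    \<comment> \<open>For \<open>k = -1\<close> only the two values 1 and -1 are known to be
      omitted, so Picard's theorem does not decide. Sending them to infinity and 0 gives a zero-free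
      entire function, which the change of sign of \<open>f\<close> inverts.\<close>
    define Y where "Y z = (g z + h z) / (g z - h z)" for z
    have Y: "Y holomorphic_on UNIV"
      unfolding Y_def by (intro holomorphic_intros g h) (use m0 in auto)
    have "\<exists>y. \<forall>z. Y z = y"
    proof (rule antiperiodic_constant[OF Y _ _ c])
      show "Y z \<noteq> 0" for z using p0[of z] m0[of z] by (simp add: Y_def)
      show "Y z * Y (z + c) = 1" for z
      proof -
        have "(g z + h z) * (g (z + c) + h (z + c)) - (g z - h z) * (g (z + c) - h (z + c)) =
              2 * (g (z + c) * h z + g z * h (z + c))"
          by (simp add: algebra_simps)
        moreover have "g (z + c) * h z = - (g z * h (z + c))" using F_eq[of z] k[of z] True by simp
        ultimately have "(g z + h z) * (g (z + c) + h (z + c)) = (g z - h z) * (g (z + c) - h (z + c))"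
          by simp
        then show ?thesis using m0[of z] m0[of "z + c"] by (simp add: Y_def)
      qed
      \<comment> \<open>The denominator is zero-free, so its logarithmic mean is constant and the
        transform raises the characteristic by a constant at most.\<close>
      have Tb: "Tone Y r \<le> Tchar g h (r + 0) + (ln 2 - ln (norm (g 0 - h 0)))" if r: "r > 0" for r
      proof -
        have cm: "continuous_on S (\<lambda>z. ln (norm (g z - h z)))" for S
          using m0 by (intro continuous_on_ln_norm continuous_intros entire_continuous_on g h) auto
        have cY: "continuous_on S (Vone Y)" for S
          by (rule coprime_pair.Vmax_continuous[OF coprime_pair_one[OF Y]])
        have "Tone Y r \<le> cmean (\<lambda>z. (Vmax g h z + ln 2) - ln (norm (g z - h z))) r"
          unfolding Tchar_def
        proof (rule cmean_mono)
          fix z :: complex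
          have e: "exp (Vmax g h z) = max (norm (g z)) (norm (h z))"
            using Vmax_arg_pos[of z] by (simp add: Vmax_def)
          have "norm (g z + h z) \<le> 2 * exp (Vmax g h z)" "norm (g z - h z) \<le> 2 * exp (Vmax g h z)"
            using norm_triangle_ineq[of "g z" "h z"] norm_triangle_ineq4[of "g z" "h z"] by (auto simp: e)
          then have "max (norm (Y z)) 1 \<le> 2 * exp (Vmax g h z) / norm (g z - h z)"
            using m0[of z] by (simp add: Y_def norm_divide divide_right_mono)
          then have "ln (max (norm (Y z)) 1) \<le> ln (2 * exp (Vmax g h z) / norm (g z - h z))"
            using m0[of z] by (subst ln_le_cancel_iff) (auto simp: less_max_iff_disj)
          also have "\<dots> = (Vmax g h z + ln 2) - ln (norm (g z - h z))"
            using m0[of z] by (simp add: ln_div ln_mult_pos)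
          finally show "Vone Y z \<le> (Vmax g h z + ln 2) - ln (norm (g z - h z))"
            by (simp add: Vmax_def)
        qed (use r in \<open>auto intro!: continuous_on_diff continuous_on_add continuous_on_const cm cY Vmax_continuous\<close>)
        also have "\<dots> = Tchar g h r + ln 2 - cmean (\<lambda>z. ln (norm (g z - h z))) r"
          using r cm by (simp add: cmean_diff cmean_add Tchar_def continuous_intros Vmax_continuous)
        also have "cmean (\<lambda>z. ln (norm (g z - h z))) r = ln (norm (g 0 - h 0))"
          by (rule cmean_ln_nonvanishing[of "\<lambda>z. g z - h z" "r + 1"])
             (use r m0 in \<open>auto intro!: holomorphic_intros intro: holomorphic_on_subset[OF g] holomorphic_on_subset[OF h]\<close>)
        finally show ?thesis by simp
      qed
      show "subexp (Tone Y)"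
        by (rule subexp_mono[OF subexp_shift[OF sub, of 0] eventually_mono[OF eventually_gt_at_top[of 0] Tb]]) simp
    qed
    then obtain y where y: "\<And>z. Y z = y" by blast
    have yz: "(y - 1) * g z = (y + 1) * h z" for z
    proof -
      have "g z + h z = y * (g z - h z)" using y[of z] m0[of z] by (simp add: Y_def field_simps)
      then show ?thesis by (simp add: algebra_simps)
    qed
    show False
    proof (cases "y = 1")
      case True
      then have "h z = 0" for z using yz[of z] by simp
      then show False using gh_nz by blast
    next
      case False
      then have "g z = ((y + 1) / (y - 1)) * h z" for z using yz[of z] by (simp add: field_simps)
      then show False using nonconst by blast
    qed
  qed
qed

lemma multiplier_constant: "\<exists>k. \<forall>z. F z = k"
proof (rule ccontr)
  assume nc: "\<not> ?thesis"
  define F2 where "F2 z = F z * F (z + c)" for z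
  define F3 where "F3 z = F2 z * F (z + 2 * c)" for z
  have Fs: "(\<lambda>z. F (z + b)) holomorphic_on UNIV" for b by (rule entire_shift(1)[OF F])
  have F2: "F2 holomorphic_on UNIV" unfolding F2_def by (intro holomorphic_intros F Fs)
  have F3: "F3 holomorphic_on UNIV" unfolding F3_def by (intro holomorphic_intros F2 Fs)
  have F_eq1: "F (z + c) * g (z + c) * h (z + 2 * c) = g (z + 2 * c) * h (z + c)" for z
    using F_eq[of "z + c"] by (simp add: add.assoc)
  have F_eq2: "F (z + 2 * c) * g (z + 2 * c) * h (z + 3 * c) = g (z + 3 * c) * h (z + 2 * c)" for z
    using F_eq[of "z + 2 * c"] by (simp add: add.assoc)
  have gsh: "(\<lambda>z. g (z + b)) holomorphic_on UNIV" "(\<lambda>z. h (z + b)) holomorphic_on UNIV" for b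
    by (rule entire_shift(1)[OF g], rule entire_shift(1)[OF h])
  have e2: "F2 z * g z * h (z + 2 * c) = g (z + 2 * c) * h z" for z
  proof -
    \<comment> \<open>Multiplying the relations at \<open>z\<close> and \<open>z + c\<close> gives
      the claim up to a nonzero entire factor, which is then cancelled; this also covers the points
      where the factor vanishes.\<close>
    have "(g (z + c) * h (z + c)) * (F2 z * g z * h (z + 2 * c) - g (z + 2 * c) * h z) = 0" for z
    proof -
      have "(F z * g z * h (z + c)) * (F (z + c) * g (z + c) * h (z + 2 * c)) =
            (g (z + c) * h z) * (g (z + 2 * c) * h (z + c))"
        by (simp only: F_eq F_eq1)
      then show ?thesis by (simp add: F2_def algebra_simps)
    qed
    then have "F2 z * g z * h (z + 2 * c) - g (z + 2 * c) * h z = 0"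
      by (rule entire_mult_eq_0[rotated -1])
         (intro holomorphic_intros g h gsh F2 entire_mult_nonzero shift_nz)+
    then show ?thesis by simp
  qed
  have e3: "F3 z * g z * h (z + 3 * c) = g (z + 3 * c) * h z" for z
  proof -
    have "(g (z + 2 * c) * h (z + 2 * c)) * (F3 z * g z * h (z + 3 * c) - g (z + 3 * c) * h z) = 0" for z
    proof -
      have "(F2 z * g z * h (z + 2 * c)) * (F (z + 2 * c) * g (z + 2 * c) * h (z + 3 * c)) =
            (g (z + 2 * c) * h z) * (g (z + 3 * c) * h (z + 2 * c))"
        by (simp only: e2 F_eq2)
      then show ?thesis by (simp add: F3_def algebra_simps)
    qed
    then have "F3 z * g z * h (z + 3 * c) - g (z + 3 * c) * h z = 0"
      by (rule entire_mult_eq_0[rotated -1])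
         (intro holomorphic_intros g h gsh F3 entire_mult_nonzero shift_nz)+
    then show ?thesis by simp
  qed
  have ncs: "\<exists>z. F (z + b) - k \<noteq> 0" for b k
  proof (rule ccontr)
    assume "\<nexists>z. F (z + b) - k \<noteq> 0"
    then have "F z = k" for z by (metis diff_add_cancel eq_iff_diff_eq_0)
    then show False using nc by blast
  qed
  have F2_nz: "\<exists>z. F2 z \<noteq> 0"
    unfolding F2_def using ncs[of c 0] by (intro entire_mult_nonzero F Fs F_nz) simp
  \<comment> \<open>Otherwise \<open>F z * F (z + c) = 1\<close>, and
    \<open>antiperiodic_constant\<close> would make \<open>F\<close> constant. The growth condition
    it asks for comes from the difference estimate with \<rho> equal to 8 times
    \<open>norm c\<close>, where the factor is exactly 1/2.\<close>
  have F2_ne1: "\<exists>z. 1 - F2 z \<noteq> 0"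
  proof (rule ccontr)
    assume "\<nexists>z. 1 - F2 z \<noteq> 0"
    then have inv: "F z * F (z + c) = 1" for z by (simp add: F2_def)
    have nz: "F z \<noteq> 0" for z using inv[of z] by auto
    obtain C where C: "C \<ge> 0"
      "\<And>F c \<rho> r. F holomorphic_on UNIV \<Longrightarrow> (\<And>z. F z * g z * h (z + c) = g (z + c) * h z) \<Longrightarrow>
         \<rho> > norm c \<Longrightarrow> r \<ge> \<rho> + norm c + 1 \<Longrightarrow>
         Tone F r \<le> 4 * norm c / \<rho> * (2 * Tchar g h (r + (\<rho> + norm c)) + C)"
      by (rule difference_quotient_char[OF gh_nz]) blast
    have "Tone F r \<le> Tchar g h (r + 9 * norm c) + C / 2" if r: "r \<ge> 9 * norm c + 1" for r
    proof -
      have "Tone F r \<le> 4 * norm c / (8 * norm c) * (2 * Tchar g h (r + (8 * norm c + norm c)) + C)"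
        by (rule C(2)[OF F F_eq]) (use c r in auto)
      also have "4 * norm c / (8 * norm c) = 1 / 2" using c by simp
      finally show ?thesis by simp
    qed
    then have "subexp (Tone F)"
      by (intro subexp_mono[OF subexp_shift[OF sub, of "9 * norm c" "C / 2"]]
                eventually_mono[OF eventually_ge_at_top[of "9 * norm c + 1"]]) auto
    from antiperiodic_constant[OF F nz inv c this] show False using nc by blast
  qed
  \<comment> \<open>Where \<open>f (z + j * c) = 1\<close> the sharing condition gives \<open>F (z + j * c) = A\<close>.\<close>
  define D where "D z = (F z - A) * (F z * (F (z + c) - A)) * (F2 z * (F (z + 2 * c) - A)) * F2 z" for z
  define M where "M z = Vone F z + Vone F2 z + Vone F3 z" for z
  note cpF = coprime_pair_one[OF F] and cpF2 = coprime_pair_one[OF F2] and cpF3 = coprime_pair_one[OF F3]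
  have Vb: "norm (G z) \<le> exp (Vone G z)" "0 \<le> Vone G z" for G z
  proof -
    have "0 < max (norm (G z)) (norm (1::complex))" by (simp add: less_max_iff_disj)
    then show "norm (G z) \<le> exp (Vone G z)" by (simp add: Vmax_def)
  qed (simp add: Vmax_def)
  have M0: "0 \<le> M z" for z using Vb(2)[of F] Vb(2)[of F2] Vb(2)[of F3] by (simp add: M_def)
  have MF: "norm (F z) \<le> exp (M z)" "norm (F2 z) \<le> exp (M z)" "norm (F3 z) \<le> exp (M z)" for z
  proof -
    have "Vone F z \<le> M z" "Vone F2 z \<le> M z" "Vone F3 z \<le> M z"
      using Vb(2)[of F z] Vb(2)[of F2 z] Vb(2)[of F3 z] by (simp_all add: M_def)
    then show "norm (F z) \<le> exp (M z)" "norm (F2 z) \<le> exp (M z)" "norm (F3 z) \<le> exp (M z)"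
      using Vb(1)[of F z] Vb(1)[of F2 z] Vb(1)[of F3 z] by (meson exp_le_cancel_iff order_trans)+
  qed
  have "three_targets g h F F2 D M ((1 + norm A) ^ 3)"
  proof unfold_locales
    show "D holomorphic_on UNIV"
      unfolding D_def by (intro holomorphic_intros F F2 Fs)
    show "\<exists>z. D z \<noteq> 0"
      unfolding D_def using ncs[of 0 A] ncs
      by (intro entire_mult_nonzero holomorphic_intros F F2 Fs F_nz F2_nz) auto
    show "\<exists>z. F z - 1 \<noteq> 0" using ncs[of 0 1] by simp
    show "\<exists>z. F2 z - F z \<noteq> 0"
    proof -
      have "\<exists>z. F z * (F (z + c) - 1) \<noteq> 0"
        by (intro entire_mult_nonzero holomorphic_intros F Fs F_nz ncs)
      then show ?thesis by (simp add: F2_def algebra_simps)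
    qed
    show "continuous_on UNIV M"
      unfolding M_def by (intro continuous_intros coprime_pair.Vmax_continuous cpF cpF2 cpF3)
    show "cmean M r \<le> cmean M s" if "0 \<le> r" "r \<le> s" for r s
    proof -
      have "cmean M t = Tone F t + Tone F2 t + Tone F3 t" if "t \<ge> 0" for t
        unfolding M_def Tchar_def using that
        by (simp add: cmean_add continuous_intros coprime_pair.Vmax_continuous cpF cpF2 cpF3)
      then show ?thesis
        using that coprime_pair.Tchar_mono[OF cpF that] coprime_pair.Tchar_mono[OF cpF2 that] coprime_pair.Tchar_mono[OF cpF3 that]
        by simp
    qed
    show "D z = 0" if zero: "g z - h z = 0 \<or> F z * g z - h z = 0 \<or> F2 z * g z - h z = 0" for z
    proof (cases "h z = 0")
      case True
      then have "g z \<noteq> 0" using coprime[of z] by auto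
      \<comment> \<open>At a pole of \<open>f\<close> a form can vanish only through
        \<open>F z = 0\<close> or \<open>F2 z = 0\<close>; the last factor of \<open>D\<close>
        accounts for this.\<close>
      then have "F2 z = 0" using zero True by (auto simp: F2_def)
      then show ?thesis by (simp add: D_def)
    next
      case hz: False
      consider "g z = h z" | "F z * g z = h z" | "F2 z * g z = h z" using zero by auto
      then show ?thesis
      proof cases
        case 1
        then show ?thesis using F_at_one[of z] by (simp add: D_def)
      next
        case 2
        then have "h z * h (z + c) = h z * g (z + c)" using F_eq[of z] by (simp add: mult_ac)
        then have "F (z + c) = A" using hz F_at_one[of "z + c"] by simp
        then show ?thesis by (simp add: D_def)
      next
        case 3
        then have "h z * h (z + 2 * c) = h z * g (z + 2 * c)" using e2[of z] by (simp add: mult_ac)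
        then have "F (z + 2 * c) = A" using hz F_at_one[of "z + 2 * c"] by simp
        then show ?thesis by (simp add: D_def)
      qed
    qed
    show "norm (D z) \<le> (1 + norm A) ^ 3 * exp (4 * M z)" for z
    proof -
      have e1: "1 \<le> exp (M z)" using M0[of z] by simp
      have b: "norm (u - A * v) \<le> (1 + norm A) * exp (M z)" if "norm u \<le> exp (M z)" "norm v \<le> exp (M z)" for u v
      proof -
        have "norm (u - A * v) \<le> norm u + norm A * norm v"
          using norm_triangle_ineq4[of u "A * v"] by (simp add: norm_mult)
        also have "\<dots> \<le> exp (M z) + norm A * exp (M z)"
          using that by (intro add_mono mult_left_mono) auto
        finally show ?thesis by (simp add: algebra_simps)
      qed
      \<comment> \<open>The factors \<open>F\<close> and \<open>F2\<close> in front of the shifted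
        terms of \<open>D\<close> turn these into \<open>F2 - A * F\<close> and
        \<open>F3 - A * F2\<close>. Thus no shifted argument remains and \<open>M\<close> suffices,
        with one \<open>exp (M z)\<close> for each of the four factors.\<close>
      have "D z = (F z - A * 1) * (F2 z - A * F z) * (F3 z - A * F2 z) * F2 z"
        by (simp add: D_def F2_def F3_def algebra_simps)
      then have "norm (D z) = norm (F z - A * 1) * norm (F2 z - A * F z) * norm (F3 z - A * F2 z) * norm (F2 z)"
        by (simp only: norm_mult)
      also have "\<dots> \<le> ((1 + norm A) * exp (M z)) * ((1 + norm A) * exp (M z)) * ((1 + norm A) * exp (M z)) * exp (M z)"
        by (intro mult_mono b MF) (use e1 in auto)
      also have "\<dots> = (1 + norm A) ^ 3 * exp (4 * M z)"
        by (simp add: power3_eq_cube flip: exp_add)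
      finally show ?thesis .
    qed
    show "1 \<le> (1 + norm A) ^ 3" by (rule one_le_power) simp
  qed (use F F2 gh_nz F2_ne1 M0 MF in auto)
  then obtain r1 a b where "\<And>r. r \<ge> r1 \<Longrightarrow> Tchar g h r \<le> a * ln (r + 9) + b"
    using three_targets_slow_growth[OF _ F3 F_eq e2 e3 c sub] unfolding M_def[abs_def] by metis
  from slow_growth_constant[OF gh_nz F F_eq this] show False using nc by blast
qed

theorem shift_dichotomy: "(\<forall>z. F z = A) \<or> (\<forall>z. F z = 1)"
  using multiplier_constant constant_multiplier by metis

end


section \<open>From the meromorphic function to the pair of entire functions\<close>

lemma log_plus_eq: "log_plus x = ln (max x 1)"
  by (simp add: log_plus_def max_def)

lemma zorder_translate:
  fixes f :: "complex \<Rightarrow> complex"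
  shows "zorder (\<lambda>w. f (w + c)) z = zorder f (z + c)"
  using zorder_shift[of "\<lambda>w. f (w + c)" z] zorder_shift[of f "z + c"] by (simp add: add_ac)

lemma is_pole_translate:
  fixes f :: "complex \<Rightarrow> complex"
  shows "is_pole (\<lambda>w. f (w + c)) z \<longleftrightarrow> is_pole f (z + c)"
  using is_pole_shift_0[of "\<lambda>w. f (w + c)" z] is_pole_shift_0[of f "z + c"] by (simp add: add_ac)

lemma entire_zorder:
  assumes "G holomorphic_on UNIV" "\<exists>z. G z \<noteq> 0"
  shows "zorder G z \<ge> 0" "zorder G z = 0 \<longleftrightarrow> G z \<noteq> 0" "zorder G z > 0 \<longleftrightarrow> G z = 0"
proof -
  obtain x where "G x \<noteq> 0" using assms by blast
  then have fr: "frequently (\<lambda>z. G z \<noteq> 0) (at z)"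
    using frequently_at_complexI[OF entire_eventually_nonzero[OF assms(1)]] by blast
  have an: "G analytic_on {z}" by (rule holomorphic_on_imp_analytic_at[OF assms(1)]) auto
  show "zorder G z \<ge> 0" "zorder G z = 0 \<longleftrightarrow> G z \<noteq> 0" "zorder G z > 0 \<longleftrightarrow> G z = 0"
    using zorder_ge_0[OF an fr] zorder_eq_0_iff[OF an fr] zorder_pos_iff'[OF an fr] by auto
qed

lemma entire_meromorphic: "G holomorphic_on UNIV \<Longrightarrow> G meromorphic_on {z}"
  by (intro analytic_on_imp_meromorphic_on holomorphic_on_imp_analytic_at) auto

lemma entire_frequently_nonzero:
  assumes "G holomorphic_on UNIV" "\<exists>z. G z \<noteq> 0"
  shows "frequently (\<lambda>z. G z \<noteq> 0) (at z)"
  using assms frequently_at_complexI[OF entire_eventually_nonzero[OF assms(1)]] by blast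

text \<open>A quotient of nonnegative order has no pole, hence a finite limit at every point, and
  its singularities are removable.\<close>

lemma entire_divides:
  assumes P: "P holomorphic_on UNIV" "\<exists>z. P z \<noteq> 0" and N: "N holomorphic_on UNIV" "\<exists>z. N z \<noteq> 0"
    and zo: "\<And>z. zorder N z \<le> zorder P z"
  obtains Q where "Q holomorphic_on UNIV" "\<And>z. P z = Q z * N z"
proof -
  obtain z1 where z1: "N z1 \<noteq> 0" using N by blast
  obtain zp where zp: "P zp \<noteq> 0" using P by blast
  have bdd: "\<exists>B. eventually (\<lambda>z. norm (P z) \<le> B * norm (N z)) (at z0)" for z0
  proof -
    define f where "f z = P z / N z" for z
    have mero: "f meromorphic_on {z0}"
      unfolding f_def by (intro meromorphic_intros entire_meromorphic P N)
    have "zorder f z0 = zorder P z0 - zorder N z0"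
      unfolding f_def by (intro zorder_divide entire_meromorphic entire_frequently_nonzero P N)
    then have zf: "zorder f z0 \<ge> 0" using zo[of z0] by simp
    have ne: "not_essential f z0" "isolated_singularity_at f z0"
      using mero by (auto intro: meromorphic_on_not_essential meromorphic_on_isolated_singularity)
    have "\<not> is_pole f z0"
      using isolated_pole_imp_neg_zorder[OF ne(2)] zf by force
    then obtain l where "f \<midarrow>z0\<rightarrow> l"
      using ne(1) by (auto simp: not_essential_def)
    then have "((\<lambda>z. norm (f z)) \<longlongrightarrow> norm l) (at z0)" by (rule tendsto_norm)
    then have "eventually (\<lambda>z. norm (f z) < norm l + 1) (at z0)"
      by (rule order_tendstoD(2)) simp
    then have "eventually (\<lambda>z. norm (P z) \<le> (norm l + 1) * norm (N z)) (at z0)"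
      using entire_eventually_nonzero[OF N(1) z1, of z0]
      by eventually_elim (simp add: f_def norm_divide divide_less_eq)
    then show ?thesis by blast
  qed
  show ?thesis using removable_quotient[OF P(1) N(1) z1 bdd] that by blast
qed

text \<open>Weierstrass factorization. The value 0 of \<open>f\<close> at a pole agrees with
  division by zero, so \<open>f = g / h\<close> holds literally at every point.\<close>

lemma meromorphic_coprime_quotient:
  assumes mero: "f nicely_meromorphic_on UNIV" and nonconst: "\<not> (\<exists>k. \<forall>z. f z = k)"
  obtains g h where "coprime_pair g h" "\<exists>z. g z \<noteq> 0" "\<exists>z. h z \<noteq> 0"
    "\<And>z. f z = g z / h z" "\<And>z. is_pole f z \<longleftrightarrow> h z = 0"
    "\<And>z. zorder f z = zorder g z - zorder h z"
proof -
  obtain e f1 f2 where ef: "e holomorphic_on UNIV" "f1 holomorphic_on UNIV" "f2 holomorphic_on UNIV"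
    and z: "\<forall>z. f1 z = 0 \<longleftrightarrow> \<not>is_pole f z \<and> f z = 0" "\<forall>z. f2 z = 0 \<longleftrightarrow> is_pole f z"
    and nz: "\<forall>z. e z \<noteq> 0" and eq: "\<forall>z. f z = e z * f1 z / f2 z"
    using weierstrass_factorization_meromorphic_UNIV[OF mero] by metis
  define g where "g z = e z * f1 z" for z
  have g: "g holomorphic_on UNIV" unfolding g_def by (intro holomorphic_intros ef)
  have fq: "f z = g z / f2 z" for z using eq by (simp add: g_def)
  have g_nz: "\<exists>z. g z \<noteq> 0" using nonconst fq by (metis div_0)
  have h_nz: "\<exists>z. f2 z \<noteq> 0" using nonconst fq by (metis div_by_0)
  have zo: "zorder f z = zorder g z - zorder f2 z" for z
  proof -
    have "f = (\<lambda>z. g z / f2 z)" using fq by blast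
    then show ?thesis
      using zorder_divide[of g z f2] entire_meromorphic entire_frequently_nonzero g ef(3) g_nz h_nz by metis
  qed
  have "coprime_pair g f2"
    by unfold_locales (use g ef z nz in \<open>auto simp: g_def\<close>)
  then show ?thesis
    using that[of g f2] g_nz h_nz fq z(2) zo by blast
qed

text \<open>The contribution of a single modulus \<open>a\<close>, so that \<open>counting\<close>
  can be evaluated pole by pole.\<close>

lemma counting_step_integral:
  fixes a r k :: real
  assumes "0 < a" "0 < r"
  shows "((\<lambda>t. (if a \<le> t then k else 0) / t) has_integral (k * (ln (max r a) - ln a))) {0..r}"
proof (cases "a \<le> r")
  case False
  have "((\<lambda>t. (if a \<le> t then k else 0) / t) has_integral 0) {0..r}"
    by (rule has_integral_is_0) (use False in auto)
  then show ?thesis using False by (simp add: max_def)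
next
  case True
  have "((\<lambda>t. k / t) has_integral (k * ln r - k * ln a)) {a..r}"
  proof (rule fundamental_theorem_of_calculus[OF True])
    fix t assume "t \<in> {a..r}"
    then have "((\<lambda>t. k * ln t) has_real_derivative k / t) (at t within {a..r})"
      using assms by (auto intro!: derivative_eq_intros simp: field_simps)
    then show "((\<lambda>t. k * ln t) has_vector_derivative k / t) (at t within {a..r})"
      by (simp add: has_real_derivative_iff_has_vector_derivative)
  qed
  then have "((\<lambda>t. if t \<in> {a..r} then k / t else 0) has_integral (k * ln r - k * ln a)) {0..r}"
    by (subst has_integral_restrict) (use assms in auto)
  moreover have "(\<lambda>t. if t \<in> {a..r} then k / t else 0) t = (\<lambda>t. (if a \<le> t then k else 0) / t) t" if "t \<in> {0..r}" for t
    using that by simp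
  ultimately have "((\<lambda>t. (if a \<le> t then k else 0) / t) has_integral (k * ln r - k * ln a)) {0..r}"
    by (rule has_integral_eq[rotated])
  then show ?thesis using True by (simp add: max_def right_diff_distrib)
qed

text \<open>Jensen's formula for the denominator. Its constant depends on the outer radius and is
  eliminated by comparison with a fixed radius \<open>s\<close> below the moduli of all nonzero
  zeros, where \<open>max s |a|\<close> is \<open>|a|\<close>. A zero at the origin is split off to
  match the term in \<open>ln r\<close> of \<open>counting\<close>.\<close>

lemma mean_ln_denominator:
  assumes h: "h holomorphic_on UNIV" "\<exists>z. h z \<noteq> 0"
    and pole: "\<And>z. is_pole f z \<longleftrightarrow> h z = 0" and zo: "\<And>z. is_pole f z \<Longrightarrow> - zorder f z = zorder h z"
  obtains C where "\<And>r. r \<ge> 1 \<Longrightarrow> regular h r \<Longrightarrow> cmean (ln_norm h) r \<le> counting f r + C"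
proof -
  obtain z1 where z1: "h z1 \<noteq> 0" using h by blast
  have pc: "pole_count f t = (\<Sum>a\<in>zset h R. if norm a \<le> t then real (zmult h a) else 0)" if "t < R" for t R
  proof -
    have "{z. norm z \<le> t \<and> is_pole f z} = {a\<in>zset h R. norm a \<le> t}"
      using that pole by (auto simp: zset_def)
    moreover have "real_of_int (pole_mult f a) = real (zmult h a)" if "h a = 0" for a
      using pole[of a] zo[of a] that entire_zorder(1)[OF h, of a] by (simp add: pole_mult_def zmult_def)
    ultimately have "pole_count f t = (\<Sum>a\<in>{a\<in>zset h R. norm a \<le> t}. real (zmult h a))"
      unfolding pole_count_def of_int_sum by (intro sum.cong) (auto simp: zset_def)
    then show ?thesis by (simp add: sum.inter_filter[OF finite_zset[OF h(1) z1]])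
  qed
  obtain s where s: "0 < s" "s < 1" "\<And>a. h a = 0 \<Longrightarrow> a \<noteq> 0 \<Longrightarrow> s < norm a"
  proof -
    define s where "s = Min (insert (1/2) ((\<lambda>a. norm a / 2) ` (zset h 1 - {0})))"
    have fin: "finite (insert (1/2) ((\<lambda>a. norm a / 2) ` (zset h 1 - {0})))"
      using finite_zset[OF h(1) z1] by simp
    have "0 < s" unfolding s_def using fin by (subst Min_gr_iff) auto
    moreover have "s \<le> 1/2" unfolding s_def using fin by (intro Min_le) auto
    moreover have "s < norm a" if "h a = 0" "a \<noteq> 0" for a
    proof (cases "norm a < 1")
      case True
      then have "s \<le> norm a / 2" unfolding s_def using fin that by (intro Min_le) (auto simp: zset_def)
      moreover have "norm a > 0" using that by simp
      ultimately show ?thesis by linarith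
    next
      case False
      then show ?thesis using \<open>s \<le> 1/2\<close> by linarith
    qed
    ultimately show ?thesis using that[of s] by simp
  qed
  have regs: "regular h s"
    unfolding regular_def using s by force
  define k0 where "k0 = (if h 0 = 0 then real (zmult h 0) else 0)"
  show ?thesis
  proof (rule that)
    fix r :: real assume r: "r \<ge> 1" "regular h r"
    define S where "S = zset h (r + 1)"
    define k where "k a = real (zmult h a)" for a
    have finS: "finite S" unfolding S_def by (rule finite_zset[OF h(1) z1])
    obtain K where K: "\<And>t. 0 < t \<Longrightarrow> t < r + 1 \<Longrightarrow> regular h t \<Longrightarrow>
       cmean (ln_norm h) t = (\<Sum>a\<in>S. k a * ln (max t (norm a))) + K"
      using jensen[OF h(1) z1, of "r + 1"] r unfolding S_def k_def by auto
    have split: "(\<Sum>a\<in>S. G a) = (\<Sum>a\<in>S - {0}. G a) + (if h 0 = 0 then G 0 else 0)" for G :: "complex \<Rightarrow> real"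
    proof (cases "h 0 = 0")
      case True
      then have "0 \<in> S" using r by (simp add: S_def zset_def)
      then show ?thesis using sum.remove[OF finS, of 0 G] True by simp
    next
      case False
      then have "0 \<notin> S" by (simp add: S_def zset_def)
      then show ?thesis using False by simp
    qed
    have n0: "pole_count f 0 = k0"
      using pc[of 0 "r + 1"] r split[of "\<lambda>a. if norm a \<le> 0 then real (zmult h a) else 0"]
      by (simp add: S_def k0_def)
    have pct: "pole_count f t - pole_count f 0 = (\<Sum>a\<in>S - {0}. if norm a \<le> t then k a else 0)" if "0 \<le> t" "t \<le> r" for t
      using pc[of t "r + 1"] that split[of "\<lambda>a. if norm a \<le> t then k a else 0"]
      unfolding n0 S_def k_def k0_def by simp
    have "((\<lambda>t. \<Sum>a\<in>S - {0}. (if norm a \<le> t then k a else 0) / t) has_integral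
           (\<Sum>a\<in>S - {0}. k a * (ln (max r (norm a)) - ln (norm a)))) {0..r}"
      by (intro has_integral_sum counting_step_integral) (use finS r in auto)
    moreover have "(\<Sum>a\<in>S - {0}. (if norm a \<le> t then k a else 0) / t) = (pole_count f t - pole_count f 0) / t" if "t \<in> {0..r}" for t
      using that by (simp add: pct sum_divide_distrib)
    ultimately have "((\<lambda>t. (pole_count f t - pole_count f 0) / t) has_integral
           (\<Sum>a\<in>S - {0}. k a * (ln (max r (norm a)) - ln (norm a)))) {0..r}"
      by (rule has_integral_eq[rotated])
    then have cnt: "counting f r = (\<Sum>a\<in>S - {0}. k a * (ln (max r (norm a)) - ln (norm a))) + k0 * ln r"
      by (simp add: counting_def integral_unique n0)
    have "cmean (ln_norm h) r - cmean (ln_norm h) s =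
          (\<Sum>a\<in>S. k a * (ln (max r (norm a)) - ln (max s (norm a))))"
      using K[of r] K[of s] r s regs by (simp add: sum_subtractf right_diff_distrib)
    also have "\<dots> = (\<Sum>a\<in>S - {0}. k a * (ln (max r (norm a)) - ln (max s (norm a)))) + k0 * (ln r - ln s)"
      using split[of "\<lambda>a. k a * (ln (max r (norm a)) - ln (max s (norm a)))"] r s by (simp add: k0_def k_def max_def)
    also have "(\<Sum>a\<in>S - {0}. k a * (ln (max r (norm a)) - ln (max s (norm a)))) =
               (\<Sum>a\<in>S - {0}. k a * (ln (max r (norm a)) - ln (norm a)))"
    proof (rule sum.cong)
      fix a assume "a \<in> S - {0}"
      then have "s < norm a" using s(3)[of a] by (auto simp: S_def zset_def)
      then show "k a * (ln (max r (norm a)) - ln (max s (norm a))) = k a * (ln (max r (norm a)) - ln (norm a))"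
        by (simp add: max_def)
    qed simp
    also have "\<dots> + k0 * (ln r - ln s) = counting f r - k0 * ln s"
      by (simp add: cnt right_diff_distrib)
    finally show "cmean (ln_norm h) r \<le> counting f r + (cmean (ln_norm h) s - k0 * ln s)"
      by simp
  qed
qed

lemma hyper_order_bound:
  assumes "hyper_order f < 1"
  obtains s where "s < 1" "eventually (\<lambda>r. nevanlinna_T f r \<le> exp (r powr s)) at_top"
proof -
  obtain s where s: "hyper_order f < ereal s" "ereal s < 1"
    using ereal_dense2[OF assms] by auto
  have "eventually (\<lambda>r. ereal (ln (ln (nevanlinna_T f r)) / ln r) < ereal s) at_top"
    using s(1) unfolding hyper_order_def by (rule Limsup_lessD)
  then have "eventually (\<lambda>r. nevanlinna_T f r \<le> exp (r powr s)) at_top"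
    using eventually_gt_at_top[of 1]
  proof eventually_elim
    fix r :: real assume a: "ereal (ln (ln (nevanlinna_T f r)) / ln r) < ereal s" "r > 1"
    define T where "T = nevanlinna_T f r"
    have l: "ln (ln T) < s * ln r"
      using a by (simp add: T_def divide_less_eq)
    show "nevanlinna_T f r \<le> exp (r powr s)"
    \<comment> \<open>For \<open>T\<close> at most 1 the iterated logarithm carries no information,
      but then the bound is trivial.\<close>
    proof (cases "T \<le> 1")
      case True
      have "1 \<le> exp (r powr s)" by simp
      then show ?thesis using True unfolding T_def by linarith
    next
      case False
      then have "ln T > 0" by simp
      then have "ln T = exp (ln (ln T))" by simp
      also have "\<dots> \<le> exp (s * ln r)" using l by simp
      also have "\<dots> = r powr s" using a(2) by (simp add: powr_def)
      finally have "exp (ln T) \<le> exp (r powr s)" by (simp only: exp_le_cancel_iff)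
      moreover have "exp (ln T) = T" using False by (intro exp_ln) simp
      ultimately show ?thesis by (simp only: T_def)
    qed
  qed
  with s(2) show ?thesis by (intro that[of s]) auto
qed

text \<open>On a regular circle \<open>Vmax g h\<close> is ln |h| + log+ |f|, so Cartan's form is at
  most the Nevanlinna characteristic plus a constant; monotonicity covers the other radii. A bound
  \<open>exp (r powr s)\<close> with \<open>s < 1\<close> is subexponential.\<close>

lemma (in coprime_pair) subexp_Tchar:
  assumes nz: "\<exists>z. h z \<noteq> 0" and f: "\<And>z. f z = g z / h z"
    and pole: "\<And>z. is_pole f z \<longleftrightarrow> h z = 0" and zo: "\<And>z. is_pole f z \<Longrightarrow> - zorder f z = zorder h z"
    and hyp: "hyper_order f < 1"
  shows "subexp (Tchar g h)"
proof -
  obtain z1 where z1: "h z1 \<noteq> 0" using nz by blast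
  obtain s where s: "s < 1" "eventually (\<lambda>r. nevanlinna_T f r \<le> exp (r powr s)) at_top"
    using hyper_order_bound[OF hyp] by blast
  obtain C where C: "\<And>r. r \<ge> 1 \<Longrightarrow> regular h r \<Longrightarrow> cmean (ln_norm h) r \<le> counting f r + C"
    using mean_ln_denominator[OF h nz pole zo] by blast
  obtain r1 where r1: "\<And>r. r \<ge> r1 \<Longrightarrow> nevanlinna_T f r \<le> exp (r powr s)"
    using s(2) by (auto simp: eventually_at_top_linorder)
  have reg: "Tchar g h r \<le> nevanlinna_T f r + C" if r: "r \<ge> 1" "regular h r" for r
  proof -
    have hz: "h z \<noteq> 0" if "norm z = r" for z :: complex using r that by (auto simp: regular_def)
    have ch: "continuous_on (sphere 0 r) (ln_norm h)" by (rule regular_ln_continuous[OF h r(2)])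
    have cf: "continuous_on (sphere 0 r) (\<lambda>z. log_plus (norm (f z)))"
      unfolding log_plus_eq f using hz
      by (intro continuous_intros entire_continuous_on g h) (auto simp: max_def)
    have "Tchar g h r = cmean (\<lambda>z. ln (norm (h z)) + log_plus (norm (f z))) r"
      unfolding Tchar_def
    proof (rule cmean_cong)
      fix z :: complex assume "norm z = r"
      then have n: "norm (h z) > 0" using hz by simp
      have "max (norm (g z)) (norm (h z)) = norm (h z) * max (norm (f z)) 1"
        using n by (simp add: f norm_divide max_mult_distrib_left)
      moreover have "0 < max (norm (f z)) 1" by (simp add: less_max_iff_disj)
      ultimately show "Vmax g h z = ln (norm (h z)) + log_plus (norm (f z))"
        unfolding Vmax_def log_plus_eq using n by (simp only: ln_mult_pos)
    qed (use r in simp)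
    also have "\<dots> = cmean (ln_norm h) r + proximity f r"
      using ch cf r by (subst cmean_add) (auto simp: proximity_def cmean_def)
    finally show ?thesis using C[OF r] by (simp add: nevanlinna_T_def)
  qed
  \<comment> \<open>A nonnegative exponent makes the power increase with the radius.\<close>
  define s' where "s' = max s 0"
  have s': "s' < 1" "0 \<le> s'" using s(1) by (auto simp: s'_def)
  have bound: "Tchar g h r \<le> exp ((r + 1) powr s') + C" if r: "r \<ge> max 1 r1" for r
  proof -
    obtain t where t: "r < t" "t < r + 1" "regular h t"
      using ex_regular[OF h z1, of r "r + 1"] r by auto
    have "Tchar g h r \<le> Tchar g h t" using t r by (intro Tchar_mono) auto
    also have "\<dots> \<le> nevanlinna_T f t + C" using t r by (intro reg) auto
    also have "\<dots> \<le> exp (t powr s) + C" using r1[of t] t r by simp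
    also have "t powr s \<le> t powr s'" using t r by (intro powr_mono) (auto simp: s'_def)
    also have "\<dots> \<le> (r + 1) powr s'" using t r s' by (intro powr_mono2) auto
    finally show ?thesis by simp
  qed
  have "subexp (\<lambda>r. exp (r powr s'))"
    unfolding subexp_def
  proof (intro allI impI)
    fix e :: real assume e: "e > 0"
    have "((\<lambda>r. r powr (s' - 1)) \<longlongrightarrow> 0) at_top"
      by (rule tendsto_neg_powr[OF _ filterlim_ident]) (use s' in simp)
    then have "eventually (\<lambda>r. r powr (s' - 1) < e) at_top"
      using e by (rule order_tendstoD(2))
    then show "eventually (\<lambda>r. exp (r powr s') \<le> exp (e * r)) at_top"
      using eventually_gt_at_top[of 0]
    proof eventually_elim
      fix r :: real assume r: "r powr (s' - 1) < e" "r > 0"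
      have "r powr s' = r powr (s' - 1) * r" using r(2) by (simp add: powr_diff)
      also have "\<dots> \<le> e * r" using r by (intro mult_right_mono) auto
      finally show "exp (r powr s') \<le> exp (e * r)" by simp
    qed
  qed
  from subexp_shift[OF this, of 1 C] show ?thesis
    by (rule subexp_mono) (use bound in \<open>auto simp: eventually_at_top_linorder intro!: exI[of _ "max 1 r1"]\<close>)
qed

theorem theorem2:
  fixes f :: "complex \<Rightarrow> complex" and c A :: complex
  assumes mero: "f nicely_meromorphic_on UNIV"
    and nonconst: "\<not> (\<exists>k. \<forall>z. f z = k)"
    and hyp: "hyper_order f < 1"
    and c_nz: "c \<noteq> 0"
    and A_nz: "A \<noteq> 0"
    and E0: "\<forall>z. apoint_mult f 0 z > 0 \<longrightarrow>
               apoint_mult (\<lambda>w. f (w + c)) 0 z \<ge> apoint_mult f 0 z"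
    and Einf: "\<forall>z. pole_mult (\<lambda>w. f (w + c)) z > 0 \<longrightarrow>
               pole_mult f z \<ge> pole_mult (\<lambda>w. f (w + c)) z"
    and E1: "\<forall>z. (\<not> is_pole f z \<and> f z = 1) \<longrightarrow>
               (\<not> is_pole (\<lambda>w. f (w + c)) z \<and> f (z + c) = A)"
  shows "(\<forall>z. f (z + c) = A * f z) \<or> (\<forall>z. f (z + c) = f z)"
proof -
  obtain g h where cp: "coprime_pair g h" and nz: "\<exists>z. g z \<noteq> 0" "\<exists>z. h z \<noteq> 0"
    and f: "\<And>z. f z = g z / h z" and pole: "\<And>z. is_pole f z \<longleftrightarrow> h z = 0"
    and zo: "\<And>z. zorder f z = zorder g z - zorder h z"
    using meromorphic_coprime_quotient[OF mero nonconst] by blast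
  interpret coprime_pair g h by (rule cp)
  note zg = entire_zorder[OF g nz(1)] and zh = entire_zorder[OF h nz(2)]
  \<comment> \<open>As \<open>g\<close> and \<open>h\<close> have no common zero, multiplicities of
    zeros and poles of \<open>f\<close> are orders of \<open>g\<close> and \<open>h\<close>
    respectively.\<close>
  have ap: "apoint_mult f 0 z = (if g z = 0 then zorder g z else 0)" for z
    using pole[of z] f[of z] coprime[of z] zo[of z] zh(2)[of z] by (auto simp: apoint_mult_def)
  have pm: "pole_mult f z = (if h z = 0 then zorder h z else 0)" for z
    using pole[of z] coprime[of z] zo[of z] zg(2)[of z] by (auto simp: pole_mult_def)
  have aps: "apoint_mult (\<lambda>w. f (w + c)) 0 z = apoint_mult f 0 (z + c)" for z
    by (simp add: apoint_mult_def is_pole_translate zorder_translate)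
  have pms: "pole_mult (\<lambda>w. f (w + c)) z = pole_mult f (z + c)" for z
    by (simp add: pole_mult_def is_pole_translate zorder_translate)
  have zg_le: "zorder g z \<le> zorder g (z + c)" for z
    using E0[rule_format, of z] zg[of z] zg[of "z + c"] unfolding aps ap by (auto split: if_splits)
  have zh_le: "zorder h (z + c) \<le> zorder h z" for z
    using Einf[rule_format, of z] zh[of z] zh[of "z + c"] unfolding pms pm by (auto split: if_splits)
  have sh: "(\<lambda>z. g (z + c)) holomorphic_on UNIV" "(\<lambda>z. h (z + c)) holomorphic_on UNIV"
    using entire_shift(1)[OF g] entire_shift(1)[OF h] by auto
  have shnz: "\<exists>z. g (z + c) \<noteq> 0" "\<exists>z. h (z + c) \<noteq> 0"
    using nz by (metis diff_add_cancel)+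
  have zsum: "zorder (\<lambda>z. g z * h (z + c)) z \<le> zorder (\<lambda>z. g (z + c) * h z) z" for z
  proof -
    have "zorder (\<lambda>z. g z * h (z + c)) z = zorder g z + zorder h (z + c)"
      using zorder_mult[OF entire_meromorphic[OF g] entire_frequently_nonzero[OF g nz(1)]
        entire_meromorphic[OF sh(2)] entire_frequently_nonzero[OF sh(2) shnz(2)]] by (simp add: zorder_translate)
    moreover have "zorder (\<lambda>z. g (z + c) * h z) z = zorder g (z + c) + zorder h z"
      using zorder_mult[OF entire_meromorphic[OF sh(1)] entire_frequently_nonzero[OF sh(1) shnz(1)]
        entire_meromorphic[OF h] entire_frequently_nonzero[OF h nz(2)]] by (simp add: zorder_translate)
    ultimately show ?thesis using zg_le[of z] zh_le[of z] by simp
  qed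
  \<comment> \<open>The inequalities between orders say that the denominator of
    \<open>f (z + c) / f z\<close>, cleared of fractions, divides its numerator.\<close>
  obtain F where F: "F holomorphic_on UNIV" "\<And>z. g (z + c) * h z = F z * (g z * h (z + c))"
  proof (rule entire_divides[of "\<lambda>z. g (z + c) * h z" "\<lambda>z. g z * h (z + c)"])
    show "\<exists>z. g (z + c) * h z \<noteq> 0" "\<exists>z. g z * h (z + c) \<noteq> 0"
      by (intro entire_mult_nonzero g h sh nz shnz)+
  qed (use zsum in \<open>auto intro!: holomorphic_intros g h sh\<close>)
  have ss: "shift_sharing g h F c A"
  proof unfold_locales
    show "\<not> (\<exists>k. \<forall>z. g z = k * h z)"
    proof
      assume "\<exists>k. \<forall>z. g z = k * h z"
      then obtain k where k: "\<And>z. g z = k * h z" by blast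
      then have "h z \<noteq> 0" for z using coprime[of z] by auto
      then have "f z = k" for z using k f by simp
      then show False using nonconst by blast
    qed
    show "h (z + c) \<noteq> 0 \<and> g (z + c) = A * h (z + c)" if "g z = h z" for z
    proof -
      have "h z \<noteq> 0" using coprime[of z] that by auto
      then have "\<not> is_pole f z \<and> f z = 1" using pole f that by simp
      then have "h (z + c) \<noteq> 0" "f (z + c) = A"
        using E1[rule_format, of z] pole by (auto simp: is_pole_translate)
      then show ?thesis using f[of "z + c"] by (auto simp: field_simps)
    qed
    show "subexp (Tchar g h)"
    proof (rule subexp_Tchar[OF nz(2) f pole _ hyp])
      show "- zorder f z = zorder h z" if "is_pole f z" for z
        using pm[of z] pole[of z] that by (simp add: pole_mult_def)
    qed
  qed (use nz F c_nz A_nz in \<open>auto simp: mult.assoc\<close>)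
  have quot: "f (z + c) = F z * f z" if "F z \<noteq> 0" for z
  proof -
    have e: "g (z + c) * h z = F z * g z * h (z + c)" using F(2)[of z] by (simp add: mult.assoc)
    show ?thesis
    proof (cases "h z = 0 \<or> h (z + c) = 0")
      case False
      then show ?thesis using e by (simp add: f field_simps)
    next
      case True
      \<comment> \<open>Where \<open>F\<close> does not vanish, the poles of \<open>f\<close> and of
        its shift coincide, and both functions take the value 0 there by convention.\<close>
      then have "h z = 0" "h (z + c) = 0"
        using e \<open>F z \<noteq> 0\<close> coprime[of z] coprime[of "z + c"] by auto
      then show ?thesis by (simp add: f)
    qed
  qed
  from shift_sharing.shift_dichotomy[OF ss] show ?thesis
    using quot A_nz by auto
qed

end
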